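(* Let $k$ be an integer and $m$ a positive integer. Let $g\in J^{\mathrm{cusp}}_{k,m}$ have Fourier expansion $g(\tau,z)=\sum_ng_n(\zeta)q^n$, $g_n(\zeta)=\sum_rc(n,r;g)\zeta^r$. Let $m'<m$ be a nonnegative integer and let $\theta\in J^{\mathrm{cusp}}_{k,m'}$ be a Jacobi cusp form that is a basic theta block, $$\theta(\tau,z)=\eta(\tau)^{\nu(0)}(\vartheta(\tau,z)/\eta(\tau))^{\nu(1)}\prod_{r\ge2}\mathrm{atom}_r(\tau,z)^{\nu(r)},$$ where $\nu:\mathbb{Z}_{\ge0}\to\mathbb{Z}$ is finitely supported and nonnegative on $\mathbb{Z}_{>0}$, with baby theta block $$b(\zeta)=\zeta^{-\frac12\sum_{r\ge1}\mathrm{tot}(r)\nu(r)}\prod_{r\ge1}\Phi_r(\zeta)^{\nu(r)}\in\mathbb{Z}[\zeta,\zeta^{-1}],$$ where $\mathrm{tot}$ is Euler's totient function and $\Phi_r$ is the $r$-th cyclotomic polynomial. For $r\ge1$ let $\Gamma(r,m)=\{\left(\begin{smallmatrix}a&b\\c&d\end{smallmatrix}\right)\in SL_2(\mathbb{Z}):a\equiv d\equiv1,\ c\equiv0\bmod r,\ cm\equiv0\bmod r^2\}$. Then $b(\zeta)$ divides the Fourier expansion of $g$ in $\mathbb{C}[\zeta,\zeta^{-1}][[q]]$ if and only if $b(\zeta)$ divides $g_n(\zeta)$ in $\mathbb{C}[\zeta,\zeta^{-1}]$ for all $n\le\max_{r\ge1:\,\nu(r)>0}\frac{k+\nu(r)-1}{12}[SL_2(\mathbb{Z}):\Gamma(r,m)]$.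 Furthermore, these two equivalent conditions are implied by the condition that $b(\zeta)$ divides $g_n(\zeta)$ in $\mathbb{C}[\zeta,\zeta^{-1}]$ for all $n\le\max_{r\ge1:\,\nu(r)>0}\frac{k+\nu(r)-1}{12}\,r^3\prod_{p\mid r}(1-1/p^2)$, the product taken over the prime divisors $p$ of $r$.
   Context: $e(w)=e^{2\pi iw}$, $q=e(\tau)$, $\zeta=e(z)$. $J^{\mathrm{cusp}}_{k,m}$ is the space of Jacobi cusp forms of weight $k$ and index $m$ (level one, trivial character): holomorphic $g$ on $\mathbb{H}\times\mathbb{C}$ with $g(\frac{a\tau+b}{c\tau+d},\frac z{c\tau+d})=(c\tau+d)^ke(\frac{mcz^2}{c\tau+d})g(\tau,z)$ for $SL_2(\mathbb{Z})$, $g(\tau,z+\lambda\tau+\mu)=e(-m\lambda^2\tau-2m\lambda z)g(\tau,z)$ for $\lambda,\mu\in\mathbb{Z}$, and Fourier expansion $\sum c(n,r)q^n\zeta^r$ supported on $4nm-r^2>0$ (for $m=0$: supported on $n>0$, $r=0$). $\eta(\tau)=q^{1/24}\prod_{n\ge1}(1-q^n)$, $\vartheta(\tau,z)=q^{1/8}(\zeta^{1/2}-\zeta^{-1/2})\prod_{n\ge1}(1-q^n\zeta)(1-q^n\zeta^{-1})(1-q^n)$, $\vartheta_s(\tau,z)=\vartheta(\tau,sz)$, and $\mathrm{atom}_r=\prod_{s\mid r}\vartheta_s^{\mu(r/s)}$ with $\mu$ the Möbius function. A basic theta block is a product of powers of $\eta$ and $\vartheta_s$ that is a weakly holomorphic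 Jacobi form of integral weight and nonnegative integral index. *)

theory Defs
  imports
    "HOL-Analysis.Analysis"
    "HOL-Computational_Algebra.Computational_Algebra"
    "HOL-Number_Theory.Number_Theory"
    "HOL-Algebra.Coset"
    "HOL-Library.Poly_Mapping"
begin

definition e2pii :: "complex \<Rightarrow> complex" where
  "e2pii w = exp (2 * of_real pi * \<i> * w)"


section \<open>Jacobi forms\<close>

text \<open>
  Functions on the product of the upper half plane and the complex plane are curried; their values
  for Im \<tau> \<le> 0 are irrelevant.  Holomorphy in two variables means that the real Frechet derivative
  exists and is complex linear.
\<close>

definition holomorphic_HC :: "(complex \<Rightarrow> complex \<Rightarrow> complex) \<Rightarrow> bool" where
  "holomorphic_HC g \<longleftrightarrow>
     (\<forall>\<tau> z. Im \<tau> > 0 \<longrightarrow>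
       (\<exists>\<alpha> \<beta>. ((\<lambda>(t, w). g t w) has_derivative (\<lambda>(h, h'). \<alpha> * h + \<beta> * h')) (at (\<tau>, z))))"

definition jacobi_transforms :: "int \<Rightarrow> int \<Rightarrow> (complex \<Rightarrow> complex \<Rightarrow> complex) \<Rightarrow> bool" where
  "jacobi_transforms k m g \<longleftrightarrow>
     (\<forall>(a::int) b c d \<tau> z. a * d - b * c = 1 \<longrightarrow> Im \<tau> > 0 \<longrightarrow>
        g ((of_int a * \<tau> + of_int b) / (of_int c * \<tau> + of_int d)) (z / (of_int c * \<tau> + of_int d)) =
        (of_int c * \<tau> + of_int d) powi k *
          e2pii (of_int m * of_int c * z\<^sup>2 / (of_int c * \<tau> + of_int d)) * g \<tau> z) \<and>
     (\<forall>(l::int) (u::int) \<tau> z. Im \<tau> > 0 \<longrightarrow>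
        g \<tau> (z + of_int l * \<tau> + of_int u) =
        e2pii (- of_int m * (of_int l)\<^sup>2 * \<tau> - 2 * of_int m * of_int l * z) * g \<tau> z)"

text \<open>
  The double series over all integers n, r converges unconditionally, so it determines the
  coefficients.
\<close>

definition has_fourier_expansion ::
    "(complex \<Rightarrow> complex \<Rightarrow> complex) \<Rightarrow> (int \<Rightarrow> int \<Rightarrow> complex) \<Rightarrow> bool" where
  "has_fourier_expansion g c \<longleftrightarrow>
     (\<forall>\<tau> z. Im \<tau> > 0 \<longrightarrow>
       ((\<lambda>(n, r). c n r * e2pii (of_int n * \<tau>) * e2pii (of_int r * z)) has_sum g \<tau> z) UNIV)"

definition jacobi_wh :: "int \<Rightarrow> int \<Rightarrow> (complex \<Rightarrow> complex \<Rightarrow> complex) set" where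
  "jacobi_wh k m = {g. holomorphic_HC g \<and> jacobi_transforms k m g \<and>
     (\<exists>c. has_fourier_expansion g c \<and> (\<exists>N. \<forall>n r. c n r \<noteq> 0 \<longrightarrow> n \<ge> N))}"

definition jacobi_cusp :: "int \<Rightarrow> int \<Rightarrow> (complex \<Rightarrow> complex \<Rightarrow> complex) set" where
  "jacobi_cusp k m = {g. holomorphic_HC g \<and> jacobi_transforms k m g \<and>
     (\<exists>c. has_fourier_expansion g c \<and>
       (\<forall>n r. c n r \<noteq> 0 \<longrightarrow> (if m = 0 then n > 0 \<and> r = 0 else 4 * n * m - r\<^sup>2 > 0)))}"


section \<open>Theta blocks\<close>

definition eta :: "complex \<Rightarrow> complex" where
  "eta \<tau> = e2pii (\<tau> / 24) * prodinf (\<lambda>n. 1 - e2pii \<tau> ^ Suc n)"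

definition jtheta :: "complex \<Rightarrow> complex \<Rightarrow> complex" where
  "jtheta \<tau> z = e2pii (\<tau> / 8) * (e2pii (z / 2) - e2pii (- z / 2)) *
     prodinf (\<lambda>n. (1 - e2pii \<tau> ^ Suc n * e2pii z) * (1 - e2pii \<tau> ^ Suc n * e2pii (- z)) *
           (1 - e2pii \<tau> ^ Suc n))"

definition jtheta_mult :: "nat \<Rightarrow> complex \<Rightarrow> complex \<Rightarrow> complex" where
  "jtheta_mult s \<tau> z = jtheta \<tau> (of_nat s * z)"

definition moebius_mu :: "nat \<Rightarrow> int" where
  "moebius_mu n = (if squarefree n then (-1) ^ card (prime_factors n) else 0)"

definition atom :: "nat \<Rightarrow> complex \<Rightarrow> complex \<Rightarrow> complex" where
  "atom r \<tau> z = (\<Prod>s | s dvd r. jtheta_mult s \<tau> z powi moebius_mu (r div s))"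

definition eta_theta_product :: "(nat \<Rightarrow> int) \<Rightarrow> complex \<Rightarrow> complex \<Rightarrow> complex" where
  "eta_theta_product d \<tau> z =
     eta \<tau> powi d 0 * (\<Prod>s | s \<ge> 1 \<and> d s \<noteq> 0. jtheta_mult s \<tau> z powi d s)"

definition theta_block :: "(nat \<Rightarrow> int) \<Rightarrow> complex \<Rightarrow> complex \<Rightarrow> complex" where
  "theta_block \<nu> \<tau> z =
     eta \<tau> powi \<nu> 0 * (jtheta \<tau> z / eta \<tau>) powi \<nu> 1 *
     (\<Prod>r | r \<ge> 2 \<and> \<nu> r \<noteq> 0. atom r \<tau> z powi \<nu> r)"

text \<open>
  Products with negative powers of theta functions are identities of meromorphic functions: where a
  theta function vanishes, the value given by \<open>x / 0 = 0\<close> is not that of the analytic continuation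
  (for instance atom 2 is 2 at z = 0).  Hence functions are compared at those z for which no
  multiple s z, s \<ge> 1, is a zero of theta, that is, off the torsion points; for each \<tau> these z are
  dense, so a holomorphic function is determined by its values there.
\<close>

definition eq_off_torsion ::
    "(complex \<Rightarrow> complex \<Rightarrow> complex) \<Rightarrow> (complex \<Rightarrow> complex \<Rightarrow> complex) \<Rightarrow> bool" where
  "eq_off_torsion f h \<longleftrightarrow>
     (\<forall>\<tau> z. Im \<tau> > 0 \<longrightarrow> (\<forall>s\<ge>1. jtheta_mult s \<tau> z \<noteq> 0) \<longrightarrow> f \<tau> z = h \<tau> z)"

definition basic_theta_block :: "(complex \<Rightarrow> complex \<Rightarrow> complex) \<Rightarrow> bool" where
  "basic_theta_block f \<longleftrightarrow>
     (\<exists>d. finite {s. d s \<noteq> 0} \<and> eq_off_torsion f (eta_theta_product d)) \<and>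
     (\<exists>k m. m \<ge> 0 \<and> f \<in> jacobi_wh k m)"


section \<open>Laurent polynomials and the baby theta block\<close>

type_synonym laurent = "int \<Rightarrow>\<^sub>0 complex"

text \<open>
  The Laurent polynomial \<open>g\<^sub>n(\<zeta>)\<close>.  It is meaningful only if \<open>c n r \<noteq> 0\<close> for finitely many r,
  as is the case for Jacobi cusp forms.
\<close>

definition q_coeff :: "(int \<Rightarrow> int \<Rightarrow> complex) \<Rightarrow> int \<Rightarrow> laurent" where
  "q_coeff c n = Abs_poly_mapping (c n)"

text \<open>
  The Fourier expansion as a power series in q; the coefficients with \<open>n < 0\<close>, which vanish for
  Jacobi cusp forms, are dropped.
\<close>

definition q_expansion :: "(int \<Rightarrow> int \<Rightarrow> complex) \<Rightarrow> laurent fps" where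
  "q_expansion c = Abs_fps (\<lambda>n. q_coeff c (int n))"

definition cyclotomic :: "nat \<Rightarrow> complex poly" where
  "cyclotomic r = (\<Prod>j\<in>totatives r. [:- e2pii (of_nat j / of_nat r), 1:])"

definition laurent_of_poly :: "complex poly \<Rightarrow> laurent" where
  "laurent_of_poly p = (\<Sum>i\<le>Polynomial.degree p. Poly_Mapping.single (int i) (poly.coeff p i))"

text \<open>
  The sum of \<open>tot(r) \<nu>(r)\<close> is even whenever the theta block has integral index, so the integer
  division is exact.  The coefficients are integers, but the ring of complex Laurent polynomials is
  the one in which divisibility is considered.
\<close>

definition baby_theta_block :: "(nat \<Rightarrow> int) \<Rightarrow> laurent" where
  "baby_theta_block \<nu> =
     Poly_Mapping.single (- ((\<Sum>r | r \<ge> 1 \<and> \<nu> r \<noteq> 0. int (totient r) * \<nu> r) div 2)) 1 *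
     (\<Prod>r | r \<ge> 1 \<and> \<nu> r \<noteq> 0. laurent_of_poly (cyclotomic r) ^ nat (\<nu> r))"


section \<open>The groups\<close>

definition SL2Z :: "(int ^ 2 ^ 2) monoid" where
  "SL2Z = \<lparr>carrier = {A. det A = 1}, mult = (**), one = mat 1\<rparr>"

definition Gamma_rm :: "nat \<Rightarrow> int \<Rightarrow> (int ^ 2 ^ 2) set" where
  "Gamma_rm r m = {A \<in> carrier SL2Z.
     [A $ 1 $ 1 = 1] (mod int r) \<and> [A $ 2 $ 2 = 1] (mod int r) \<and>
     [A $ 2 $ 1 = 0] (mod int r) \<and> [A $ 2 $ 1 * m = 0] (mod (int r)\<^sup>2)}"

definition SL2Z_index :: "(int ^ 2 ^ 2) set \<Rightarrow> nat" where
  "SL2Z_index H = card (rcosets\<^bsub>SL2Z\<^esub> H)"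

end

theory Submission
  imports Defs "HOL-Complex_Analysis.Complex_Analysis"
begin

text \<open>
  Up to a monomial, \<open>b\<close> is the product over r of the \<open>\<nu>(r)\<close>-th powers of the \<open>\<zeta> - \<xi>\<close>, where
  \<open>\<xi>\<close> runs over the primitive r-th roots of unity, so divisibility by \<open>b\<close> means that g vanishes
  to order \<open>\<nu>(r)\<close> in z at the torsion points \<open>j/r\<close>.  The modular group permutes the translates of
  g by the torsion points of exact order r.  If all of them vanish to order \<open>i < \<nu>(r)\<close>, their i-th
  Taylor coefficients are permuted, up to constants of absolute value 1, with weight \<open>k + i\<close>; their
  product, divided by a power of eta, is invariant, and the vanishing of the first Fourier
  coefficients at \<open>1/r\<close> makes it tend to 0 at the cusp, hence vanish.  So one of these Taylor
  coefficients is 0, and then all of them are, by transitivity.  The number of torsion points of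
  exact order r is at most the index of \<open>\<Gamma>(r, m)\<close>, because the bottom row mod r is constant on the
  right cosets, and it is trivially at most \<open>r\<^sup>2\<close>.
\<close>

text \<open>The modular argument runs on absolute values. The maximum modulus principle asks for no
  more, so neither the multiplier system of eta nor the unimodular factors picked up by the
  translates have to be determined; for eta it is enough that |eta(-1/\<tau>)|^2 = |\<tau>|
  |eta(\<tau>)|^2. The number 12 arises because eta^2 has weight 1 and leading exponent 1/12: a
  product of J functions of weight k + i is compared with eta^(2 (k + i) J), whose order at the cusp
  is (k + i) J / 12. The largest i is \<nu>(r) - 1. Coefficients are inspected at the single point
  1/r: one decaying factor suffices, since the cusp condition keeps all the others bounded. The
  obstacle is uniformity. Taylor coefficients in z must be holomorphic and bounded as functions of
  \<tau>, while the order of vanishing is known for each \<tau> separately. A Schwarz lemma of order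
  n, whose constant is a bound on the unit circle, settles this. Letting Im \<tau> tend to infinity
  then returns the vanishing to the single coefficients g_n.\<close>

section \<open>The exponential function e(w)\<close>

lemma e2pii_add: "e2pii (a + b) = e2pii a * e2pii b"
  by (simp add: e2pii_def distrib_left exp_add)

lemma e2pii_diff: "e2pii (a - b) = e2pii a / e2pii b"
  by (simp add: e2pii_def right_diff_distrib exp_diff)

lemma e2pii_minus: "e2pii (- a) = inverse (e2pii a)"
  by (simp add: e2pii_def exp_minus)

lemma e2pii_nonzero [simp]: "e2pii a \<noteq> 0"
  by (simp add: e2pii_def)

lemma e2pii_0 [simp]: "e2pii 0 = 1"
  by (simp add: e2pii_def)

lemma norm_e2pii: "norm (e2pii w) = exp (- (2 * pi * Im w))"
  by (simp add: e2pii_def)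

lemma e2pii_of_int [simp]: "e2pii (of_int n) = 1"
  using exp_integer_2pi[of "of_int n"] by (simp add: e2pii_def mult_ac)

lemma e2pii_of_nat [simp]: "e2pii (of_nat n) = 1"
  using e2pii_of_int[of "int n"] by simp

lemma e2pii_1 [simp]: "e2pii 1 = 1"
  using e2pii_of_int[of 1] by simp

lemma e2pii_power: "e2pii w ^ n = e2pii (of_nat n * w)"
  by (simp add: e2pii_def exp_of_nat_mult [symmetric] mult_ac)

lemma e2pii_powi: "e2pii w powi n = e2pii (of_int n * w)"
  by (cases n) (simp_all add: power_int_def e2pii_power e2pii_minus [symmetric] algebra_simps)

lemma e2pii_half [simp]: "e2pii (1 / 2) = - 1"
  by (simp add: e2pii_def)

lemma e2pii_eq_1_iff: "e2pii w = 1 \<longleftrightarrow> (\<exists>n. w = of_int n)"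
proof -
  have "e2pii w = 1 \<longleftrightarrow> Im w = 0 \<and> (\<exists>n::int. Re w = of_int n)"
    unfolding e2pii_def exp_eq_1 by simp
  thus ?thesis by (auto simp: complex_eq_iff)
qed

lemma e2pii_eq_iff: "e2pii v = e2pii w \<longleftrightarrow> (\<exists>n. v = w + of_int n)"
proof -
  have "e2pii v = e2pii w \<longleftrightarrow> e2pii (v - w) = 1"
    by (simp add: e2pii_diff field_simps)
  thus ?thesis by (auto simp: e2pii_eq_1_iff algebra_simps)
qed

lemma holomorphic_e2pii [holomorphic_intros]:
  "f holomorphic_on S \<Longrightarrow> (\<lambda>z. e2pii (f z)) holomorphic_on S"
  unfolding e2pii_def by (intro holomorphic_intros)

lemma continuous_on_e2pii [continuous_intros]:
  "continuous_on S f \<Longrightarrow> continuous_on S (\<lambda>z. e2pii (f z))"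
  unfolding e2pii_def by (intro continuous_intros)

lemma e2pii_has_derivative: "(e2pii has_field_derivative 2 * of_real pi * \<i> * e2pii z) (at z)"
  unfolding e2pii_def by (auto intro!: derivative_eq_intros)

section \<open>The eta function\<close>

text \<open>The q-Pochhammer symbol (a; q) with infinitely many factors. Eta and the theta function
  used here are products of such symbols and an exponential.\<close>

definition qpoch :: "complex \<Rightarrow> complex \<Rightarrow> complex" where
  "qpoch a q = prodinf (\<lambda>n. 1 - a * q ^ n)"

lemma qpoch_convergent: "norm (q::complex) < 1 \<Longrightarrow> convergent_prod (\<lambda>n. 1 - a * q ^ n)"
  by (intro abs_convergent_prod_imp_convergent_prod summable_imp_abs_convergent_prod)
     (simp add: norm_mult norm_power summable_mult summable_geometric)

lemma qpoch_LIMSEQ: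
  assumes "norm q < 1"
  shows "(\<lambda>N. \<Prod>n<N. 1 - a * q ^ n) \<longlonglongrightarrow> qpoch a q"
proof -
  have "(\<lambda>N. \<Prod>n\<le>N. 1 - a * q ^ n) \<longlonglongrightarrow> qpoch a q"
    unfolding qpoch_def by (rule convergent_prod_LIMSEQ[OF qpoch_convergent[OF assms]])
  thus ?thesis
    by (subst filterlim_sequentially_Suc [symmetric]) (simp only: lessThan_Suc_atMost)
qed

lemma qpoch_rec:
  assumes "norm q < 1"
  shows "qpoch a q = (1 - a) * qpoch (a * q) q"
proof (rule LIMSEQ_unique)
  show "(\<lambda>N. \<Prod>n<Suc N. 1 - a * q ^ n) \<longlonglongrightarrow> qpoch a q"
    using qpoch_LIMSEQ[OF assms] by (rule filterlim_compose[OF _ filterlim_Suc])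
  have "(\<lambda>N. (1 - a) * (\<Prod>n<N. 1 - (a * q) * q ^ n)) \<longlonglongrightarrow> (1 - a) * qpoch (a * q) q"
    by (intro tendsto_intros qpoch_LIMSEQ assms)
  also have "(\<lambda>N. (1 - a) * (\<Prod>n<N. 1 - (a * q) * q ^ n)) = (\<lambda>N. \<Prod>n<Suc N. 1 - a * q ^ n)"
    by (rule ext, subst prod.lessThan_Suc_shift) (simp add: mult_ac)
  finally show "(\<lambda>N. \<Prod>n<Suc N. 1 - a * q ^ n) \<longlonglongrightarrow> (1 - a) * qpoch (a * q) q" .
qed

text \<open>\<open>convergent_prod\<close> rules out a limit 0 that does not come from a zero
  factor.\<close>

lemma qpoch_eq_0_iff:
  assumes "norm q < 1"
  shows "qpoch a q = 0 \<longleftrightarrow> (\<exists>n. a * q ^ n = 1)"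
  using has_prod_eq_0_iff[OF convergent_prod_has_prod[OF qpoch_convergent[OF assms, of a]]]
  by (auto simp: qpoch_def image_iff)

lemma qpoch_mult_minus:
  assumes "norm q < 1"
  shows "qpoch a q * qpoch (- a) q = qpoch (a\<^sup>2) (q\<^sup>2)"
proof -
  have "qpoch a q * qpoch (- a) q = prodinf (\<lambda>n. (1 - a * q ^ n) * (1 - (-a) * q ^ n))"
    unfolding qpoch_def by (intro prodinf_mult qpoch_convergent assms)
  also have "(\<lambda>n. (1 - a * q ^ n) * (1 - (-a) * q ^ n)) = (\<lambda>n. 1 - a\<^sup>2 * (q\<^sup>2) ^ n)"
    by (simp add: algebra_simps power2_eq_square power_mult_distrib)
  finally show ?thesis by (simp add: qpoch_def)
qed

lemma qpoch_split:
  assumes "norm q < 1"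
  shows "qpoch a q = qpoch a (q\<^sup>2) * qpoch (a * q) (q\<^sup>2)"
proof (rule LIMSEQ_unique)
  have q2: "norm (q\<^sup>2) < 1"
    using assms by (simp add: norm_power power_less_one_iff)
  show "(\<lambda>N. \<Prod>n<2 * N. 1 - a * q ^ n) \<longlonglongrightarrow> qpoch a q"
    by (rule filterlim_compose[OF qpoch_LIMSEQ[OF assms]])
       (auto intro!: filterlim_subseq simp: strict_mono_def)
  have "(\<lambda>N. (\<Prod>n<N. 1 - a * (q\<^sup>2) ^ n) * (\<Prod>n<N. 1 - (a * q) * (q\<^sup>2) ^ n))
          \<longlonglongrightarrow> qpoch a (q\<^sup>2) * qpoch (a * q) (q\<^sup>2)"
    by (intro tendsto_intros qpoch_LIMSEQ q2)
  also have "(\<lambda>N. (\<Prod>n<N. 1 - a * (q\<^sup>2) ^ n) * (\<Prod>n<N. 1 - (a * q) * (q\<^sup>2) ^ n))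
      = (\<lambda>N. \<Prod>n<2 * N. 1 - a * q ^ n)"
  proof
    fix N
    show "(\<Prod>n<N. 1 - a * (q\<^sup>2) ^ n) * (\<Prod>n<N. 1 - (a * q) * (q\<^sup>2) ^ n) = (\<Prod>n<2 * N. 1 - a * q ^ n)"
      by (induction N) (simp_all add: power_mult [symmetric] mult_ac)
  qed
  finally show "(\<lambda>N. \<Prod>n<2 * N. 1 - a * q ^ n) \<longlonglongrightarrow> qpoch a (q\<^sup>2) * qpoch (a * q) (q\<^sup>2)" .
qed

lemma qpoch_self_nonzero:
  assumes "norm q < 1"
  shows "qpoch q q \<noteq> 0"
proof
  assume "qpoch q q = 0"
  then obtain n where "q * q ^ n = 1" by (auto simp: qpoch_eq_0_iff assms)
  hence "norm q ^ Suc n = 1" by (metis norm_one norm_power power_Suc)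
  moreover have "norm q ^ Suc n < 1" using assms by (simp add: power_less_one_iff del: power_Suc)
  ultimately show False by simp
qed

text \<open>Euler's identity behind the equal numbers of partitions into distinct and into odd
  parts: (q; q) splits into odd and even exponents, and its even part factors as (q; q) (-q; q). It
  makes the values of theta at the three half-periods multiply to something known.\<close>

lemma qpoch_euler:
  assumes "norm q < 1"
  shows "qpoch (- q) q * qpoch q (q\<^sup>2) = 1"
proof -
  have "qpoch q q = qpoch q (q\<^sup>2) * qpoch (q\<^sup>2) (q\<^sup>2)"
    using qpoch_split[OF assms, of q] by (simp add: power2_eq_square)
  also have "qpoch (q\<^sup>2) (q\<^sup>2) = qpoch q q * qpoch (- q) q"
    using qpoch_mult_minus[OF assms, of q] by simp
  finally have "qpoch q q * (qpoch (- q) q * qpoch q (q\<^sup>2)) = qpoch q q * 1"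
    by (simp add: mult_ac)
  thus ?thesis using qpoch_self_nonzero[OF assms] by (metis mult_left_cancel)
qed

text \<open>Both arguments vary, because theta moves the first one at fixed q while eta moves q
  itself.\<close>

lemma qpoch_holomorphic [holomorphic_intros]:
  assumes f: "f holomorphic_on S" and h: "h holomorphic_on S" and S: "open S"
    and less: "\<And>z. z \<in> S \<Longrightarrow> norm (h z) < 1"
  shows "(\<lambda>z. qpoch (f z) (h z)) holomorphic_on S"
proof (rule holomorphic_uniform_sequence[OF S, where f = "\<lambda>N z. \<Prod>n<N. 1 - f z * h z ^ n"])
  show "(\<lambda>z. \<Prod>n<N. 1 - f z * h z ^ n) holomorphic_on S" for N
    by (intro holomorphic_intros f h)
  fix x assume "x \<in> S"
  then obtain d where d: "d > 0" "cball x d \<subseteq> S" using S open_contains_cball by blast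
  let ?A = "cball x d"
  have cf: "continuous_on ?A f" and ch: "continuous_on ?A h"
    using f h d holomorphic_on_imp_continuous_on continuous_on_subset by blast+
  have "compact (f ` ?A)" using cf by (intro compact_continuous_image) auto
  then obtain B where B: "\<And>z. z \<in> ?A \<Longrightarrow> norm (f z) \<le> B"
    using compact_imp_bounded bounded_iff by (metis imageI)
  \<comment> \<open>|h| attains a maximum below 1 on the closed ball, which gives a geometric
    majorant.\<close>
  have "\<exists>y\<in>?A. \<forall>z\<in>?A. norm (h z) \<le> norm (h y)"
    using d by (intro continuous_attains_sup continuous_intros ch) auto
  then obtain y where y: "y \<in> ?A" "\<And>z. z \<in> ?A \<Longrightarrow> norm (h z) \<le> norm (h y)" by blast
  have "uniformly_convergent_on ?A (\<lambda>N z. \<Sum>n<N. norm ((1 - f z * h z ^ n) - 1))"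
  proof (rule Weierstrass_m_test')
    show "norm (norm ((1 - f z * h z ^ n) - 1)) \<le> B * norm (h y) ^ n" if "z \<in> ?A" for n z
      using B[OF that] y(2)[OF that] order_trans[OF norm_ge_zero B[OF that]]
      by (auto simp: norm_mult norm_power intro!: mult_mono power_mono)
    show "summable (\<lambda>n. B * norm (h y) ^ n)"
      using less y d by (intro summable_mult summable_geometric) auto
  qed
  hence "uniformly_convergent_on ?A (\<lambda>N z. \<Prod>n<N. 1 - f z * h z ^ n)"
    by (intro uniformly_convergent_on_prod') (auto intro!: continuous_intros cf ch)
  then obtain l where l: "uniform_limit ?A (\<lambda>N z. \<Prod>n<N. 1 - f z * h z ^ n) l sequentially"
    by (auto simp: uniformly_convergent_on_def)
  have "l z = qpoch (f z) (h z)" if "z \<in> ?A" for z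
    using tendsto_uniform_limitI[OF l that] qpoch_LIMSEQ[of "h z" "f z"] less that d
    by (meson LIMSEQ_unique subsetD)
  hence "uniform_limit ?A (\<lambda>N z. \<Prod>n<N. 1 - f z * h z ^ n) (\<lambda>z. qpoch (f z) (h z)) sequentially"
    using l by (subst uniform_limit_cong') (auto simp: )
  thus "\<exists>d>0. cball x d \<subseteq> S \<and>
      uniform_limit (cball x d) (\<lambda>N z. \<Prod>n<N. 1 - f z * h z ^ n) (\<lambda>z. qpoch (f z) (h z)) sequentially"
    using d by blast
qed

section \<open>Theta functions and the inversion of eta\<close>

text \<open>The quotient f/h is doubly periodic. Its only possible poles are the lattice points;
  they are simple zeros of h, by \<open>h0\<close> and quasi-periodicity, and f vanishes there too.
  So the quotient is entire and bounded by its values on a period parallelogram, and Liouville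
  applies.\<close>

lemma elliptic_ratio_constant:
  fixes f h a b :: "complex \<Rightarrow> complex"
  assumes \<tau>: "Im \<tau> > 0"
    and holf: "f holomorphic_on UNIV" and holh: "h holomorphic_on UNIV"
    and a: "\<And>z. a z \<noteq> 0" "\<And>z. f (z + 1) = a z * f z" "\<And>z. h (z + 1) = a z * h z"
    and b: "\<And>z. b z \<noteq> 0" "\<And>z. f (z + \<tau>) = b z * f z" "\<And>z. h (z + \<tau>) = b z * h z"
    and zero: "\<And>z. h z = 0 \<longleftrightarrow> (\<exists>m n. z = of_int m + of_int n * \<tau>)"
    and f0: "f 0 = 0" and h0: "deriv h 0 \<noteq> 0"
  obtains C where "\<And>z. f z = C * h z"
proof -
  \<comment> \<open>At a zero of h the value is the limit of f/h at 0. By periodicity this single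
    number is right at every lattice point.\<close>
  define Q where "Q z = (if h z = 0 then deriv f 0 / deriv h 0 else f z / h z)" for z
  have per1: "Q (z + 1) = Q z" and per\<tau>: "Q (z + \<tau>) = Q z" for z
    using a b by (auto simp: Q_def)
  have int_per: "Q (z + of_int n * w) = Q z" if "\<And>z. Q (z + w) = Q z" for z w n
  proof (induction n rule: int_induct[where k = 0])
    case (step1 i) thus ?case using that[of "z + of_int i * w"] by (simp add: algebra_simps)
  next
    case (step2 i) thus ?case using that[of "z + of_int (i - 1) * w"] by (simp add: algebra_simps)
  qed simp
  have per: "Q (z + (of_int m + of_int n * \<tau>)) = Q z" for z m n
    using int_per[OF per1, of "z + of_int n * \<tau>" m] int_per[OF per\<tau>, of z n] by (simp add: add_ac)
  have hz0: "h 0 = 0" using zero[of 0] by (metis add.right_neutral mult_zero_left of_int_0)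
  have df: "(f has_field_derivative deriv f 0) (at 0)" and dh: "(h has_field_derivative deriv h 0) (at 0)"
    using holf holh by (auto intro!: holomorphic_derivI)
  have lf: "(\<lambda>z. f z / z) \<midarrow>0\<rightarrow> deriv f 0" and lh: "(\<lambda>z. h z / z) \<midarrow>0\<rightarrow> deriv h 0"
    using df dh by (simp_all add: has_field_derivative_iff f0 hz0)
  have ev: "eventually (\<lambda>z. h z / z \<noteq> 0) (at 0)"
    by (rule tendsto_imp_eventually_ne[OF lh h0])
  then obtain \<epsilon> where \<epsilon>: "\<epsilon> > 0" "\<And>z. z \<noteq> 0 \<Longrightarrow> norm z < \<epsilon> \<Longrightarrow> h z \<noteq> 0"
    unfolding eventually_at by (auto simp: dist_norm)
  have "((\<lambda>z. (f z / z) / (h z / z)) \<longlongrightarrow> deriv f 0 / deriv h 0) (at 0)"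
    by (intro tendsto_intros lf lh h0)
  moreover have "eventually (\<lambda>z. (f z / z) / (h z / z) = Q z) (at 0)"
    using ev eventually_neq_at_within[of 0] by eventually_elim (auto simp: Q_def)
  ultimately have Q0: "(Q \<longlongrightarrow> Q 0) (at 0)"
    using Lim_transform_eventually by (fastforce simp: Q_def hz0)
  have Q_lattice: "(Q \<longlongrightarrow> Q w) (at w)" if hw: "h w = 0" for w
  proof -
    obtain m n where w: "w = of_int m + of_int n * \<tau>" using hw zero by blast
    have "(\<lambda>z. Q (z + w)) = Q" using per by (auto simp: w)
    hence "((\<lambda>z. Q (z + w)) \<longlongrightarrow> Q w) (at 0)"
      using Q0 per[of 0 m n] by (simp add: w)
    thus ?thesis by (subst LIM_offset_zero_iff) (simp_all add: add.commute)
  qed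
  have "Q holomorphic_on UNIV"
    unfolding holomorphic_on_def
  proof (intro ballI)
    fix z :: complex
    have "\<exists>A. open A \<and> z \<in> A \<and> Q holomorphic_on A"
    proof (cases "h z = 0")
      case False
      have "open {z. h z \<noteq> 0}"
        using holomorphic_on_imp_continuous_on[OF holh] by (intro open_Collect_neq) auto
      moreover have "Q holomorphic_on {z. h z \<noteq> 0}"
        by (rule holomorphic_transform[where f = "\<lambda>z. f z / h z"])
           (auto intro!: holomorphic_intros holomorphic_on_subset[OF holf] holomorphic_on_subset[OF holh] simp: Q_def)
      ultimately show ?thesis using False by blast
    next
      case True
      then obtain m n where z: "z = of_int m + of_int n * \<tau>" using zero by blast
      have ne: "h w \<noteq> 0" if "w \<in> ball z \<epsilon> - {z}" for w
      proof
        assume "h w = 0"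
        then obtain m' n' where "w = of_int m' + of_int n' * \<tau>" using zero by blast
        hence "w - z = of_int (m' - m) + of_int (n' - n) * \<tau>" by (simp add: z algebra_simps)
        hence "h (w - z) = 0" using zero by blast
        moreover have "norm (w - z) < \<epsilon>" "w - z \<noteq> 0" using that by (auto simp: dist_norm norm_minus_commute)
        ultimately show False using \<epsilon>(2) by blast
      qed
      have "Q holomorphic_on ball z \<epsilon>"
      proof (rule no_isolated_singularity'[where K = "{z}"])
        show "(Q \<longlongrightarrow> Q y) (at y within ball z \<epsilon>)" if "y \<in> {z}" for y
          using Q_lattice[OF True] that by (auto intro: tendsto_within_subset)
        show "Q holomorphic_on ball z \<epsilon> - {z}"
          by (rule holomorphic_transform[where f = "\<lambda>z. f z / h z"])
             (use ne in \<open>auto intro!: holomorphic_intros holomorphic_on_subset[OF holf] holomorphic_on_subset[OF holh] simp: Q_def\<close>)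
      qed auto
      thus ?thesis using \<epsilon>(1) by (intro exI[of _ "ball z \<epsilon>"]) auto
    qed
    thus "Q field_differentiable (at z within UNIV)"
      by (metis holomorphic_on_open UNIV_I field_differentiable_def)
  qed
  moreover have "bounded (range Q)"
  proof -
    define K where "K = (\<lambda>p. of_real (fst p) + of_real (snd p) * \<tau>) ` ({0..1::real} \<times> {0..1::real})"
    have "compact K" unfolding K_def
      by (intro compact_continuous_image continuous_intros compact_Times) auto
    hence "bounded (Q ` K)"
      by (intro compact_imp_bounded compact_continuous_image)
         (use \<open>Q holomorphic_on UNIV\<close> holomorphic_on_imp_continuous_on continuous_on_subset in blast)
    moreover have "range Q \<subseteq> Q ` K"
    proof safe
      fix z
      define t where "t = Im z / Im \<tau>"
      define s where "s = Re z - t * Re \<tau>"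
      have z: "z = of_real s + of_real t * \<tau>"
        using \<tau> by (simp add: complex_eq_iff s_def t_def)
      have "Q (of_real (frac s) + of_real (frac t) * \<tau> + (of_int \<lfloor>s\<rfloor> + of_int \<lfloor>t\<rfloor> * \<tau>)) 
              = Q (of_real (frac s) + of_real (frac t) * \<tau>)"
        by (rule per)
      also have "of_real (frac s) + of_real (frac t) * \<tau> + (of_int \<lfloor>s\<rfloor> + of_int \<lfloor>t\<rfloor> * \<tau>) = z"
        by (simp add: z frac_def algebra_simps)
      finally have "Q z = Q (of_real (frac s) + of_real (frac t) * \<tau>)" .
      moreover have "of_real (frac s) + of_real (frac t) * \<tau> \<in> K"
        unfolding K_def by (intro image_eqI[of _ _ "(frac s, frac t)"]) (auto simp: frac_lt_1 less_imp_le)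
      ultimately show "Q z \<in> Q ` K" by simp
    qed
    ultimately show ?thesis using bounded_subset by blast
  qed
  ultimately obtain C where C: "\<And>z. Q z = C"
    using Liouville_theorem unfolding constant_on_def by blast
  have "f z = C * h z" for z
  proof (cases "h z = 0")
    case False
    thus ?thesis using C[of z] by (auto simp: Q_def field_simps)
  next
    case True
    then obtain m n where z: "z = of_int m + of_int n * \<tau>" using zero by blast
    \<comment> \<open>At a zero of h the equation \<open>Q z = C\<close> says nothing about f, so
      the zero of f at 0 is carried to the lattice by the functional equations.\<close>
    have int_zero: "f (w + of_int n * v) = 0"
      if "f w = 0" "\<And>z. \<exists>c. c \<noteq> 0 \<and> f (z + v) = c * f z" for w n v
    proof (induction n rule: int_induct[where k = 0])
      case (step1 i) thus ?case using that(2)[of "w + of_int i * v"] by (auto simp: algebra_simps)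
    next
      case (step2 i) thus ?case using that(2)[of "w + of_int (i - 1) * v"] by (auto simp: algebra_simps)
    qed (use that in simp)
    have "f (0 + of_int m * 1) = 0" by (rule int_zero) (use f0 a in blast)+
    hence "f (of_int m * 1 + of_int n * \<tau>) = 0" by (intro int_zero) (use b in auto)
    thus ?thesis using True by (simp add: z)
  qed
  thus ?thesis using that by blast
qed


text \<open>Up to sign this is \<open>jtheta\<close> without q^(1/8) and without (q; q). These
  factors do not depend on z, and (q; q) is the function whose inversion is to be determined, so
  they are kept out.\<close>

definition theta_fn :: "complex \<Rightarrow> complex \<Rightarrow> complex" where
  "theta_fn \<tau> z = e2pii (- z / 2) * (qpoch (e2pii z) (e2pii \<tau>) * qpoch (e2pii (\<tau> - z)) (e2pii \<tau>))"

lemma norm_e2pii_less_1: "Im \<tau> > 0 \<Longrightarrow> norm (e2pii \<tau>) < 1"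
  by (simp add: norm_e2pii)

context
  fixes \<tau> :: complex
  assumes \<tau>: "Im \<tau> > 0"
begin

lemma theta_fn_holomorphic: "theta_fn \<tau> holomorphic_on UNIV"
proof -
  have "(\<lambda>z. e2pii (- z / 2) * (qpoch (e2pii z) (e2pii \<tau>) * qpoch (e2pii (\<tau> - z)) (e2pii \<tau>))) holomorphic_on UNIV"
    by (intro holomorphic_intros norm_e2pii_less_1 \<tau>) auto
  thus ?thesis by (simp add: theta_fn_def [abs_def])
qed

lemma theta_fn_add_1: "theta_fn \<tau> (z + 1) = - 1 * theta_fn \<tau> z"
proof -
  have "e2pii (- (z + 1) / 2) = - e2pii (- z / 2)"
  proof -
    have "e2pii (- (z + 1) / 2) = e2pii (- z / 2) * inverse (e2pii (1 / 2))"
      by (simp only: e2pii_minus [symmetric] e2pii_add [symmetric]) (simp add: field_simps)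
    thus ?thesis by simp
  qed
  thus ?thesis by (simp add: theta_fn_def e2pii_add e2pii_diff)
qed

lemma theta_fn_add_tau: "theta_fn \<tau> (z + \<tau>) = - (e2pii (- z) * e2pii (- \<tau> / 2)) * theta_fn \<tau> z"
proof -
  let ?q = "e2pii \<tau>" and ?x = "e2pii z"
  have "qpoch ?x ?q = (1 - ?x) * qpoch (e2pii (z + \<tau>)) ?q"
    using qpoch_rec[OF norm_e2pii_less_1[OF \<tau>], of ?x] by (simp add: e2pii_add)
  moreover have "qpoch (e2pii (\<tau> - (z + \<tau>))) ?q = (1 - inverse ?x) * qpoch (e2pii (\<tau> - z)) ?q"
    using qpoch_rec[OF norm_e2pii_less_1[OF \<tau>], of "inverse ?x"]
    by (simp add: e2pii_minus [symmetric] e2pii_add [symmetric])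
  moreover have "1 - inverse ?x = - e2pii (-z) * (1 - ?x)"
    by (simp add: e2pii_minus field_simps)
  moreover have "e2pii (- (z + \<tau>) / 2) = e2pii (- z / 2) * e2pii (- \<tau> / 2)"
    by (simp add: e2pii_add [symmetric] add_divide_distrib diff_divide_distrib)
  ultimately show ?thesis
    by (simp add: theta_fn_def mult_ac)
qed

text \<open>The first product vanishes at the lattice points whose coefficient of \<tau> is at most
  0, the second at the remaining ones.\<close>

lemma theta_fn_eq_0_iff: "theta_fn \<tau> z = 0 \<longleftrightarrow> (\<exists>m n. z = of_int m + of_int n * \<tau>)"
proof -
  have "theta_fn \<tau> z = 0 \<longleftrightarrow> (\<exists>n::nat. e2pii (z + of_nat n * \<tau>) = 1) \<or> (\<exists>n::nat. e2pii (\<tau> - z + of_nat n * \<tau>) = 1)"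
    by (simp add: theta_fn_def qpoch_eq_0_iff norm_e2pii_less_1 \<tau> e2pii_power e2pii_add)
  also have "\<dots> \<longleftrightarrow> (\<exists>m n. z = of_int m + of_int n * \<tau>)" (is "?L \<longleftrightarrow> ?R")
  proof
    assume ?L
    thus ?R
    proof (elim disjE exE)
      fix n :: nat assume "e2pii (z + of_nat n * \<tau>) = 1"
      then obtain k :: int where "z + of_nat n * \<tau> = of_int k" by (auto simp: e2pii_eq_1_iff)
      hence "z = of_int k + of_int (- int n) * \<tau>" by (simp add: algebra_simps)
      thus ?R by blast
    next
      fix n :: nat assume "e2pii (\<tau> - z + of_nat n * \<tau>) = 1"
      then obtain k :: int where "\<tau> - z + of_nat n * \<tau> = of_int k" by (auto simp: e2pii_eq_1_iff)
      hence "z = of_int (- k) + of_int (int n + 1) * \<tau>" by (simp add: algebra_simps)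
      thus ?R by blast
    qed
  next
    assume ?R
    then obtain m n where z: "z = of_int m + of_int n * \<tau>" by blast
    show ?L
    proof (cases "n \<le> 0")
      case True
      hence "z + of_nat (nat (- n)) * \<tau> = of_int m" by (simp add: z)
      thus ?thesis by (metis e2pii_of_int)
    next
      case False
      hence "\<tau> - z + of_nat (nat (n - 1)) * \<tau> = of_int (- m)" by (simp add: z algebra_simps)
      thus ?thesis by (metis e2pii_of_int)
    qed
  qed
  finally show ?thesis .
qed

text \<open>The place where eta enters: after splitting off 1 - e(z), the value of the cofactor at 0
  is the square of the product in eta.\<close>

lemma theta_fn_has_derivative_0:
  "(theta_fn \<tau> has_field_derivative - (2 * of_real pi * \<i>) * (qpoch (e2pii \<tau>) (e2pii \<tau>))\<^sup>2) (at 0)"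
proof -
  let ?q = "e2pii \<tau>"
  define h where "h z = e2pii (- z / 2) * (qpoch (e2pii (z + \<tau>)) ?q * qpoch (e2pii (\<tau> - z)) ?q)" for z
  have theta_fn: "theta_fn \<tau> = (\<lambda>z. (1 - e2pii z) * h z)"
  proof
    fix z
    have "qpoch (e2pii z) ?q = (1 - e2pii z) * qpoch (e2pii (z + \<tau>)) ?q"
      using qpoch_rec[OF norm_e2pii_less_1[OF \<tau>], of "e2pii z"] by (simp only: e2pii_add)
    thus "theta_fn \<tau> z = (1 - e2pii z) * h z" by (simp only: theta_fn_def h_def mult_ac)
  qed
  have "h holomorphic_on UNIV"
    unfolding h_def [abs_def] by (intro holomorphic_intros norm_e2pii_less_1 \<tau>) auto
  hence 1: "(h has_field_derivative deriv h 0) (at 0)" by (rule holomorphic_derivI) auto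
  have 2: "((\<lambda>z. 1 - e2pii z) has_field_derivative 0 - 2 * of_real pi * \<i> * e2pii 0) (at 0)"
    by (rule DERIV_diff[OF DERIV_const e2pii_has_derivative])
  have h0: "h 0 = (qpoch ?q ?q)\<^sup>2"
    by (simp only: h_def add_0 diff_zero minus_zero div_0 e2pii_0 mult_1 power2_eq_square)
  show ?thesis
    using DERIV_mult[OF 2 1] by (simp add: theta_fn h0)
qed

end

text \<open>
  The quotient of \<open>theta_fn (-1/\<tau>) (z/\<tau>) exp (-\<pi> i z\<^sup>2/\<tau>)\<close> and \<open>theta_fn \<tau> z\<close> is an elliptic function
  without poles, hence a constant.  Its absolute value follows from the values at the three
  half-periods, and the comparison of derivatives at 0 then gives the transformation of eta.
\<close>

lemma norm_qpoch_inversion: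
  assumes \<tau>: "Im \<tau> > 0"
  defines "\<tau>' \<equiv> - 1 / \<tau>"
  shows "norm (e2pii (\<tau>' / 12)) * norm (qpoch (e2pii \<tau>') (e2pii \<tau>')) ^ 2 =
         norm \<tau> * (norm (e2pii (\<tau> / 12)) * norm (qpoch (e2pii \<tau>) (e2pii \<tau>)) ^ 2)"
proof -
  have \<tau>0: "\<tau> \<noteq> 0" using \<tau> by auto
  have \<tau>': "Im \<tau>' > 0"
    using \<tau> by (simp add: \<tau>'_def Im_divide_of_real Im_divide) (simp add: sum_power2_gt_zero_iff)
  \<comment> \<open>The Gaussian factor gives U the quasi-periods of \<open>theta_fn \<tau>\<close>:
    the steps 1 and \<tau> in z are the steps -\<tau>' and 1 in z / \<tau>.\<close>
  define U where "U z = theta_fn \<tau>' (z / \<tau>) * e2pii (- z\<^sup>2 / (2 * \<tau>))" for z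
  have U_add_1: "U (z + 1) = - 1 * U z" for z
  proof -
    have "theta_fn \<tau>' (z / \<tau>) = - (e2pii (- ((z + 1) / \<tau>)) * e2pii (- \<tau>' / 2)) * theta_fn \<tau>' ((z + 1) / \<tau>)"
      using theta_fn_add_tau[OF \<tau>', of "(z + 1) / \<tau>"] by (simp add: \<tau>'_def add_divide_distrib)
    hence "U z = - (e2pii (- ((z + 1) / \<tau>)) * e2pii (- \<tau>' / 2) * e2pii (- z\<^sup>2 / (2 * \<tau>))) * theta_fn \<tau>' ((z + 1) / \<tau>)"
      by (simp add: U_def)
    also have "e2pii (- ((z + 1) / \<tau>)) * e2pii (- \<tau>' / 2) * e2pii (- z\<^sup>2 / (2 * \<tau>)) = e2pii (- (z + 1)\<^sup>2 / (2 * \<tau>))"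
    proof -
      have "- ((z + 1) / \<tau>) + - \<tau>' / 2 + - z\<^sup>2 / (2 * \<tau>) = - (z + 1)\<^sup>2 / (2 * \<tau>)"
        using \<tau>0 by (simp add: \<tau>'_def divide_simps) (simp add: algebra_simps power2_eq_square)
      thus ?thesis by (simp only: e2pii_add [symmetric])
    qed
    finally show ?thesis by (simp add: U_def)
  qed
  have U_add_\<tau>: "U (z + \<tau>) = - (e2pii (- z) * e2pii (- \<tau> / 2)) * U z" for z
  proof -
    have "theta_fn \<tau>' ((z + \<tau>) / \<tau>) = - theta_fn \<tau>' (z / \<tau>)"
      using theta_fn_add_1[OF \<tau>', of "z / \<tau>"] \<tau>0 by (simp add: add_divide_distrib)
    moreover have "e2pii (- (z + \<tau>)\<^sup>2 / (2 * \<tau>)) = e2pii (- z) * e2pii (- \<tau> / 2) * e2pii (- z\<^sup>2 / (2 * \<tau>))"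
    proof -
      have "- (z + \<tau>)\<^sup>2 / (2 * \<tau>) = - z + - \<tau> / 2 + - z\<^sup>2 / (2 * \<tau>)"
        using \<tau>0 by (simp add: divide_simps) (simp add: algebra_simps power2_eq_square)
      thus ?thesis by (simp only: e2pii_add [symmetric])
    qed
    ultimately show ?thesis by (simp add: U_def)
  qed
  let ?Q = "\<lambda>\<tau>. qpoch (e2pii \<tau>) (e2pii \<tau>)"
  have dU: "(U has_field_derivative - (2 * of_real pi * \<i>) * (?Q \<tau>')\<^sup>2 / \<tau>) (at 0)"
  proof -
    have 1: "((\<lambda>z. z / \<tau>) has_field_derivative 1 / \<tau>) (at 0)"
      by (rule DERIV_cdivide[OF DERIV_ident])
    have d0: "(theta_fn \<tau>' has_field_derivative - (2 * of_real pi * \<i>) * (?Q \<tau>')\<^sup>2) (at (0 / \<tau>))"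
      using theta_fn_has_derivative_0[OF \<tau>'] by simp
    have 2: "((\<lambda>z. theta_fn \<tau>' (z / \<tau>)) has_field_derivative - (2 * of_real pi * \<i>) * (?Q \<tau>')\<^sup>2 * (1 / \<tau>)) (at 0)"
      by (rule DERIV_chain2[OF d0 1])
    have "(\<lambda>z. e2pii (- z\<^sup>2 / (2 * \<tau>))) holomorphic_on UNIV"
      using \<tau>0 by (intro holomorphic_intros) auto
    hence 3: "((\<lambda>z. e2pii (- z\<^sup>2 / (2 * \<tau>))) has_field_derivative deriv (\<lambda>z. e2pii (- z\<^sup>2 / (2 * \<tau>))) 0) (at 0)"
      by (rule holomorphic_derivI) auto
    have "theta_fn \<tau>' 0 = 0" unfolding theta_fn_eq_0_iff[OF \<tau>'] by (intro exI[of _ 0]) simp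
    thus ?thesis unfolding U_def
      using DERIV_mult[OF 2 3] by simp
  qed
  have "(\<lambda>z. z / \<tau>) holomorphic_on UNIV"
    using \<tau>0 by (intro holomorphic_on_divide holomorphic_on_ident holomorphic_on_const)
  hence 1: "(\<lambda>z. theta_fn \<tau>' (z / \<tau>)) holomorphic_on UNIV"
    using holomorphic_on_compose_gen[OF _ theta_fn_holomorphic[OF \<tau>']] by (simp add: o_def)
  have 2: "(\<lambda>z. - z\<^sup>2 / (2 * \<tau>)) holomorphic_on UNIV"
    using \<tau>0 by (intro holomorphic_on_divide holomorphic_on_minus holomorphic_on_power
        holomorphic_on_ident holomorphic_on_const) simp
  have hol: "U holomorphic_on UNIV"
    unfolding U_def by (intro holomorphic_on_mult 1 holomorphic_e2pii 2)
  have thf0: "theta_fn \<tau>' 0 = 0"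
    unfolding theta_fn_eq_0_iff[OF \<tau>'] by (intro exI[of _ 0]) simp
  hence U0: "U 0 = 0" by (simp add: U_def)
  have deriv: "deriv (theta_fn \<tau>) 0 \<noteq> 0"
    using DERIV_imp_deriv[OF theta_fn_has_derivative_0[OF \<tau>]] qpoch_self_nonzero[OF norm_e2pii_less_1[OF \<tau>]] by simp
  have nz: "- (e2pii (- z) * e2pii (- \<tau> / 2)) \<noteq> 0" for z by simp
  obtain C where C: "\<And>z. U z = C * theta_fn \<tau> z"
    using elliptic_ratio_constant[OF \<tau> hol theta_fn_holomorphic[OF \<tau>] _ U_add_1 theta_fn_add_1[OF \<tau>]
        nz U_add_\<tau> theta_fn_add_tau[OF \<tau>] theta_fn_eq_0_iff[OF \<tau>] U0 deriv] by (metis neg_equal_0_iff_equal one_neq_zero)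
  \<comment> \<open>Absolute values of the Weber functions, up to constants and powers of q: their
    squares give theta at 1/2, \<tau>/2 and (1 + \<tau>)/2. Inversion exchanges the first two
    half-periods and fixes the third, up to lattice translations and sign.\<close>
  define u where "u \<tau> = norm (qpoch (- e2pii \<tau>) (e2pii \<tau>))" for \<tau>
  define v where "v \<tau> = norm (qpoch (e2pii (\<tau> / 2)) (e2pii \<tau>))" for \<tau>
  define w where "w \<tau> = norm (qpoch (- e2pii (\<tau> / 2)) (e2pii \<tau>))" for \<tau>
  have uvw: "u \<tau> * v \<tau> * w \<tau> = 1" if "Im \<tau> > 0" for \<tau>
  proof -
    have sq: "(e2pii (\<tau> / 2))\<^sup>2 = e2pii \<tau>" by (simp add: e2pii_power)
    have "qpoch (e2pii (\<tau> / 2)) (e2pii \<tau>) * qpoch (- e2pii (\<tau> / 2)) (e2pii \<tau>) = qpoch (e2pii \<tau>) ((e2pii \<tau>)\<^sup>2)"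
      using qpoch_mult_minus[OF norm_e2pii_less_1[OF that], of "e2pii (\<tau> / 2)"] by (simp add: sq)
    hence "v \<tau> * w \<tau> = norm (qpoch (e2pii \<tau>) ((e2pii \<tau>)\<^sup>2))"
      by (simp add: v_def w_def norm_mult [symmetric])
    hence "u \<tau> * v \<tau> * w \<tau> = norm (qpoch (- e2pii \<tau>) (e2pii \<tau>) * qpoch (e2pii \<tau>) ((e2pii \<tau>)\<^sup>2))"
      by (simp add: u_def norm_mult)
    thus ?thesis using qpoch_euler[OF norm_e2pii_less_1[OF that]] by simp
  qed
  have theta_fn_u: "norm (theta_fn \<tau> (1 / 2)) = 2 * (u \<tau>)\<^sup>2" if "Im \<tau> > 0" for \<tau>
  proof -
    have "qpoch (-1) (e2pii \<tau>) = 2 * qpoch (- e2pii \<tau>) (e2pii \<tau>)"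
      using qpoch_rec[OF norm_e2pii_less_1[OF that], of "-1"] by simp
    thus ?thesis
      by (simp add: theta_fn_def norm_mult e2pii_diff norm_e2pii u_def power2_eq_square)
  qed
  have theta_fn_v: "norm (theta_fn \<tau> (\<tau> / 2)) = norm (e2pii (- \<tau> / 4)) * (v \<tau>)\<^sup>2" for \<tau>
    by (simp add: theta_fn_def norm_mult v_def power2_eq_square)
  have theta_fn_w: "norm (theta_fn \<tau> ((1 + \<tau>) / 2)) = norm (e2pii (- \<tau> / 4)) * (w \<tau>)\<^sup>2" for \<tau>
  proof -
    have "e2pii ((1 + \<tau>) / 2) = - e2pii (\<tau> / 2)" by (simp add: add_divide_distrib e2pii_add)
    moreover have "e2pii (\<tau> - (1 + \<tau>) / 2) = - e2pii (\<tau> / 2)"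
    proof -
      have "\<tau> - (1 + \<tau>) / 2 = \<tau> / 2 - 1 / 2" by (simp add: field_simps)
      thus ?thesis by (simp add: e2pii_diff)
    qed
    moreover have "norm (e2pii (- ((1 + \<tau>) / 2) / 2)) = norm (e2pii (- \<tau> / 4))"
      by (simp add: norm_e2pii)
    ultimately show ?thesis by (simp add: theta_fn_def norm_mult w_def power2_eq_square)
  qed
  define E E' where "E = norm (e2pii (- (\<tau> / 8)))" and "E' = norm (e2pii (- (\<tau>' / 8)))"
  have E2: "norm (e2pii (- (\<tau> / 4))) = E\<^sup>2" and E'2: "norm (e2pii (- (\<tau>' / 4))) = E'\<^sup>2"
    and E'i: "norm (e2pii (\<tau>' / 8)) = inverse E'"
    by (simp_all add: E_def E'_def norm_power [symmetric] e2pii_power norm_inverse [symmetric] e2pii_minus [symmetric])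
  have Epos: "E > 0" "E' > 0" by (simp_all add: E_def E'_def)
  \<comment> \<open>1/2 divided by \<tau> is -\<tau>'/2, while \<open>theta_fn_v\<close> speaks of
    \<tau>'/2.\<close>
  have even: "norm (theta_fn \<tau>' (- z)) = norm (theta_fn \<tau>' z)" if "z = \<tau>' / 2" for z
  proof -
    have "theta_fn \<tau>' (- z + \<tau>') = - (e2pii z * e2pii (- \<tau>' / 2)) * theta_fn \<tau>' (- z)"
      using theta_fn_add_tau[OF \<tau>', of "- z"] by simp
    also have "e2pii z * e2pii (- \<tau>' / 2) = 1"
      by (simp add: that e2pii_add [symmetric])
    finally show ?thesis by (simp add: that)
  qed
  have 1: "E' * (v \<tau>')\<^sup>2 = norm C * (2 * (u \<tau>)\<^sup>2)"
  proof -
    have "norm (U (1 / 2)) = norm (theta_fn \<tau>' (- (\<tau>' / 2))) * norm (e2pii (\<tau>' / 8))"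
      by (simp add: U_def norm_mult \<tau>'_def power2_eq_square mult_ac)
    also have "\<dots> = norm (e2pii (- \<tau>' / 4)) * (v \<tau>')\<^sup>2 * norm (e2pii (\<tau>' / 8))"
      by (simp only: even[OF refl] theta_fn_v)
    also have "\<dots> = E' * (v \<tau>')\<^sup>2"
      using Epos by (simp add: E'2 E'i power2_eq_square)
    finally show ?thesis by (simp only: C norm_mult theta_fn_u[OF \<tau>])
  qed
  have 2: "2 * (u \<tau>')\<^sup>2 = norm C * (E * (v \<tau>)\<^sup>2)"
  proof -
    have "norm (U (\<tau> / 2)) = norm (theta_fn \<tau>' (1 / 2)) * norm (e2pii (- \<tau> / 8))"
      using \<tau>0 by (simp add: U_def norm_mult power2_eq_square)
    hence "2 * (u \<tau>')\<^sup>2 * E = norm C * (E\<^sup>2 * (v \<tau>)\<^sup>2)"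
      by (simp add: C theta_fn_u[OF \<tau>'] theta_fn_v norm_mult E2 flip: E_def)
    thus ?thesis using Epos by (simp add: power2_eq_square)
  qed
  have 3: "E' * (w \<tau>')\<^sup>2 = norm C * (E * (w \<tau>)\<^sup>2)"
  proof -
    have "norm (theta_fn \<tau>' ((1 + \<tau>') / 2)) = norm (theta_fn \<tau>' ((1 - \<tau>') / 2))"
    proof -
      have 1: "(1 - \<tau>') / 2 + \<tau>' = (1 + \<tau>') / 2" by (simp add: field_simps)
      have "- ((1 - \<tau>') / 2) + - \<tau>' / 2 = - (1 / 2)" by (simp add: field_simps)
      hence 2: "e2pii (- ((1 - \<tau>') / 2)) * e2pii (- \<tau>' / 2) = - 1"
        by (simp only: e2pii_add [symmetric]) (simp add: e2pii_minus)
      show ?thesis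
        using theta_fn_add_tau[OF \<tau>', of "(1 - \<tau>') / 2"] by (simp only: 1 2) simp
    qed
    moreover have "norm (U ((1 + \<tau>) / 2)) = norm (theta_fn \<tau>' ((1 - \<tau>') / 2)) * (norm (e2pii (\<tau>' / 8)) * E)"
    proof -
      have 1: "(1 + \<tau>) / 2 / \<tau> = (1 - \<tau>') / 2" using \<tau>0 by (simp add: \<tau>'_def field_simps)
      have "- ((1 + \<tau>) / 2)\<^sup>2 / (2 * \<tau>) = \<tau>' / 8 + (- (\<tau> / 8) + - (1 / 4))"
        using \<tau>0 by (simp add: \<tau>'_def divide_simps) (simp add: algebra_simps power2_eq_square)
      hence "e2pii (- ((1 + \<tau>) / 2)\<^sup>2 / (2 * \<tau>)) = e2pii (\<tau>' / 8) * (e2pii (- (\<tau> / 8)) * e2pii (- (1 / 4)))"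
        by (simp only: e2pii_add)
      moreover have "norm (e2pii (- (1 / 4))) = 1" by (simp add: norm_e2pii)
      ultimately show ?thesis by (simp only: U_def norm_mult E_def 1 mult_1_right)
    qed
    ultimately have "E'\<^sup>2 * (w \<tau>')\<^sup>2 * (inverse E' * E) = norm C * (E\<^sup>2 * (w \<tau>)\<^sup>2)"
      by (simp only: C theta_fn_w norm_mult) (simp add: E2 E'2 E'i)
    thus ?thesis using Epos by (simp add: power2_eq_square field_simps)
  qed
  have "2 * E'\<^sup>2 * (u \<tau>' * v \<tau>' * w \<tau>')\<^sup>2 = 2 * norm C ^ 3 * E\<^sup>2 * (u \<tau> * v \<tau> * w \<tau>)\<^sup>2"
  proof -
    have "2 * E'\<^sup>2 * (u \<tau>' * v \<tau>' * w \<tau>')\<^sup>2 = (2 * (u \<tau>')\<^sup>2) * (E' * (v \<tau>')\<^sup>2) * (E' * (w \<tau>')\<^sup>2)"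
      by (simp add: power2_eq_square)
    thus ?thesis unfolding 1 2 3 by (simp add: power2_eq_square power3_eq_cube)
  qed
  \<comment> \<open>In the product of the three relations the half-period values cancel by Euler's
    identity, which leaves an equation for |C|^3 alone.\<close>
  hence E3: "E'\<^sup>2 = norm C ^ 3 * E\<^sup>2" using uvw[OF \<tau>] uvw[OF \<tau>'] by simp
  define e e' where "e = norm (e2pii (- \<tau> / 12))" and "e' = norm (e2pii (- \<tau>' / 12))"
  have e3: "e ^ 3 = E\<^sup>2" and e'3: "e' ^ 3 = E'\<^sup>2"
    by (simp_all add: e_def e'_def E_def E'_def norm_power [symmetric] e2pii_power)
  have epos: "e > 0" "e' > 0" by (simp_all add: e_def e'_def)
  \<comment> \<open>The cube root is taken among positive reals and is therefore unambiguous; for C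
    itself a cube root of unity would remain open.\<close>
  have "e' ^ 3 = (norm C * e) ^ 3" by (simp add: e3 e'3 E3 power_mult_distrib)
  hence eC: "e' = norm C * e"
    by (rule power_eq_imp_eq_base) (use epos in auto)
  have "(U has_field_derivative C * (- (2 * of_real pi * \<i>) * (?Q \<tau>)\<^sup>2)) (at 0)"
  proof -
    have "U = (\<lambda>z. C * theta_fn \<tau> z)" using C by auto
    thus ?thesis using DERIV_cmult[OF theta_fn_has_derivative_0[OF \<tau>], of C] by simp
  qed
  from DERIV_unique[OF this dU] have "C * (?Q \<tau>)\<^sup>2 * \<tau> = (?Q \<tau>')\<^sup>2"
    using \<tau>0 by (simp add: field_simps)
  hence Q: "norm (?Q \<tau>') ^ 2 = norm C * norm (?Q \<tau>) ^ 2 * norm \<tau>"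
    by (metis norm_mult norm_power)
  have e_inv: "norm (e2pii (\<tau> / 12)) = inverse e" "norm (e2pii (\<tau>' / 12)) = inverse e'"
    by (simp_all add: e_def e'_def norm_inverse [symmetric] e2pii_minus [symmetric])
  have "norm C \<noteq> 0" using eC epos by auto
  thus ?thesis unfolding Q e_inv eC using epos by (simp add: field_simps)
qed

section \<open>The size of eta\<close>

lemma eta_eq_qpoch: "eta \<tau> = e2pii (\<tau> / 24) * qpoch (e2pii \<tau>) (e2pii \<tau>)"
  by (simp add: eta_def qpoch_def)

lemma eta_nonzero: "Im \<tau> > 0 \<Longrightarrow> eta \<tau> \<noteq> 0"
  by (simp add: eta_eq_qpoch qpoch_self_nonzero norm_e2pii_less_1)

lemma eta_holomorphic: "eta holomorphic_on {\<tau>. Im \<tau> > 0}"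
proof -
  have "(\<lambda>\<tau>. e2pii (\<tau> / 24) * qpoch (e2pii \<tau>) (e2pii \<tau>)) holomorphic_on {\<tau>. Im \<tau> > 0}"
    by (intro holomorphic_intros open_halfspace_Im_gt norm_e2pii_less_1) auto
  thus ?thesis by (simp add: eta_eq_qpoch [abs_def])
qed

lemma norm_eta_add_1: "norm (eta (\<tau> + 1)) = norm (eta \<tau>)"
  by (simp add: eta_eq_qpoch norm_mult e2pii_add add_divide_distrib norm_e2pii)

lemma norm_eta_inversion:
  assumes "Im \<tau> > 0"
  shows "norm (eta (- 1 / \<tau>)) ^ 2 = norm \<tau> * norm (eta \<tau>) ^ 2"
proof -
  have "norm (eta \<tau>) ^ 2 = norm (e2pii (\<tau> / 12)) * norm (qpoch (e2pii \<tau>) (e2pii \<tau>)) ^ 2" for \<tau>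
    by (simp add: eta_eq_qpoch norm_mult power_mult_distrib norm_power [symmetric] e2pii_power)
  thus ?thesis using norm_qpoch_inversion[OF assms] by metis
qed

text \<open>For Im \<tau> \<ge> 1 the number q stays in a compact disc inside the unit disc, where
  (q; q) has no zeros. Both bounds are wanted because eta occurs with exponents of either
  sign.\<close>

lemma norm_qpoch_bounds:
  obtains l u where "0 < l" 
    "\<And>\<tau>. Im \<tau> \<ge> 1 \<Longrightarrow> l \<le> norm (qpoch (e2pii \<tau>) (e2pii \<tau>)) \<and> norm (qpoch (e2pii \<tau>) (e2pii \<tau>)) \<le> u"
proof -
  let ?r = "exp (- (2 * pi))" and ?f = "\<lambda>q. norm (qpoch q q)"
  have r: "?r < 1" by simp
  have "(\<lambda>q. qpoch q q) holomorphic_on ball 0 1"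
    by (intro holomorphic_intros) auto
  moreover have "cball 0 ?r \<subseteq> (ball 0 1 :: complex set)"
    using r by (simp add: cball_subset_ball_iff)
  ultimately have c: "continuous_on (cball 0 ?r) ?f"
    by (intro continuous_intros) (meson continuous_on_subset holomorphic_on_imp_continuous_on)
  obtain x where x: "x \<in> cball 0 ?r" "\<And>q. q \<in> cball 0 ?r \<Longrightarrow> ?f x \<le> ?f q"
    using continuous_attains_inf[OF _ _ c] by auto
  have "\<exists>y\<in>cball 0 ?r. \<forall>q\<in>cball 0 ?r. ?f q \<le> ?f y"
    by (rule continuous_attains_sup[OF _ _ c]) auto
  then obtain y where y: "\<And>q. q \<in> cball 0 ?r \<Longrightarrow> ?f q \<le> ?f y" by blast
  have "norm x < 1" using le_less_trans[OF _ r, of "norm x"] x(1) by simp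
  hence "0 < ?f x" using qpoch_self_nonzero by simp
  moreover have "e2pii \<tau> \<in> cball 0 ?r" if "Im \<tau> \<ge> 1" for \<tau>
    using that by (simp add: norm_e2pii)
  ultimately show ?thesis using that x y by blast
qed

section \<open>Laurent polynomials\<close>

lemma fps_const_dvd_iff:
  fixes f :: "'a :: comm_ring_1 fps"
  shows "fps_const b dvd f \<longleftrightarrow> (\<forall>n. b dvd fps_nth f n)"
proof
  assume "fps_const b dvd f"
  thus "\<forall>n. b dvd fps_nth f n" by (auto elim!: dvdE)
next
  assume "\<forall>n. b dvd fps_nth f n"
  then obtain h where "\<And>n. fps_nth f n = b * h n" unfolding dvd_def by metis
  hence "f = fps_const b * Abs_fps h" by (intro fps_ext) simp
  thus "fps_const b dvd f" by simp
qed

lemma poly_mapping_sum_single: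
  "L = (\<Sum>i\<in>Poly_Mapping.keys L. Poly_Mapping.single i (Poly_Mapping.lookup L i))"
  by (rule poly_mapping_eqI) (simp add: lookup_sum lookup_single when_def in_keys_iff)

lemma lookup_single_times:
  fixes L :: laurent
  shows "Poly_Mapping.lookup (Poly_Mapping.single a c * L) i = c * Poly_Mapping.lookup L (i - a)"
proof -
  have "Poly_Mapping.single a c * L
          = (\<Sum>j\<in>Poly_Mapping.keys L. Poly_Mapping.single (a + j) (c * Poly_Mapping.lookup L j))"
    by (subst (1) poly_mapping_sum_single[of L]) (simp add: sum_distrib_left mult_single)
  hence "Poly_Mapping.lookup (Poly_Mapping.single a c * L) i
          = (\<Sum>j\<in>Poly_Mapping.keys L. if j = i - a then c * Poly_Mapping.lookup L j else 0)"
    by (simp add: lookup_sum lookup_single when_def algebra_simps)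
  thus ?thesis by (simp add: in_keys_iff)
qed

definition laurent_eval :: "laurent \<Rightarrow> complex \<Rightarrow> complex" where
  "laurent_eval L x = (\<Sum>i\<in>Poly_Mapping.keys L. Poly_Mapping.lookup L i * x powi i)"

lemma laurent_eval_superset:
  assumes "finite A" "Poly_Mapping.keys L \<subseteq> A"
  shows "laurent_eval L x = (\<Sum>i\<in>A. Poly_Mapping.lookup L i * x powi i)"
  unfolding laurent_eval_def by (rule sum.mono_neutral_left) (use assms in \<open>auto simp: in_keys_iff\<close>)

lemma laurent_eval_0 [simp]: "laurent_eval 0 x = 0"
  by (simp add: laurent_eval_def)

lemma laurent_eval_add: "laurent_eval (L + M) x = laurent_eval L x + laurent_eval M x"
proof -
  let ?A = "Poly_Mapping.keys L \<union> Poly_Mapping.keys M"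
  have "Poly_Mapping.keys (L + M) \<subseteq> ?A" by (rule keys_add)
  thus ?thesis
    using laurent_eval_superset[of ?A "L + M"] laurent_eval_superset[of ?A L] laurent_eval_superset[of ?A M]
    by (simp add: lookup_add distrib_right sum.distrib)
qed

lemma laurent_eval_sum: "laurent_eval (sum f A) x = (\<Sum>a\<in>A. laurent_eval (f a) x)"
  by (induction A rule: infinite_finite_induct) (simp_all add: laurent_eval_add)

lemma laurent_eval_single: "laurent_eval (Poly_Mapping.single i a) x = a * x powi i"
  by (simp add: laurent_eval_def)

text \<open>0 has to be excluded: \<open>0 powi n\<close> is 0 for negative n, so the monomials of
  degree 1 and -1 would both evaluate to 0 although their product is 1.\<close>

lemma laurent_eval_mult:
  assumes "x \<noteq> 0"
  shows "laurent_eval (L * M) x = laurent_eval L x * laurent_eval M x"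
proof -
  have "L * M = (\<Sum>i\<in>Poly_Mapping.keys L. \<Sum>j\<in>Poly_Mapping.keys M.
          Poly_Mapping.single (i + j) (Poly_Mapping.lookup L i * Poly_Mapping.lookup M j))"
    by (subst poly_mapping_sum_single[of L], subst poly_mapping_sum_single[of M])
       (simp only: sum_product mult_single)
  hence "laurent_eval (L * M) x = (\<Sum>i\<in>Poly_Mapping.keys L. \<Sum>j\<in>Poly_Mapping.keys M.
          (Poly_Mapping.lookup L i * x powi i) * (Poly_Mapping.lookup M j * x powi j))"
    using assms by (simp add: laurent_eval_sum laurent_eval_single power_int_add mult_ac)
  thus ?thesis by (simp only: laurent_eval_def sum_product)
qed

lemma laurent_eval_1 [simp]: "laurent_eval 1 x = 1"
  using laurent_eval_single[of 0 1 x] by simp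

lemma laurent_eval_power: "x \<noteq> 0 \<Longrightarrow> laurent_eval (L ^ n) x = laurent_eval L x ^ n"
  by (induction n) (simp_all add: laurent_eval_mult)

lemma laurent_eval_holomorphic: "(\<lambda>z. laurent_eval L (e2pii (z + \<mu>))) holomorphic_on S"
  unfolding laurent_eval_def e2pii_powi by (intro holomorphic_intros)

lemma laurent_eval_laurent_of_poly: "laurent_eval (laurent_of_poly p) x = poly p x"
  by (simp add: laurent_of_poly_def laurent_eval_sum laurent_eval_single poly_altdef)

lemma lookup_laurent_of_poly:
  "Poly_Mapping.lookup (laurent_of_poly p) i = (if i \<ge> 0 then poly.coeff p (nat i) else 0)"
proof (cases "i \<ge> 0")
  case True
  then obtain n where "i = int n" using nonneg_int_cases by blast
  thus ?thesis
    by (simp add: laurent_of_poly_def lookup_sum lookup_single when_def coeff_eq_0)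
next
  case False
  thus ?thesis by (auto simp: laurent_of_poly_def lookup_sum lookup_single when_def intro!: sum.neutral)
qed

lemma laurent_of_poly_0 [simp]: "laurent_of_poly 0 = 0"
  by (simp add: laurent_of_poly_def)

lemma laurent_of_poly_1 [simp]: "laurent_of_poly 1 = 1"
  by (simp add: laurent_of_poly_def)

lemma laurent_of_poly_add: "laurent_of_poly (p + q) = laurent_of_poly p + laurent_of_poly q"
  by (rule poly_mapping_eqI) (simp add: lookup_laurent_of_poly lookup_add)

lemma laurent_of_poly_smult:
  "laurent_of_poly (Polynomial.smult a p) = Poly_Mapping.single 0 a * laurent_of_poly p"
  by (rule poly_mapping_eqI) (simp add: lookup_laurent_of_poly lookup_single_times)

lemma laurent_of_poly_pCons:
  "laurent_of_poly (pCons a p) = Poly_Mapping.single 0 a + Poly_Mapping.single 1 1 * laurent_of_poly p"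
proof (rule poly_mapping_eqI)
  fix i :: int
  show "Poly_Mapping.lookup (laurent_of_poly (pCons a p)) i =
      Poly_Mapping.lookup (Poly_Mapping.single 0 a + Poly_Mapping.single 1 1 * laurent_of_poly p) i"
  proof (cases i rule: int_cases3)
    case (pos n)
    then obtain n' where "n = Suc n'" by (cases n) auto
    thus ?thesis using pos
      by (simp add: lookup_laurent_of_poly lookup_add lookup_single_times lookup_single nat_add_distrib)
  qed (simp_all add: lookup_laurent_of_poly lookup_add lookup_single_times lookup_single)
qed

lemma laurent_of_poly_mult: "laurent_of_poly (p * q) = laurent_of_poly p * laurent_of_poly q"
  by (induction p)
     (simp_all add: laurent_of_poly_add laurent_of_poly_smult laurent_of_poly_pCons algebra_simps)

lemma laurent_of_poly_power: "laurent_of_poly (p ^ n) = laurent_of_poly p ^ n"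
  by (induction n) (simp_all add: laurent_of_poly_mult)

lemma laurent_of_poly_prod: "laurent_of_poly (prod f A) = (\<Prod>a\<in>A. laurent_of_poly (f a))"
  by (induction A rule: infinite_finite_induct) (simp_all add: laurent_of_poly_mult)

text \<open>Monomials are units, so divisibility can be decided for ordinary polynomials, where
  \<open>order\<close> is at hand.\<close>

lemma laurent_eq_shifted_poly:
  obtains M p where "L = Poly_Mapping.single (- M) 1 * laurent_of_poly p"
proof -
  have "finite (Poly_Mapping.keys L)" by simp
  then obtain l where l: "\<And>i. i \<in> Poly_Mapping.keys L \<Longrightarrow> l \<le> i"
    by (metis Min_le)
  define p where "p = (\<Sum>i\<in>Poly_Mapping.keys L. Polynomial.monom (Poly_Mapping.lookup L i) (nat (i - l)))"
  have "Poly_Mapping.lookup (Poly_Mapping.single l 1 * laurent_of_poly p) i = Poly_Mapping.lookup L i" for i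
  proof (cases "i \<ge> l")
    case True
    have "poly.coeff p (nat (i - l)) = (\<Sum>j\<in>Poly_Mapping.keys L. if j = i then Poly_Mapping.lookup L j else 0)"
      unfolding p_def coeff_sum
      by (intro sum.cong refl) (use l True in \<open>auto simp: nat_eq_iff2 eq_nat_nat_iff\<close>)
    thus ?thesis using True by (simp add: lookup_single_times lookup_laurent_of_poly in_keys_iff)
  next
    case False
    hence "i \<notin> Poly_Mapping.keys L" using l by fastforce
    thus ?thesis using False by (simp add: lookup_single_times lookup_laurent_of_poly in_keys_iff)
  qed
  hence "L = Poly_Mapping.single (- (- l)) 1 * laurent_of_poly p"
    by (intro poly_mapping_eqI) simp
  thus ?thesis using that by blast
qed

text \<open>Distinct linear factors are coprime: once a power of one is divided out, the order at
  the other roots is unchanged. For \<open>p = 0\<close> the cofactor is 0 as well.\<close>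

lemma prod_linear_factors_dvd:
  fixes p :: "complex poly"
  assumes "finite A" "inj_on x A" "\<And>a. a \<in> A \<Longrightarrow> [:- x a, 1:] ^ n a dvd p"
  shows "(\<Prod>a\<in>A. [:- x a, 1:] ^ n a) dvd p"
  using assms
proof (induction A arbitrary: p rule: finite_induct)
  case (insert a A)
  obtain s where s: "p = [:- x a, 1:] ^ n a * s" using insert.prems(2)[of a] by (auto elim: dvdE)
  have "[:- x b, 1:] ^ n b dvd s" if "b \<in> A" for b
  proof (cases "p = 0")
    case True
    thus ?thesis using s by simp
  next
    case False
    hence "[:- x a, 1:] ^ n a * s \<noteq> 0" using s by simp
    have "x a \<noteq> x b" using insert that by (auto simp: inj_on_def)
    hence "Polynomial.order (x b) ([:- x a, 1:] ^ n a) = 0"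
      by (intro order_0I) (simp add: poly_power)
    hence "Polynomial.order (x b) p = Polynomial.order (x b) s"
      unfolding s by (subst order_mult) (use s False in auto)
    thus ?thesis using insert.prems(2)[of b] that False by (simp add: order_divides)
  qed
  hence "(\<Prod>a\<in>A. [:- x a, 1:] ^ n a) dvd s"
    using insert by (intro insert.IH) (auto simp: inj_on_def)
  thus ?case using insert by (simp add: s mult_dvd_mono)
qed simp

section \<open>Vanishing of Laurent polynomials at roots of unity\<close>

text \<open>The change from \<zeta> to z: e(z) - 1 has a simple zero at 0, so orders of vanishing at
  a root of unity are the same in both variables.\<close>

lemma e2pii_minus_1_factor:
  obtains k where "k holomorphic_on UNIV" "k 0 \<noteq> 0" "\<And>z. e2pii z - 1 = z * k z"
proof -
  define k where "k z = (if z = 0 then deriv (\<lambda>z. e2pii z - 1) 0 else (e2pii z - 1 - (e2pii 0 - 1)) / (z - 0))" for z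
  have "k holomorphic_on UNIV"
    unfolding k_def [abs_def] by (rule pole_lemma) (auto intro!: holomorphic_intros)
  moreover have "((\<lambda>z. e2pii z - 1) has_field_derivative 2 * of_real pi * \<i> * e2pii 0 - 0) (at 0)"
    by (rule DERIV_diff[OF e2pii_has_derivative DERIV_const])
  hence "deriv (\<lambda>z. e2pii z - 1) 0 = 2 * of_real pi * \<i>" using DERIV_imp_deriv by fastforce
  hence "k 0 \<noteq> 0" by (simp add: k_def)
  moreover have "e2pii z - 1 = z * k z" for z by (simp add: k_def)
  ultimately show ?thesis using that by blast
qed

lemma baby_theta_block_dvd_imp_factor:
  assumes fin: "finite {r. \<nu> r \<noteq> 0}" and r: "r \<ge> 1" "\<nu> r > 0" and j: "j \<in> totatives r"
    and dvd: "baby_theta_block \<nu> dvd L"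
  obtains k where "k holomorphic_on UNIV"
    "\<And>z. laurent_eval L (e2pii (z + of_nat j / of_nat r)) = z ^ nat (\<nu> r) * k z"
proof -
  let ?\<mu> = "of_nat j / of_nat r :: complex"
  let ?R = "{r. r \<ge> 1 \<and> \<nu> r \<noteq> 0}"
  have finR: "finite ?R" by (rule finite_subset[OF _ fin]) auto
  obtain s where s: "s holomorphic_on UNIV" "\<And>z. e2pii z - 1 = z * s z"
    using e2pii_minus_1_factor by metis
  have "laurent_of_poly [:- e2pii ?\<mu>, 1:] ^ nat (\<nu> r) dvd laurent_of_poly (cyclotomic r) ^ nat (\<nu> r)"
  proof (rule dvd_power_same)
    have "[:- e2pii ?\<mu>, 1:] dvd cyclotomic r"
      unfolding cyclotomic_def by (rule dvd_prodI) (use j in auto)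
    then obtain s where "cyclotomic r = [:- e2pii ?\<mu>, 1:] * s" by (elim dvdE)
    thus "laurent_of_poly [:- e2pii ?\<mu>, 1:] dvd laurent_of_poly (cyclotomic r)"
      by (simp only: laurent_of_poly_mult dvd_triv_left)
  qed
  also have "\<dots> dvd (\<Prod>r\<in>?R. laurent_of_poly (cyclotomic r) ^ nat (\<nu> r))"
    by (rule dvd_prodI) (use finR r in auto)
  also have "\<dots> dvd baby_theta_block \<nu>"
    by (simp add: baby_theta_block_def)
  also note dvd
  finally obtain H where H: "L = laurent_of_poly [:- e2pii ?\<mu>, 1:] ^ nat (\<nu> r) * H" by (elim dvdE)
  have "laurent_eval L (e2pii (z + ?\<mu>)) = z ^ nat (\<nu> r) * ((e2pii ?\<mu> * s z) ^ nat (\<nu> r) * laurent_eval H (e2pii (z + ?\<mu>)))" for z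
  proof -
    have "e2pii (z + ?\<mu>) - e2pii ?\<mu> = z * (e2pii ?\<mu> * s z)"
      using s(2)[of z] by (simp add: e2pii_add algebra_simps)
    hence "laurent_eval (laurent_of_poly [:- e2pii ?\<mu>, 1:]) (e2pii (z + ?\<mu>)) = z * (e2pii ?\<mu> * s z)"
      by (simp add: laurent_eval_laurent_of_poly)
    thus ?thesis by (simp add: H laurent_eval_mult laurent_eval_power power_mult_distrib)
  qed
  thus ?thesis
    by (intro that[of "\<lambda>z. (e2pii ?\<mu> * s z) ^ nat (\<nu> r) * laurent_eval H (e2pii (z + ?\<mu>))"])
       (auto intro!: holomorphic_intros s laurent_eval_holomorphic)
qed

text \<open>If the root \<open>e2pii \<mu>\<close> had order o' < n in p, the evaluation would be
  z^o' times a function that does not vanish at 0, and the bound would fail for small z.\<close>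

lemma linear_power_dvd_if_bound:
  assumes bound: "\<And>z. norm z \<le> 1 \<Longrightarrow> norm (laurent_eval L (e2pii (z + \<mu>))) \<le> C * norm z ^ n"
    and L: "L = Poly_Mapping.single (- M) 1 * laurent_of_poly p"
  shows "[:- e2pii \<mu>, 1:] ^ n dvd p"
proof (rule ccontr)
  let ?x = "e2pii \<mu>"
  assume not_dvd: "\<not> [:- ?x, 1:] ^ n dvd p"
  hence p0: "p \<noteq> 0" by auto
  define o' where "o' = Polynomial.order ?x p"
  have less: "o' < n" using not_dvd p0 by (simp add: order_divides o'_def)
  obtain s where s: "p = [:- ?x, 1:] ^ o' * s" "\<not> [:- ?x, 1:] dvd s"
    using order_decomp[OF p0, of ?x] by (auto simp: o'_def)
  hence sx: "poly s ?x \<noteq> 0" by (simp add: poly_eq_0_iff_dvd)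
  obtain k where k: "k holomorphic_on UNIV" "k 0 \<noteq> 0" "\<And>z. e2pii z - 1 = z * k z"
    using e2pii_minus_1_factor by metis
  define F where "F z = e2pii (of_int (- M) * (z + \<mu>)) * (?x * k z) ^ o' * poly s (e2pii (z + \<mu>))" for z
  have F: "laurent_eval L (e2pii (z + \<mu>)) = z ^ o' * F z" for z
  proof -
    have "e2pii (z + \<mu>) - ?x = z * (?x * k z)"
      using k(3)[of z] by (simp add: e2pii_add algebra_simps)
    thus ?thesis
      by (simp add: L laurent_eval_mult laurent_eval_single laurent_eval_laurent_of_poly s(1) poly_mult poly_power e2pii_powi
          F_def power_mult_distrib mult_ac)
  qed
  have "continuous_on UNIV F"
    unfolding F_def [abs_def]
    by (intro continuous_intros holomorphic_on_imp_continuous_on k continuous_on_poly)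
  hence "(F \<longlongrightarrow> F 0) (at 0)"
    by (simp add: continuous_on_def)
  hence lim: "((\<lambda>z. norm (F z)) \<longlongrightarrow> norm (F 0)) (at 0)" by (rule tendsto_norm)
  have "((\<lambda>z::complex. C * norm z ^ (n - o')) \<longlongrightarrow> C * norm (0::complex) ^ (n - o')) (at 0)"
    by (intro tendsto_intros)
  hence lim0: "((\<lambda>z::complex. C * norm z ^ (n - o')) \<longlongrightarrow> 0) (at 0)"
    using less by (simp add: power_0_left)
  have ev: "eventually (\<lambda>z::complex. norm (F z) \<le> C * norm z ^ (n - o')) (at 0)"
    unfolding eventually_at
  proof (intro exI[of _ 1] conjI ballI impI)
    fix z :: complex assume z: "z \<noteq> 0 \<and> dist z 0 < 1"
    have "norm z ^ o' * norm (F z) \<le> C * norm z ^ n"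
      using bound[of z] z F[of z] by (simp add: norm_mult norm_power)
    also have "\<dots> = norm z ^ o' * (C * norm z ^ (n - o'))"
      using less by (simp add: power_add [symmetric])
    finally show "norm (F z) \<le> C * norm z ^ (n - o')" using z by simp
  qed simp
  have "norm (F 0) \<le> 0"
    by (rule tendsto_le[OF _ lim0 lim ev]) simp
  thus False using sx k(2) by (simp add: F_def)
qed

text \<open>Fractions of totatives lie in (0, 1], so equal roots of unity force equal fractions in
  lowest terms. Hence cyclotomic polynomials for different r share no root.\<close>

lemma totatives_fraction_inj:
  assumes "j \<in> totatives r" "j' \<in> totatives r'"
    and "e2pii (of_nat j / of_nat r) = e2pii (of_nat j' / of_nat r')"
  shows "r = r' \<and> j = j'"
proof -
  have pos: "0 < j" "j \<le> r" "coprime j r" "0 < j'" "j' \<le> r'" "coprime j' r'"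
    using assms by (auto simp: in_totatives_iff)
  obtain n :: int where n: "of_nat j / of_nat r = of_nat j' / of_nat r' + (of_int n :: complex)"
    using assms(3) by (auto simp: e2pii_eq_iff)
  have "complex_of_real (real j / real r) = complex_of_real (real j' / real r' + of_int n)"
    using n by simp
  hence n': "real j / real r = real j' / real r' + of_int n" using of_real_eq_iff by blast
  have "real j / real r \<le> 1" "real j / real r > 0" "real j' / real r' \<le> 1" "real j' / real r' > 0"
    using pos by auto
  hence "real_of_int n < 1" "real_of_int n > -1" using n' by linarith+
  hence "n = 0" by linarith
  hence "real j * real r' = real j' * real r" using n' pos by (simp add: field_simps)
  hence eq: "j * r' = j' * r" by (metis of_nat_eq_iff of_nat_mult)
  have "r dvd r'" using eq pos by (metis coprime_commute coprime_dvd_mult_right_iff dvd_triv_right)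
  moreover have "r' dvd r" using eq pos by (metis coprime_commute coprime_dvd_mult_right_iff dvd_triv_right)
  ultimately have "r = r'" by (rule dvd_antisym)
  thus ?thesis using eq pos by simp
qed

lemma baby_theta_block_dvdI:
  assumes fin: "finite {r. \<nu> r \<noteq> 0}" and nonneg: "\<And>r. r > 0 \<Longrightarrow> \<nu> r \<ge> 0"
    and bound: "\<And>r j. r \<ge> 1 \<Longrightarrow> \<nu> r > 0 \<Longrightarrow> j \<in> totatives r \<Longrightarrow>
        \<exists>C. \<forall>z. norm z \<le> 1 \<longrightarrow> norm (laurent_eval L (e2pii (z + of_nat j / of_nat r))) \<le> C * norm z ^ nat (\<nu> r)"
  shows "baby_theta_block \<nu> dvd L"
proof -
  let ?R = "{r. r \<ge> 1 \<and> \<nu> r \<noteq> 0}"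
  have finR: "finite ?R" by (rule finite_subset[OF _ fin]) auto
  obtain M p where L: "L = Poly_Mapping.single (- M) 1 * laurent_of_poly p"
    by (rule laurent_eq_shifted_poly)
  define B where "B = (\<Prod>r\<in>?R. cyclotomic r ^ nat (\<nu> r))"
  define x where "x = (\<lambda>(r, j). e2pii (of_nat j / of_nat r))"
  have "B = (\<Prod>r\<in>?R. \<Prod>j\<in>totatives r. [:- x (r, j), 1:] ^ nat (\<nu> r))"
    by (simp add: B_def cyclotomic_def prod_power_distrib x_def)
  also have "\<dots> = (\<Prod>a\<in>Sigma ?R totatives. [:- x a, 1:] ^ nat (\<nu> (fst a)))"
    using finR by (subst prod.Sigma) (auto simp: case_prod_unfold)
  also have "\<dots> dvd p"
  proof (rule prod_linear_factors_dvd)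
    show "finite (Sigma ?R totatives)" using finR by auto
    show "inj_on x (Sigma ?R totatives)"
      unfolding inj_on_def x_def using totatives_fraction_inj by fastforce
    fix a assume "a \<in> Sigma ?R totatives"
    then obtain r j where a: "a = (r, j)" "r \<ge> 1" "\<nu> r \<noteq> 0" "j \<in> totatives r" by auto
    hence "\<nu> r > 0" using nonneg[of r] by simp
    then obtain C where "\<And>z. norm z \<le> 1 \<Longrightarrow> norm (laurent_eval L (e2pii (z + of_nat j / of_nat r))) \<le> C * norm z ^ nat (\<nu> r)"
      using bound a by blast
    thus "[:- x a, 1:] ^ nat (\<nu> (fst a)) dvd p"
      using linear_power_dvd_if_bound[OF _ L, of "of_nat j / of_nat r" C "nat (\<nu> r)"]
      by (simp add: a x_def)
  qed
  finally obtain s where p: "p = B * s" by (elim dvdE)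
  let ?e = "(\<Sum>r | r \<ge> 1 \<and> \<nu> r \<noteq> 0. int (totient r) * \<nu> r) div 2"
  have b: "baby_theta_block \<nu> = Poly_Mapping.single (- ?e) 1 * laurent_of_poly B"
    by (simp add: baby_theta_block_def B_def laurent_of_poly_prod laurent_of_poly_power)
  \<comment> \<open>The quotient may carry any monomial, so the powers of \<zeta> in L and in b need
    not match.\<close>
  have "Poly_Mapping.single (- M) (1::complex) = Poly_Mapping.single (- ?e) 1 * Poly_Mapping.single (?e - M) 1"
    by (simp add: mult_single)
  hence "L = baby_theta_block \<nu> * (Poly_Mapping.single (?e - M) 1 * laurent_of_poly s)"
    by (simp only: L p b laurent_of_poly_mult mult_ac)
  thus ?thesis by (rule dvdI)
qed

section \<open>Fourier expansions\<close>

lemma sum_roots_of_unity: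
  assumes "M > 0"
  shows "(\<Sum>x<M. e2pii (of_int k * (of_nat x / of_nat M))) = (if int M dvd k then of_nat M else 0)"
proof -
  let ?w = "e2pii (of_int k / of_nat M)"
  have pow: "e2pii (of_int k * (of_nat x / of_nat M)) = ?w ^ x" for x
    by (simp add: e2pii_power field_simps)
  have wM: "?w ^ M = 1" using assms by (simp add: e2pii_power)
  have w1: "?w = 1 \<longleftrightarrow> int M dvd k"
  proof -
    have "?w = 1 \<longleftrightarrow> (\<exists>n::int. (of_int k :: complex) = of_int (int M * n))"
      using assms by (simp add: e2pii_eq_1_iff field_simps)
    also have "\<dots> \<longleftrightarrow> int M dvd k" unfolding of_int_eq_iff dvd_def ..
    finally show ?thesis .
  qed
  show ?thesis
  proof (cases "?w = 1")
    case True
    thus ?thesis using w1 unfolding pow by simp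
  next
    case False
    thus ?thesis using w1 geometric_sum[OF False, of M] wM unfolding pow by simp
  qed
qed

lemma has_sum_sum:
  fixes f :: "'a \<Rightarrow> 'b \<Rightarrow> 'c :: topological_comm_monoid_add"
  assumes "\<And>i. i \<in> A \<Longrightarrow> (f i has_sum s i) S"
  shows "((\<lambda>x. \<Sum>i\<in>A. f i x) has_sum (\<Sum>i\<in>A. s i)) S"
  using assms by (induction A rule: infinite_finite_induct) (auto intro: has_sum_0 has_sum_add)

text \<open>
  Averaging over the M-th roots of unity in both variables keeps only the terms whose indices are
  congruent to the given ones mod M; all others are in the tail of the series for large M.
\<close>

lemma double_series_coeff_eq_0:
  fixes a :: "int \<times> int \<Rightarrow> complex"
  assumes sum: "\<And>s t::real. ((\<lambda>(n, r). a (n, r) * e2pii (of_int n * of_real s) * e2pii (of_int r * of_real t)) has_sum 0) UNIV"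
  shows "a p0 = 0"
proof (rule ccontr)
  assume nz: "a p0 \<noteq> 0"
  obtain n0 r0 where p0: "p0 = (n0, r0)" by (cases p0)
  have "(a has_sum 0) UNIV" using sum[of 0 0] by (simp add: case_prod_unfold)
  hence "a summable_on UNIV" by (rule has_sum_imp_summable)
  hence abs: "(\<lambda>p. norm (a p)) summable_on UNIV"
    by (simp add: summable_on_iff_abs_summable_on_complex)
  have "norm (a p0) / 2 > 0" using nz by simp
  from tendstoD[OF infsum_tendsto[OF abs] this]
  obtain F0 where F0: "finite F0"
    "\<And>F'. finite F' \<Longrightarrow> F0 \<subseteq> F' \<Longrightarrow> dist (sum (\<lambda>p. norm (a p)) F') (infsum (\<lambda>p. norm (a p)) UNIV) < norm (a p0) / 2"
    unfolding eventually_finite_subsets_at_top by auto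
  define F where "F = insert p0 F0"
  have F: "finite F" "p0 \<in> F" using F0 by (auto simp: F_def)
  have Fsum: "infsum (\<lambda>p. norm (a p)) (UNIV - F) \<le> norm (a p0) / 2"
  proof -
    have "infsum (\<lambda>p. norm (a p)) (UNIV - F) = infsum (\<lambda>p. norm (a p)) UNIV - sum (\<lambda>p. norm (a p)) F"
      using F(1) abs by (subst infsum_Diff) auto
    also have "\<dots> \<le> norm (a p0) / 2"
    proof -
      have "F0 \<subseteq> F" by (auto simp: F_def)
      from F0(2)[OF F(1) this] show ?thesis unfolding dist_real_def by linarith
    qed
    finally show ?thesis .
  qed
  have "finite ((\<lambda>(n, r). \<bar>n - n0\<bar> + \<bar>r - r0\<bar>) ` F)" using F by auto
  then obtain K where K: "\<And>n r. (n, r) \<in> F \<Longrightarrow> \<bar>n - n0\<bar> + \<bar>r - r0\<bar> \<le> K"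
    using Max_ge by (metis (no_types, lifting) case_prod_conv imageI)
  \<comment> \<open>M exceeds the distance from \<open>p0\<close> to every point of F, so
    \<open>p0\<close> is the only index in F congruent to it modulo M.\<close>
  define M where "M = Suc (nat K)"
  have M: "M > 0" "int M > K" by (auto simp: M_def)
  define B where "B = {(n, r). int M dvd n - n0 \<and> int M dvd r - r0}"
  have BF: "B - {p0} \<subseteq> UNIV - F"
  proof -
    have "p = p0" if "p \<in> B" "p \<in> F" for p
    proof -
      obtain n r where p: "p = (n, r)" by (cases p)
      have "\<bar>n - n0\<bar> < int M" "\<bar>r - r0\<bar> < int M" using K[of n r] that(2) M by (auto simp: p)
      moreover have "int M dvd n - n0" "int M dvd r - r0" using that(1) by (auto simp: B_def p)
      moreover have "k = 0" if "\<bar>k\<bar> < int M" "int M dvd k" for k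
        using dvd_imp_le_int[of k "int M"] that by linarith
      ultimately have "n - n0 = 0" "r - r0 = 0" by blast+
      thus ?thesis by (simp add: p p0)
    qed
    thus ?thesis by auto
  qed
  let ?t = "\<lambda>x::nat. of_nat x / of_nat M :: complex"
  have "((\<lambda>p. \<Sum>(x, y)\<in>{..<M} \<times> {..<M}. (e2pii (- (of_int n0 * ?t x)) * e2pii (- (of_int r0 * ?t y))) *
           (a p * e2pii (of_int (fst p) * ?t x) * e2pii (of_int (snd p) * ?t y))) has_sum
         (\<Sum>(x, y)\<in>{..<M} \<times> {..<M}. (e2pii (- (of_int n0 * ?t x)) * e2pii (- (of_int r0 * ?t y))) * 0)) UNIV"
    unfolding case_prod_unfold
  proof (intro has_sum_sum has_sum_cmult_right)
    fix xy :: "nat \<times> nat"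
    show "((\<lambda>p. a p * e2pii (of_int (fst p) * ?t (fst xy)) * e2pii (of_int (snd p) * ?t (snd xy))) has_sum 0) UNIV"
      using sum[of "of_nat (fst xy) / of_nat M" "of_nat (snd xy) / of_nat M"] by (simp add: case_prod_unfold)
  qed
  also have "(\<lambda>p. \<Sum>(x, y)\<in>{..<M} \<times> {..<M}. (e2pii (- (of_int n0 * ?t x)) * e2pii (- (of_int r0 * ?t y))) *
           (a p * e2pii (of_int (fst p) * ?t x) * e2pii (of_int (snd p) * ?t y)))
        = (\<lambda>p. of_nat (M * M) * (if p \<in> B then a p else 0))"
  proof
    fix p :: "int \<times> int"
    have shift: "e2pii (- (of_int k0 * w)) * e2pii (of_int k * w) = e2pii (of_int (k - k0) * w)" for k k0 w
      by (simp add: e2pii_add [symmetric] algebra_simps)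
    have "(\<Sum>(x, y)\<in>{..<M} \<times> {..<M}. (e2pii (- (of_int n0 * ?t x)) * e2pii (- (of_int r0 * ?t y))) *
           (a p * e2pii (of_int (fst p) * ?t x) * e2pii (of_int (snd p) * ?t y)))
        = (\<Sum>(x, y)\<in>{..<M} \<times> {..<M}. a p * (e2pii (of_int (fst p - n0) * ?t x) * e2pii (of_int (snd p - r0) * ?t y)))"
      by (intro sum.cong refl) (simp only: shift [symmetric] case_prod_unfold mult_ac)
    also have "\<dots> = a p * ((\<Sum>x<M. e2pii (of_int (fst p - n0) * ?t x)) * (\<Sum>y<M. e2pii (of_int (snd p - r0) * ?t y)))"
      unfolding sum_product by (simp only: sum.cartesian_product sum_distrib_left case_prod_unfold)
    also have "\<dots> = of_nat (M * M) * (if p \<in> B then a p else 0)"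
      unfolding sum_roots_of_unity[OF M(1)] by (auto simp: B_def case_prod_unfold)
    finally show "(\<Sum>(x, y)\<in>{..<M} \<times> {..<M}. (e2pii (- (of_int n0 * ?t x)) * e2pii (- (of_int r0 * ?t y))) *
           (a p * e2pii (of_int (fst p) * ?t x) * e2pii (of_int (snd p) * ?t y))) = \<dots>" .
  qed
  finally have "((\<lambda>p. of_nat (M * M) * (if p \<in> B then a p else 0)) has_sum 0) UNIV" by simp
  have MM: "(of_nat (M * M) :: complex) \<noteq> 0" using M(1) by simp
  have "((\<lambda>p. inverse (of_nat (M * M)) * (of_nat (M * M) * (if p \<in> B then a p else 0))) has_sum inverse (of_nat (M * M)) * 0) UNIV"
    by (rule has_sum_cmult_right) fact
  hence "((\<lambda>p. if p \<in> B then a p else 0) has_sum 0) UNIV"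
    using M(1) by (simp only: mult.assoc [symmetric] left_inverse[OF MM] mult_1 mult_zero_right)
  hence B0: "(a has_sum 0) B"
    by (subst (asm) has_sum_cong_neutral[where T = B and g = a]) auto
  have "p0 \<in> B" by (simp add: B_def p0)
  \<comment> \<open>The remaining terms of the residue class sum to \<open>- a p0\<close>, yet they
    all lie outside F.\<close>
  hence "((\<lambda>p. a p) has_sum (0 - a p0)) (B - {p0})"
    using has_sum_Diff[OF B0, of "{p0}" "a p0"] by (simp add: has_sum_finite_iff)
  hence "infsum a (B - {p0}) = - a p0" by (simp add: infsumI)
  hence "norm (a p0) = norm (infsum a (B - {p0}))" by simp
  also have "\<dots> \<le> infsum (\<lambda>p. norm (a p)) (B - {p0})"
    by (rule norm_infsum_bound) (rule summable_on_subset_banach[OF abs], simp)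
  also have "\<dots> \<le> infsum (\<lambda>p. norm (a p)) (UNIV - F)"
    by (rule infsum_mono_neutral) (use BF in \<open>auto intro: summable_on_subset_banach[OF abs]\<close>)
  also have "\<dots> \<le> norm (a p0) / 2" by (rule Fsum)
  finally show False using nz by simp
qed

text \<open>Membership in \<open>jacobi_cusp\<close> yields the support condition for some
  expansion; uniqueness carries it over to the given one. For \<tau> = i + s and z = t with real s,
  t the difference is an absolutely convergent double Fourier series.\<close>

lemma fourier_expansion_unique:
  assumes "has_fourier_expansion g c" "has_fourier_expansion g c'"
  shows "c = c'"
proof (intro ext)
  fix n r
  define a where "a = (\<lambda>(n, r). (c n r - c' n r) * e2pii (of_int n * \<i>))"
  have "a (n, r) = 0"
  proof (rule double_series_coeff_eq_0)
    fix s t :: real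
    have 1: "((\<lambda>(n, r). c n r * e2pii (of_int n * (\<i> + of_real s)) * e2pii (of_int r * of_real t)) has_sum g (\<i> + of_real s) (of_real t)) UNIV"
      and 2: "((\<lambda>(n, r). c' n r * e2pii (of_int n * (\<i> + of_real s)) * e2pii (of_int r * of_real t)) has_sum g (\<i> + of_real s) (of_real t)) UNIV"
      using assms unfolding has_fourier_expansion_def by auto
    from 2 have "((\<lambda>p. - (\<lambda>(n, r). c' n r * e2pii (of_int n * (\<i> + of_real s)) * e2pii (of_int r * of_real t)) p)
        has_sum - g (\<i> + of_real s) (of_real t)) UNIV"
      by (subst has_sum_uminus) simp
    from has_sum_add[OF 1 this]
    show "((\<lambda>(n, r). a (n, r) * e2pii (of_int n * of_real s) * e2pii (of_int r * of_real t)) has_sum 0) UNIV"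
      by (simp add: a_def case_prod_unfold distrib_left e2pii_add algebra_simps)
  qed
  thus "c n r = c' n r" by (simp add: a_def)
qed

section \<open>The index\<close>

text \<open>
  The torsion points of order exactly r, as the reductions mod r of the bottom rows of matrices in
  the modular group.
\<close>

definition primvecs :: "nat \<Rightarrow> (int \<times> int) set" where
  "primvecs r = (\<lambda>(c, d). (c mod int r, d mod int r)) ` {(c, d). coprime c d}"

lemma primvecs_subset: "r > 0 \<Longrightarrow> primvecs r \<subseteq> {0..<int r} \<times> {0..<int r}"
  by (auto simp: primvecs_def)

lemma finite_primvecs: "r > 0 \<Longrightarrow> finite (primvecs r)"
  by (rule finite_subset[OF primvecs_subset]) auto

lemma card_primvecs_le:
  assumes "r > 0"
  shows "card (primvecs r) \<le> r\<^sup>2"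
proof -
  have "card (primvecs r) \<le> card ({0..<int r} \<times> {0..<int r})"
    by (rule card_mono[OF _ primvecs_subset]) (use assms in auto)
  thus ?thesis by (simp add: power2_eq_square)
qed

text \<open>After division by r^2 the claim is that r times the product is at least 1; it is even at
  least \<open>totient r\<close>, because 1 - 1/p \<le> 1 - 1/p^2.\<close>

lemma square_le_jordan_bound:
  assumes "r > 0"
  shows "(real r)\<^sup>2 \<le> real r ^ 3 * (\<Prod>p\<in>prime_factors r. 1 - 1 / (real p)\<^sup>2)"
proof -
  have p2: "real p \<ge> 2" if "p \<in> prime_factors r" for p
    using that prime_ge_2_nat[of p] by (auto simp: in_prime_factors_iff)
  have "1 \<le> real (totient r)" using assms by (simp add: Suc_le_eq)
  also have "\<dots> = real r * (\<Prod>p\<in>prime_factors r. 1 - 1 / real p)"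
    by (rule totient_formula2)
  also have "\<dots> \<le> real r * (\<Prod>p\<in>prime_factors r. 1 - 1 / (real p)\<^sup>2)"
  proof (intro mult_left_mono prod_mono conjI)
    fix p assume p: "p \<in> prime_factors r"
    show "0 \<le> 1 - 1 / real p" using p2[OF p] by simp
    show "1 - 1 / real p \<le> 1 - 1 / (real p)\<^sup>2"
      using p2[OF p] by (simp add: power2_eq_square field_simps)
  qed simp
  finally have "(real r)\<^sup>2 * 1 \<le> (real r)\<^sup>2 * (real r * (\<Prod>p\<in>prime_factors r. 1 - 1 / (real p)\<^sup>2))"
    by (rule mult_left_mono) simp
  thus ?thesis by (simp add: power2_eq_square power3_eq_cube mult_ac)
qed

definition mat2 :: "int \<Rightarrow> int \<Rightarrow> int \<Rightarrow> int \<Rightarrow> int ^ 2 ^ 2" where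
  "mat2 a b c d = vector [vector [a, b], vector [c, d]]"

lemma mat2_nth [simp]:
  "vec_nth (vec_nth (mat2 a b c d) 1) 1 = a" "vec_nth (vec_nth (mat2 a b c d) 1) 2 = b"
  "vec_nth (vec_nth (mat2 a b c d) 2) 1 = c" "vec_nth (vec_nth (mat2 a b c d) 2) 2 = d"
  by (simp_all add: mat2_def vector_2)

lemma mat2_eta: "A = mat2 (vec_nth (vec_nth A 1) 1) (vec_nth (vec_nth A 1) 2) (vec_nth (vec_nth A 2) 1) (vec_nth (vec_nth A 2) 2)"
  by (simp add: vec_eq_iff forall_2)

lemma mat2_mult: "mat2 a b c d ** mat2 a' b' c' d' = mat2 (a * a' + b * c') (a * b' + b * d') (c * a' + d * c') (c * b' + d * d')"
  by (simp add: vec_eq_iff forall_2 matrix_matrix_mult_def sum_2)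

lemma mat2_in_SL2Z [simp]: "mat2 a b c d \<in> carrier SL2Z \<longleftrightarrow> a * d - b * c = 1"
  by (simp add: SL2Z_def det_2)

lemma in_Gamma_rm:
  "mat2 a b c d \<in> Gamma_rm r m \<longleftrightarrow> a * d - b * c = 1 \<and>
     [a = 1] (mod int r) \<and> [d = 1] (mod int r) \<and> [c = 0] (mod int r) \<and> [c * m = 0] (mod (int r)\<^sup>2)"
  by (simp add: Gamma_rm_def)

definition bottom_row_mod :: "nat \<Rightarrow> int ^ 2 ^ 2 \<Rightarrow> int \<times> int" where
  "bottom_row_mod r A = (vec_nth (vec_nth A 2) 1 mod int r, vec_nth (vec_nth A 2) 2 mod int r)"

lemma r_coset_eq_image: "H #>\<^bsub>SL2Z\<^esub> A = (\<lambda>h. h ** A) ` H"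
  by (auto simp: r_coset_def SL2Z_def)

lemma bottom_row_mod_coset:
  assumes "B \<in> Gamma_rm r m #>\<^bsub>SL2Z\<^esub> A"
  shows "bottom_row_mod r B = bottom_row_mod r A"
proof -
  obtain h where h: "h \<in> Gamma_rm r m" "B = h ** A"
    using assms by (auto simp: r_coset_eq_image)
  obtain a b c d where hm: "h = mat2 a b c d" using mat2_eta by blast
  obtain a' b' c' d' where A: "A = mat2 a' b' c' d'" using mat2_eta by blast
  have c: "[c = 0] (mod int r)" "[d = 1] (mod int r)"
    using h(1) by (auto simp: hm in_Gamma_rm)
  have "[c * x + d * y = 0 * x + 1 * y] (mod int r)" for x y
    by (intro cong_add cong_mult c cong_refl)
  thus ?thesis by (simp add: h(2) hm A mat2_mult bottom_row_mod_def cong_def)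
qed

text \<open>Membership in \<open>Gamma_rm\<close> depends only on the determinant and on the entries
  modulo r^2, and h A B^(-1) is congruent to h if A and B are congruent. So a coset is determined by
  a representative modulo r^2.\<close>

lemma r_coset_mono_mod:
  assumes r: "r > 0" and A: "A \<in> carrier SL2Z" and B: "B \<in> carrier SL2Z"
    and eq: "\<And>i j. vec_nth (vec_nth A i) j mod (int r)\<^sup>2 = vec_nth (vec_nth B i) j mod (int r)\<^sup>2"
  shows "Gamma_rm r m #>\<^bsub>SL2Z\<^esub> A \<subseteq> Gamma_rm r m #>\<^bsub>SL2Z\<^esub> B"
proof
  fix C assume "C \<in> Gamma_rm r m #>\<^bsub>SL2Z\<^esub> A"
  then obtain h where h: "h \<in> Gamma_rm r m" "C = h ** A"
    by (auto simp: r_coset_eq_image)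
  obtain p q s t where hm: "h = mat2 p q s t" using mat2_eta by blast
  obtain a b c d where A': "A = mat2 a b c d" using mat2_eta by blast
  obtain a' b' c' d' where B': "B = mat2 a' b' c' d'" using mat2_eta by blast
  let ?N = "(int r)\<^sup>2"
  have e: "[a = a'] (mod ?N)" "[b = b'] (mod ?N)" "[c = c'] (mod ?N)" "[d = d'] (mod ?N)"
    using eq[of 1 1] eq[of 1 2] eq[of 2 1] eq[of 2 2] by (auto simp: A' B' cong_def)
  have dA: "a * d - b * c = 1" and dB: "a' * d' - b' * c' = 1"
    using A B by (auto simp: A' B')
  have dh: "p * t - q * s = 1" and ph: "[p = 1] (mod int r)" "[t = 1] (mod int r)" "[s = 0] (mod int r)" "[s * m = 0] (mod ?N)"
    using h(1) by (auto simp: hm in_Gamma_rm)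
  \<comment> \<open>This is h A B^(-1), the inverse being the adjugate.\<close>
  define h' where "h' = C ** mat2 d' (- b') (- c') a'"
  have h'_eq: "h' = mat2 ((p * a + q * c) * d' - (p * b + q * d) * c') ((p * b + q * d) * a' - (p * a + q * c) * b')
       ((s * a + t * c) * d' - (s * b + t * d) * c') ((s * b + t * d) * a' - (s * a + t * c) * b')"
    by (simp add: h'_def h(2) hm A' mat2_mult)
  have rN: "int r dvd ?N" by simp
  have 1: "[(p * a + q * c) * d' - (p * b + q * d) * c' = (p * a' + q * c') * d' - (p * b' + q * d') * c'] (mod ?N)"
    by (intro cong_diff cong_mult cong_add e cong_refl)
  have 2: "(p * a' + q * c') * d' - (p * b' + q * d') * c' = p * (a' * d' - b' * c')" by (simp add: algebra_simps)
  have 3: "[(s * a + t * c) * d' - (s * b + t * d) * c' = (s * a' + t * c') * d' - (s * b' + t * d') * c'] (mod ?N)"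
    by (intro cong_diff cong_mult cong_add e cong_refl)
  have 4: "(s * a' + t * c') * d' - (s * b' + t * d') * c' = s * (a' * d' - b' * c')" by (simp add: algebra_simps)
  have 5: "[(s * b + t * d) * a' - (s * a + t * c) * b' = (s * b' + t * d') * a' - (s * a' + t * c') * b'] (mod ?N)"
    by (intro cong_diff cong_mult cong_add e cong_refl)
  have 6: "(s * b' + t * d') * a' - (s * a' + t * c') * b' = t * (a' * d' - b' * c')" by (simp add: algebra_simps)
  have e1: "[vec_nth (vec_nth h' 1) 1 = p] (mod ?N)" using 1 by (simp add: h'_eq 2 dB)
  have e2: "[vec_nth (vec_nth h' 2) 1 = s] (mod ?N)" using 3 by (simp add: h'_eq 4 dB)
  have e3: "[vec_nth (vec_nth h' 2) 2 = t] (mod ?N)" using 5 by (simp add: h'_eq 6 dB)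
  have dh': "det h' = 1"
  proof -
    have "det h' = (p * t - q * s) * (a * d - b * c) * (a' * d' - b' * c')"
      by (simp add: h'_eq det_2 algebra_simps)
    thus ?thesis by (simp add: dA dB dh)
  qed
  have "h' \<in> Gamma_rm r m"
    unfolding Gamma_rm_def SL2Z_def
    using dh' cong_dvd_modulus[OF e1 rN] cong_dvd_modulus[OF e2 rN] cong_dvd_modulus[OF e3 rN]
      cong_mult[OF e2 cong_refl[of m]] ph
    by (auto intro: cong_trans)
  moreover have "h' ** B = C"
  proof -
    have "mat2 d' (- b') (- c') a' ** B = mat 1"
      using dB by (simp add: B' mat2_mult vec_eq_iff forall_2 mat_def algebra_simps)
    thus ?thesis by (simp add: h'_def matrix_mul_assoc [symmetric])
  qed
  ultimately show "C \<in> Gamma_rm r m #>\<^bsub>SL2Z\<^esub> B"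
    by (auto simp: r_coset_eq_image)
qed

text \<open>\<open>SL2Z_index\<close> is a cardinality, which would be 0 for an infinite set of
  cosets; the comparison with the index depends on finiteness.\<close>

lemma finite_rcosets_Gamma_rm:
  assumes r: "r > 0"
  shows "finite (rcosets\<^bsub>SL2Z\<^esub> Gamma_rm r m)"
proof -
  let ?red = "\<lambda>A::int ^ 2 ^ 2. (\<lambda>(i, j). vec_nth (vec_nth A i) j mod (int r)\<^sup>2)"
  let ?co = "\<lambda>A. Gamma_rm r m #>\<^bsub>SL2Z\<^esub> A"
  have "finite (?red ` carrier SL2Z)"
  proof (rule finite_subset)
    show "?red ` carrier SL2Z \<subseteq> Pi UNIV (\<lambda>_. {0..<(int r)\<^sup>2})" using r by auto
    show "finite (Pi UNIV (\<lambda>_::2 \<times> 2. {0..<(int r)\<^sup>2}))"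
      using finite_PiE[of "UNIV :: (2 \<times> 2) set" "\<lambda>_. {0..<(int r)\<^sup>2}"] by (simp add: PiE_UNIV_domain)
  qed
  moreover have "?co A = ?co (inv_into (carrier SL2Z) ?red (?red A))" if A: "A \<in> carrier SL2Z" for A
  proof -
    let ?B = "inv_into (carrier SL2Z) ?red (?red A)"
    have B: "?B \<in> carrier SL2Z" using A by (intro inv_into_into) auto
    have "?red ?B = ?red A" using A by (intro f_inv_into_f) auto
    hence "vec_nth (vec_nth ?B i) j mod (int r)\<^sup>2 = vec_nth (vec_nth A i) j mod (int r)\<^sup>2" for i j
      by (metis (no_types, lifting) case_prod_conv)
    thus ?thesis using r_coset_mono_mod[OF r A B] r_coset_mono_mod[OF r B A] by (metis subset_antisym)
  qed
  hence "rcosets\<^bsub>SL2Z\<^esub> Gamma_rm r m \<subseteq> (\<lambda>t. ?co (inv_into (carrier SL2Z) ?red t)) ` ?red ` carrier SL2Z"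
    unfolding RCOSETS_def by blast
  ultimately show ?thesis by (meson finite_imageI finite_subset)
qed

lemma card_primvecs_le_index:
  assumes r: "r > 0"
  shows "card (primvecs r) \<le> SL2Z_index (Gamma_rm r m)"
proof -
  let ?f = "\<lambda>C. the_elem (bottom_row_mod r ` C)"
  have "primvecs r \<subseteq> ?f ` (rcosets\<^bsub>SL2Z\<^esub> Gamma_rm r m)"
  proof
    fix v assume "v \<in> primvecs r"
    then obtain c d where v: "v = (c mod int r, d mod int r)" "coprime c d" by (auto simp: primvecs_def)
    \<comment> \<open>Bezout completes the primitive row (c, d) to a matrix of determinant
      1.\<close>
    obtain u w where uw: "u * c + w * d = 1" using v(2) bezout_int[of c d] by auto
    let ?A = "mat2 w (- u) c d" and ?C = "Gamma_rm r m #>\<^bsub>SL2Z\<^esub> mat2 w (- u) c d"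
    have A: "?A \<in> carrier SL2Z" using uw by (simp add: algebra_simps)
    have "mat2 1 0 0 1 \<in> Gamma_rm r m" by (simp add: in_Gamma_rm)
    hence "mat2 1 0 0 1 ** ?A \<in> ?C" by (auto simp: r_coset_eq_image)
    hence "?A \<in> ?C" by (simp add: mat2_mult)
    hence "bottom_row_mod r ` ?C = {bottom_row_mod r ?A}"
      using bottom_row_mod_coset by blast
    hence "v = ?f ?C" by (simp add: v(1) bottom_row_mod_def)
    moreover have "?C \<in> rcosets\<^bsub>SL2Z\<^esub> Gamma_rm r m"
      using A unfolding RCOSETS_def by blast
    ultimately show "v \<in> ?f ` (rcosets\<^bsub>SL2Z\<^esub> Gamma_rm r m)" by blast
  qed
  thus ?thesis
    unfolding SL2Z_index_def using finite_rcosets_Gamma_rm[OF r] by (meson surj_card_le)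
qed

section \<open>Orders of vanishing\<close>

text \<open>A bound on the unit disc instead of a condition on Taylor coefficients: it includes the
  zero function and passes at once to sums and multiples. For entire functions it amounts to
  divisibility by z^n.\<close>

definition order_ge :: "nat \<Rightarrow> (complex \<Rightarrow> complex) \<Rightarrow> bool" where
  "order_ge n h \<longleftrightarrow> (\<exists>C. \<forall>z. norm z \<le> 1 \<longrightarrow> norm (h z) \<le> C * norm z ^ n)"

text \<open>The n-th Taylor coefficient, for entire functions that satisfy
  \<open>order_ge n\<close>. As a limit it can be followed through the substitution z -> z /
  j.\<close>

definition lead :: "nat \<Rightarrow> (complex \<Rightarrow> complex) \<Rightarrow> complex" where
  "lead n h = Lim (at 0) (\<lambda>z. h z / z ^ n)"

lemma order_ge_cmult: "order_ge n h \<Longrightarrow> order_ge n (\<lambda>z. a * h z)"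
proof -
  assume "order_ge n h"
  then obtain C where C: "\<And>z. norm z \<le> 1 \<Longrightarrow> norm (h z) \<le> C * norm z ^ n"
    by (auto simp: order_ge_def)
  have "norm (a * h z) \<le> (norm a * C) * norm z ^ n" if "norm z \<le> 1" for z
    using mult_left_mono[OF C[OF that], of "norm a"] by (simp add: norm_mult mult_ac)
  thus ?thesis unfolding order_ge_def by blast
qed

lemma order_ge_add: "order_ge n h \<Longrightarrow> order_ge n k \<Longrightarrow> order_ge n (\<lambda>z. h z + k z)"
proof -
  assume "order_ge n h" "order_ge n k"
  then obtain C D where C: "\<And>z. norm z \<le> 1 \<Longrightarrow> norm (h z) \<le> C * norm z ^ n"
      "\<And>z. norm z \<le> 1 \<Longrightarrow> norm (k z) \<le> D * norm z ^ n"
    by (auto simp: order_ge_def)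
  have "norm (h z + k z) \<le> (C + D) * norm z ^ n" if "norm z \<le> 1" for z
    using norm_triangle_ineq[of "h z" "k z"] C(1)[OF that] C(2)[OF that]
    unfolding distrib_right by linarith
  thus ?thesis unfolding order_ge_def by blast
qed

lemma order_ge_diff: "order_ge n h \<Longrightarrow> order_ge n k \<Longrightarrow> order_ge n (\<lambda>z. h z - k z)"
  using order_ge_add[of n h "\<lambda>z. -1 * k z"] order_ge_cmult[of n k "-1"] by simp

lemma order_ge_sum: "(\<And>i. i \<in> A \<Longrightarrow> order_ge n (h i)) \<Longrightarrow> order_ge n (\<lambda>z. \<Sum>i\<in>A. h i z)"
proof (induction A rule: infinite_finite_induct)
  case (insert i A)
  thus ?case using order_ge_add[of n "h i" "\<lambda>z. \<Sum>i\<in>A. h i z"] by simp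
qed (auto simp: order_ge_def intro!: exI[of _ 0])

lemma order_ge_mono: "order_ge n h \<Longrightarrow> n' \<le> n \<Longrightarrow> order_ge n' h"
proof -
  assume "order_ge n h" and le: "n' \<le> n"
  then obtain C where C: "\<And>z. norm z \<le> 1 \<Longrightarrow> norm (h z) \<le> C * norm z ^ n"
    by (auto simp: order_ge_def)
  have "norm (h z) \<le> \<bar>C\<bar> * norm z ^ n'" if "norm z \<le> 1" for z
  proof -
    have "norm (h z) \<le> C * norm z ^ n" by (rule C[OF that])
    also have "\<dots> \<le> \<bar>C\<bar> * norm z ^ n" by (intro mult_right_mono) auto
    also have "\<dots> \<le> \<bar>C\<bar> * norm z ^ n'" by (intro mult_left_mono power_decreasing le that) auto
    finally show ?thesis .
  qed
  thus ?thesis unfolding order_ge_def by blast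
qed

lemma order_ge_0: "h holomorphic_on UNIV \<Longrightarrow> order_ge 0 h"
proof -
  assume "h holomorphic_on UNIV"
  hence "continuous_on (cball 0 1) h"
    using holomorphic_on_imp_continuous_on continuous_on_subset by blast
  hence "bounded (h ` cball 0 1)"
    by (intro compact_imp_bounded compact_continuous_image) auto
  then obtain B where "\<And>z. z \<in> cball 0 1 \<Longrightarrow> norm (h z) \<le> B"
    unfolding bounded_iff by blast
  thus ?thesis unfolding order_ge_def by (intro exI[of _ B]) auto
qed

lemma order_ge_factorI:
  assumes "k holomorphic_on UNIV" "\<And>z. h z = z ^ n * k z"
  shows "order_ge n h"
proof -
  obtain C where C: "\<And>z. norm z \<le> 1 \<Longrightarrow> norm (k z) \<le> C"
    using order_ge_0[OF assms(1)] by (auto simp: order_ge_def)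
  have "norm (h z) \<le> C * norm z ^ n" if "norm z \<le> 1" for z
    using mult_right_mono[OF C[OF that], of "norm z ^ n"] by (simp add: assms(2) norm_mult norm_power mult_ac)
  thus ?thesis unfolding order_ge_def by blast
qed

text \<open>One factor z at a time: after n factors the bound for \<open>Suc n\<close> forces the
  cofactor to vanish at 0.\<close>

lemma order_ge_factor:
  assumes "h holomorphic_on UNIV" "order_ge n h"
  shows "\<exists>k. k holomorphic_on UNIV \<and> (\<forall>z. h z = z ^ n * k z)"
  using assms(2)
proof (induction n)
  case 0
  thus ?case using assms(1) by (intro exI[of _ h]) auto
next
  case (Suc n)
  then obtain k where k: "k holomorphic_on UNIV" "\<And>z. h z = z ^ n * k z"
    using order_ge_mono[of "Suc n" h n] by auto
  obtain C where C: "\<And>z. norm z \<le> 1 \<Longrightarrow> norm (h z) \<le> C * norm z ^ Suc n"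
    using Suc.prems by (auto simp: order_ge_def)
  have "(k \<longlongrightarrow> k 0) (at 0)"
    using holomorphic_on_imp_continuous_on[OF k(1)] by (simp add: continuous_on_def)
  hence lim: "((\<lambda>z. norm (k z)) \<longlongrightarrow> norm (k 0)) (at 0)" by (rule tendsto_norm)
  have "((\<lambda>z::complex. C * norm z) \<longlongrightarrow> C * norm (0::complex)) (at 0)"
    by (intro tendsto_intros)
  hence lim0: "((\<lambda>z::complex. C * norm z) \<longlongrightarrow> 0) (at 0)" by simp
  have ev: "eventually (\<lambda>z. norm (k z) \<le> C * norm z) (at 0)"
    unfolding eventually_at
  proof (intro exI[of _ 1] conjI ballI impI)
    fix z :: complex assume z: "z \<noteq> 0 \<and> dist z 0 < 1"
    have "norm z ^ n * norm (k z) \<le> norm z ^ n * (C * norm z)"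
      using C[of z] z k(2)[of z] by (simp add: norm_mult norm_power mult_ac)
    thus "norm (k z) \<le> C * norm z" using z by simp
  qed simp
  have "norm (k 0) \<le> 0"
    by (rule tendsto_le[OF _ lim0 lim ev]) simp
  hence k0: "k 0 = 0" by simp
  define l where "l z = (if z = 0 then deriv k 0 else (k z - k 0) / (z - 0))" for z
  have "l holomorphic_on UNIV"
    unfolding l_def [abs_def] by (rule pole_lemma) (auto intro: k)
  moreover have "h z = z ^ Suc n * l z" for z
    by (simp add: l_def k0 k(2))
  ultimately show ?case by blast
qed

lemma lead_eqI: "((\<lambda>z. h z / z ^ n) \<longlongrightarrow> l) (at 0) \<Longrightarrow> lead n h = l"
  unfolding lead_def by (rule tendsto_Lim) simp_all

lemma lead_factor:
  assumes "h holomorphic_on UNIV" "order_ge n h"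
  obtains k where "k holomorphic_on UNIV" "\<And>z. h z = z ^ n * k z" "lead n h = k 0"
    "((\<lambda>z. h z / z ^ n) \<longlongrightarrow> k 0) (at 0)"
proof -
  obtain k where k: "k holomorphic_on UNIV" "\<And>z. h z = z ^ n * k z"
    using order_ge_factor[OF assms] by blast
  have "(k \<longlongrightarrow> k 0) (at 0)"
    using holomorphic_on_imp_continuous_on[OF k(1)] by (simp add: continuous_on_def)
  hence lim: "((\<lambda>z. h z / z ^ n) \<longlongrightarrow> k 0) (at 0)"
    by (rule Lim_transform_eventually) (auto simp: k(2) eventually_at_filter)
  show ?thesis using that[OF k lead_eqI[OF lim] lim] .
qed

lemma lead_tendsto:
  assumes "h holomorphic_on UNIV" "order_ge n h"
  shows "((\<lambda>z. h z / z ^ n) \<longlongrightarrow> lead n h) (at 0)"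
  using lead_factor[OF assms] by metis

lemma order_ge_Suc:
  assumes "h holomorphic_on UNIV" "order_ge n h" "lead n h = 0"
  shows "order_ge (Suc n) h"
proof -
  obtain k where k: "k holomorphic_on UNIV" "\<And>z. h z = z ^ n * k z" "lead n h = k 0"
    using lead_factor[OF assms(1,2)] by metis
  define l where "l z = (if z = 0 then deriv k 0 else (k z - k 0) / (z - 0))" for z
  have "l holomorphic_on UNIV"
    unfolding l_def [abs_def] by (rule pole_lemma) (auto intro: k)
  moreover have "h z = z ^ Suc n * l z" for z
    using k(3) assms(3) by (simp add: l_def k(2))
  ultimately show ?thesis by (rule order_ge_factorI)
qed

text \<open>On the unit circle the factor w^n has modulus 1; the maximum modulus principle carries
  the bound inside.\<close>

lemma factor_bound:
  assumes k: "k holomorphic_on UNIV" and B: "\<And>w. norm w = 1 \<Longrightarrow> norm (w ^ n * k w) \<le> B" and z: "norm z \<le> 1"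
  shows "norm (k z) \<le> B"
proof (rule maximum_modulus_frontier[of k "cball 0 1"])
  show "k holomorphic_on interior (cball 0 1)" using k by (rule holomorphic_on_subset) simp
  show "continuous_on (closure (cball 0 1)) k"
    using holomorphic_on_imp_continuous_on[OF k] continuous_on_subset by blast
  show "norm (k w) \<le> B" if "w \<in> frontier (cball 0 1)" for w
    using that B[of w] by (simp add: norm_mult norm_power)
qed (use z in auto)

text \<open>The Schwarz lemma of order n. The constant in \<open>order_ge\<close> may depend on the
  function in an uncontrolled way; here it is any bound on the unit circle, hence uniform in
  families.\<close>

lemma order_ge_Schwarz:
  assumes "h holomorphic_on UNIV" "order_ge n h" "\<And>w. norm w = 1 \<Longrightarrow> norm (h w) \<le> B" "norm z \<le> 1"
  shows "norm (h z) \<le> B * norm z ^ n"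
proof -
  obtain k where k: "k holomorphic_on UNIV" "\<And>z. h z = z ^ n * k z"
    using lead_factor[OF assms(1,2)] by metis
  have "norm (k z) \<le> B"
    using factor_bound[OF k(1) _ assms(4)] assms(3) k(2) by metis
  from mult_right_mono[OF this, of "norm z ^ n"] show ?thesis
    by (simp add: k(2) norm_mult norm_power mult_ac)
qed

lemma lead_bound:
  assumes "h holomorphic_on UNIV" "order_ge n h" "\<And>w. norm w = 1 \<Longrightarrow> norm (h w) \<le> B"
  shows "norm (lead n h) \<le> B"
proof -
  obtain k where k: "k holomorphic_on UNIV" "\<And>z. h z = z ^ n * k z" "lead n h = k 0"
    using lead_factor[OF assms(1,2)] by metis
  have "norm (k 0) \<le> B"
    using factor_bound[OF k(1), of n B 0] assms(3) k(2) by simp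
  thus ?thesis by (simp add: k(3))
qed

lemma lead_add_higher:
  assumes h: "h holomorphic_on UNIV" "order_ge n h" and l: "l holomorphic_on UNIV" "order_ge (Suc n) l"
  shows "lead n (\<lambda>z. h z + l z) = lead n h"
proof (rule lead_eqI)
  obtain k where k: "k holomorphic_on UNIV" "\<And>z. l z = z ^ Suc n * k z"
    using order_ge_factor[OF l] by blast
  have "(k \<longlongrightarrow> k 0) (at 0)"
    using holomorphic_on_imp_continuous_on[OF k(1)] by (simp add: continuous_on_def)
  hence "((\<lambda>z. h z / z ^ n + z * k z) \<longlongrightarrow> lead n h + 0 * k 0) (at 0)"
    by (intro tendsto_intros lead_tendsto h)
  hence "((\<lambda>z. h z / z ^ n + z * k z) \<longlongrightarrow> lead n h) (at 0)" by simp
  thus "((\<lambda>z. (h z + l z) / z ^ n) \<longlongrightarrow> lead n h) (at 0)"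
    by (rule Lim_transform_eventually) (auto simp: k(2) eventually_at_filter add_divide_distrib)
qed

section \<open>A Sturm bound for products\<close>

lemma Im_inversion: "Im \<tau> > 0 \<Longrightarrow> Im (- 1 / \<tau>) = Im \<tau> / (norm \<tau>)\<^sup>2"
  by (simp add: Im_divide cmod_power2)

text \<open>
  After a translation to \<open>|Re \<tau>| \<le> 1/2\<close>, a point with \<open>Im \<tau> < 1/2\<close> has \<open>|\<tau>|\<^sup>2 < 1/2\<close>, so that the
  inversion at least doubles the imaginary part.
\<close>

lemma fundamental_strip:
  fixes \<phi> :: "complex \<Rightarrow> real"
  assumes T: "\<And>\<tau>. Im \<tau> > 0 \<Longrightarrow> \<phi> (\<tau> + 1) = \<phi> \<tau>"
    and S: "\<And>\<tau>. Im \<tau> > 0 \<Longrightarrow> \<phi> (- 1 / \<tau>) = \<phi> \<tau>"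
    and \<tau>: "Im \<tau> > 0"
  obtains \<tau>' where "Im \<tau>' \<ge> 1 / 2" "\<bar>Re \<tau>'\<bar> \<le> 1 / 2" "\<phi> \<tau>' = \<phi> \<tau>"
proof -
  have T_int: "\<phi> (\<tau> + of_int n) = \<phi> \<tau>" if "Im \<tau> > 0" for \<tau> n
  proof (induction n rule: int_induct[where k = 0])
    case (step1 i) thus ?case using T[of "\<tau> + of_int i"] that by (simp add: add_ac)
  next
    case (step2 i) thus ?case using T[of "\<tau> + of_int (i - 1)"] that by (simp add: add_ac)
  qed simp
  \<comment> \<open>n bounds the number of inversions still needed.\<close>
  have "\<exists>\<tau>'. Im \<tau>' \<ge> 1 / 2 \<and> \<bar>Re \<tau>'\<bar> \<le> 1 / 2 \<and> \<phi> \<tau>' = \<phi> \<tau>"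
    if "Im \<tau> \<ge> (1 / 2) ^ Suc n" for n \<tau>
    using that
  proof (induction n arbitrary: \<tau>)
    case (0 \<tau>)
    define \<tau>' where "\<tau>' = \<tau> + of_int (- round (Re \<tau>))"
    have "\<bar>Re \<tau>'\<bar> \<le> 1 / 2" using of_int_round_abs_le[of "Re \<tau>"] by (simp add: \<tau>'_def abs_minus_commute)
    moreover have "\<phi> \<tau>' = \<phi> \<tau>" unfolding \<tau>'_def by (rule T_int) (use 0 in simp)
    ultimately show ?case using 0 by (intro exI[of _ \<tau>']) (simp add: \<tau>'_def)
  next
    case (Suc n \<tau>)
    have pos: "Im \<tau> > 0" by (rule less_le_trans[OF _ Suc.prems]) simp
    define \<tau>' where "\<tau>' = \<tau> + of_int (- round (Re \<tau>))"
    have re: "\<bar>Re \<tau>'\<bar> \<le> 1 / 2" using of_int_round_abs_le[of "Re \<tau>"] by (simp add: \<tau>'_def abs_minus_commute)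
    have \<phi>: "\<phi> \<tau>' = \<phi> \<tau>" unfolding \<tau>'_def by (rule T_int[OF pos])
    have im: "Im \<tau>' = Im \<tau>" by (simp add: \<tau>'_def)
    show ?case
    proof (cases "Im \<tau> \<ge> 1 / 2")
      case True
      thus ?thesis using re \<phi> im by (intro exI[of _ \<tau>']) auto
    next
      case False
      have "(Re \<tau>')\<^sup>2 \<le> (1 / 2)\<^sup>2" using re by (subst abs_le_square_iff [symmetric]) simp
      moreover have "(Im \<tau>')\<^sup>2 \<le> (1 / 2)\<^sup>2" using False pos im by (intro power_mono) auto
      moreover have "(1 / 2 :: real)\<^sup>2 = 1 / 4" by (simp add: power2_eq_square)
      ultimately have "(norm \<tau>')\<^sup>2 \<le> 1 / 2" unfolding cmod_power2 by linarith
      moreover have "(norm \<tau>')\<^sup>2 > 0" using pos im by auto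
      ultimately have "2 * Im \<tau>' \<le> Im \<tau>' / (norm \<tau>')\<^sup>2"
        using pos im by (simp add: field_simps)
      moreover have "(1 / 2) ^ Suc n \<le> 2 * Im \<tau>'"
        using Suc.prems im by simp
      moreover have "Im (- 1 / \<tau>') = Im \<tau>' / (norm \<tau>')\<^sup>2"
        using im pos by (intro Im_inversion) simp
      ultimately have "(1 / 2) ^ Suc n \<le> Im (- 1 / \<tau>')" by linarith
      then obtain \<tau>'' where "Im \<tau>'' \<ge> 1 / 2" "\<bar>Re \<tau>''\<bar> \<le> 1 / 2" "\<phi> \<tau>'' = \<phi> (- 1 / \<tau>')"
        using Suc.IH by blast
      thus ?thesis using S[of \<tau>'] \<phi> im pos by auto
    qed
  qed
  moreover obtain n where "(1 / 2) ^ n < Im \<tau>"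
    using real_arch_pow_inv[OF \<tau>, of "1 / 2"] by auto
  hence "Im \<tau> \<ge> (1 / 2) ^ Suc n"
    using \<tau> by simp
  ultimately show ?thesis using that by blast
qed

text \<open>If \<Psi> did not vanish at \<tau>, values of modulus at least |\<Psi>(\<tau>)| would
  occur only below some height, and by invariance all of these moduli in a compact box. So |\<Psi>|
  would have a maximum, \<Psi> would be constant, and the decay at the cusp would be
  violated.\<close>

lemma invariant_eq_0_if_vanishes_at_cusp:
  fixes \<Psi> :: "complex \<Rightarrow> complex"
  assumes hol: "\<Psi> holomorphic_on {\<tau>. Im \<tau> > 0}"
    and T: "\<And>\<tau>. Im \<tau> > 0 \<Longrightarrow> norm (\<Psi> (\<tau> + 1)) = norm (\<Psi> \<tau>)"
    and S: "\<And>\<tau>. Im \<tau> > 0 \<Longrightarrow> norm (\<Psi> (- 1 / \<tau>)) = norm (\<Psi> \<tau>)"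
    and cusp: "\<And>\<tau>. Im \<tau> \<ge> 1 \<Longrightarrow> norm (\<Psi> \<tau>) \<le> C * exp (- \<delta> * Im \<tau>)" and \<delta>: "\<delta> > 0"
    and \<tau>: "Im \<tau> > 0"
  shows "\<Psi> \<tau> = 0"
proof (rule ccontr)
  assume nz: "\<Psi> \<tau> \<noteq> 0"
  define a where "a = norm (\<Psi> \<tau>)"
  have a: "a > 0" using nz by (simp add: a_def)
  have "((\<lambda>y. C * exp (- \<delta> * y)) \<longlongrightarrow> C * 0) at_top"
    using \<delta> by (intro tendsto_intros filterlim_compose[OF exp_at_bot] filterlim_tendsto_neg_mult_at_bot[OF tendsto_const] filterlim_ident) auto
  hence "eventually (\<lambda>y. C * exp (- \<delta> * y) < a) at_top"
    using a by (intro order_tendstoD(2)[where y = 0]) auto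
  then obtain Y0 where Y0: "\<And>y. y \<ge> Y0 \<Longrightarrow> C * exp (- \<delta> * y) < a"
    by (auto simp: eventually_at_top_linorder)
  define Y where "Y = max 1 Y0"
  have Y: "norm (\<Psi> w) < a" if "Im w \<ge> Y" for w
    using cusp[of w] Y0[of "Im w"] that by (auto simp: Y_def)
  define K where "K = cbox (Complex (- 1 / 2) (1 / 2)) (Complex (1 / 2) Y)"
  have reduce: "\<exists>w'\<in>K. norm (\<Psi> w') = norm (\<Psi> w)" if w: "Im w > 0" "norm (\<Psi> w) \<ge> a" for w
  proof -
    obtain w' where w': "Im w' \<ge> 1 / 2" "\<bar>Re w'\<bar> \<le> 1 / 2" "norm (\<Psi> w') = norm (\<Psi> w)"
      by (rule fundamental_strip[of "\<lambda>w. norm (\<Psi> w)" w, OF T S w(1)])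
    have "Im w' \<le> Y" using Y[of w'] w'(3) w(2) by force
    thus ?thesis using w' by (intro bexI[of _ w']) (auto simp: K_def in_cbox_complex_iff)
  qed
  obtain w0 where "w0 \<in> K" "norm (\<Psi> w0) = a"
    using reduce[OF \<tau>] by (auto simp: a_def)
  have KH: "K \<subseteq> {\<tau>. Im \<tau> > 0}" by (auto simp: K_def in_cbox_complex_iff)
  have "compact K" by (simp add: K_def)
  moreover have "continuous_on K (\<lambda>w. norm (\<Psi> w))"
    using holomorphic_on_imp_continuous_on[OF hol] KH continuous_on_subset by (intro continuous_intros) blast
  ultimately obtain \<xi> where \<xi>: "\<xi> \<in> K" "\<And>w. w \<in> K \<Longrightarrow> norm (\<Psi> w) \<le> norm (\<Psi> \<xi>)"
    using continuous_attains_sup[of K "\<lambda>w. norm (\<Psi> w)"] \<open>w0 \<in> K\<close> by auto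
  have \<xi>a: "norm (\<Psi> \<xi>) \<ge> a" using \<xi>(2)[OF \<open>w0 \<in> K\<close>] \<open>norm (\<Psi> w0) = a\<close> by simp
  have "\<Psi> constant_on {\<tau>. Im \<tau> > 0}"
  proof (rule maximum_modulus_principle[OF hol])
    show "open {\<tau>. Im \<tau> > 0}" "open {\<tau>. Im \<tau> > 0}" by (auto simp: open_halfspace_Im_gt)
    show "connected {\<tau>. Im \<tau> > 0}" by (intro convex_connected convex_halfspace_Im_gt)
    show "\<xi> \<in> {\<tau>. Im \<tau> > 0}" using \<xi>(1) KH by blast
    fix w assume w: "w \<in> {\<tau>. Im \<tau> > 0}"
    show "norm (\<Psi> w) \<le> norm (\<Psi> \<xi>)"
    proof (cases "norm (\<Psi> w) \<ge> a")
      case True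
      thus ?thesis using reduce[of w] w \<xi>(2) by fastforce
    qed (use \<xi>a in simp)
  qed simp
  then obtain x where x: "\<And>w. Im w > 0 \<Longrightarrow> \<Psi> w = x" unfolding constant_on_def by auto
  have "Im (Complex 0 Y) \<ge> Y" "Y > 0" by (auto simp: Y_def)
  thus False using Y[of "Complex 0 Y"] x[of "Complex 0 Y"] x[of \<tau>] \<tau> by (simp add: a_def)
qed

text \<open>Holomorphic functions on a connected open set form an integral domain, by the identity
  theorem.\<close>

lemma product_eq_0_imp_factor_eq_0:
  assumes "finite P" "\<And>p. p \<in> P \<Longrightarrow> f p holomorphic_on S" "open S" "connected S" "S \<noteq> {}"
    and "\<And>z. z \<in> S \<Longrightarrow> (\<Prod>p\<in>P. f p z) = (0::complex)"
  shows "\<exists>p\<in>P. \<forall>z\<in>S. f p z = 0"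
  using assms(1,2,6)
proof (induction P rule: finite_induct)
  case empty
  thus ?case using assms(5) by auto
next
  case (insert p P)
  show ?case
  proof (cases "\<forall>z\<in>S. f p z = 0")
    case False
    then obtain z0 where z0: "z0 \<in> S" "f p z0 \<noteq> 0" by blast
    let ?U = "{z \<in> S. f p z \<noteq> 0}"
    have "open ?U"
      using continuous_open_preimage[OF holomorphic_on_imp_continuous_on assms(3) open_Compl[of "{0}"], of "f p"] insert.prems
      by (auto simp: Int_def vimage_def)
    have "(\<Prod>p\<in>P. f p z) = 0" if "z \<in> S" for z
    proof (rule analytic_continuation_open[of ?U S "\<lambda>z. \<Prod>p\<in>P. f p z" "\<lambda>_. 0"])
      show "(\<lambda>z. \<Prod>p\<in>P. f p z) holomorphic_on S" using insert.prems by (intro holomorphic_intros) auto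
      show "(\<Prod>p\<in>P. f p z) = 0" if "z \<in> ?U" for z
        using insert.prems(2)[of z] insert.hyps that by auto
    qed (use \<open>open ?U\<close> assms z0 that in auto)
    thus ?thesis using insert by blast
  qed auto
qed

text \<open>
  The product of the functions has weight \<open>K * card P\<close>; dividing it by the corresponding power of
  eta gives an invariant function that tends to 0 at the cusp.
\<close>

lemma sturm_product:
  fixes f :: "'i \<Rightarrow> complex \<Rightarrow> complex" and K :: int
  assumes fin: "finite P" and hol: "\<And>p. p \<in> P \<Longrightarrow> f p holomorphic_on {\<tau>. Im \<tau> > 0}"
    and \<sigma>: "bij_betw \<sigma> P P" and T: "\<And>p \<tau>. p \<in> P \<Longrightarrow> Im \<tau> > 0 \<Longrightarrow> norm (f p (\<tau> + 1)) = norm (f (\<sigma> p) \<tau>)"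
    and \<rho>: "bij_betw \<rho> P P"
    and S: "\<And>p \<tau>. p \<in> P \<Longrightarrow> Im \<tau> > 0 \<Longrightarrow> norm (f p (- 1 / \<tau>)) = norm \<tau> powi K * norm (f (\<rho> p) \<tau>)"
    and bounded: "\<And>p. p \<in> P \<Longrightarrow> \<exists>B. \<forall>\<tau>. Im \<tau> \<ge> 1 \<longrightarrow> norm (f p \<tau>) \<le> B"
    and p0: "p0 \<in> P" and decay: "\<And>\<tau>. Im \<tau> \<ge> 1 \<Longrightarrow> norm (f p0 \<tau>) \<le> B0 * exp (- 2 * pi * N * Im \<tau>)"
    and N: "N > real_of_int K * real (card P) / 12"
  shows "\<exists>p\<in>P. \<forall>\<tau>. Im \<tau> > 0 \<longrightarrow> f p \<tau> = 0"
proof -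
  let ?H = "{\<tau>. Im \<tau> > 0}" and ?J = "int (card P)"
  define \<Psi> where "\<Psi> \<tau> = (\<Prod>p\<in>P. f p \<tau>) * eta \<tau> powi (- 2 * K * ?J)" for \<tau>
  obtain l u where lu: "0 < l"
    "\<And>\<tau>. Im \<tau> \<ge> 1 \<Longrightarrow> l \<le> norm (qpoch (e2pii \<tau>) (e2pii \<tau>)) \<and> norm (qpoch (e2pii \<tau>) (e2pii \<tau>)) \<le> u"
    using norm_qpoch_bounds by metis
  obtain B where B: "\<And>p \<tau>. p \<in> P \<Longrightarrow> Im \<tau> \<ge> 1 \<Longrightarrow> norm (f p \<tau>) \<le> B p"
    using bounded by metis
  define A where "A = B0 * (\<Prod>p\<in>P - {p0}. B p)"
  \<comment> \<open>K may have either sign, so the power of (q; q) is controlled by the lower or by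
    the upper bound; the sum covers both.\<close>
  define D where "D = l powi (- 2 * K * ?J) + u powi (- 2 * K * ?J)"
  have "\<Psi> \<tau> = 0" if "Im \<tau> > 0" for \<tau>
  proof (rule invariant_eq_0_if_vanishes_at_cusp[OF _ _ _ _ _ that])
    show "\<Psi> holomorphic_on ?H"
      unfolding \<Psi>_def [abs_def] by (intro holomorphic_intros hol eta_holomorphic) (auto simp: eta_nonzero)
    show "norm (\<Psi> (\<tau> + 1)) = norm (\<Psi> \<tau>)" if "Im \<tau> > 0" for \<tau>
    proof -
      have "(\<Prod>p\<in>P. norm (f p (\<tau> + 1))) = (\<Prod>p\<in>P. norm (f (\<sigma> p) \<tau>))"
        by (intro prod.cong refl T that)
      also have "\<dots> = (\<Prod>p\<in>P. norm (f p \<tau>))"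
        by (rule prod.reindex_bij_betw[OF \<sigma>])
      finally show ?thesis
        by (simp add: \<Psi>_def norm_mult norm_power_int norm_eta_add_1 prod_norm [symmetric])
    qed
    show "norm (\<Psi> (- 1 / \<tau>)) = norm (\<Psi> \<tau>)" if \<tau>: "Im \<tau> > 0" for \<tau>
    proof -
      have \<tau>0: "norm \<tau> \<noteq> 0" using \<tau> by auto
      have "(\<Prod>p\<in>P. norm (f p (- 1 / \<tau>))) = (\<Prod>p\<in>P. norm \<tau> powi K * norm (f (\<rho> p) \<tau>))"
        by (intro prod.cong refl S \<tau>)
      also have "\<dots> = norm \<tau> powi (K * ?J) * (\<Prod>p\<in>P. norm (f p \<tau>))"
        by (simp add: prod.distrib prod.reindex_bij_betw[OF \<rho>, of "\<lambda>p. norm (f p \<tau>)"] power_int_mult)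
      also have "norm (eta (- 1 / \<tau>)) powi (- 2 * K * ?J) = norm \<tau> powi (- (K * ?J)) * norm (eta \<tau>) powi (- 2 * K * ?J)"
      proof -
        have *: "x powi (- 2 * K * ?J) = (x ^ 2) powi (- (K * ?J))" for x :: real
          using power_int_mult[of x 2 "- (K * ?J)"] by (simp add: mult_ac)
        show ?thesis unfolding * norm_eta_inversion[OF \<tau>] by (simp add: power_int_mult_distrib)
      qed
      moreover have "norm \<tau> powi (K * ?J) * norm \<tau> powi (- (K * ?J)) = 1"
        using \<tau>0 by (simp add: power_int_add [symmetric])
      ultimately show ?thesis
        by (simp add: \<Psi>_def norm_mult norm_power_int prod_norm [symmetric] mult_ac)
    qed
    show "2 * pi * (N - real_of_int K * real (card P) / 12) > 0" using N by simp
    show "norm (\<Psi> \<tau>) \<le> (A * D) * exp (- (2 * pi * (N - real_of_int K * real (card P) / 12)) * Im \<tau>)"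
      if y: "Im \<tau> \<ge> 1" for \<tau>
    proof -
      let ?Q = "norm (qpoch (e2pii \<tau>) (e2pii \<tau>))"
      have Q: "0 < l" "l \<le> ?Q" "?Q \<le> u" "0 < ?Q" "0 < u" using lu(1) lu(2)[OF y] by linarith+
      have 1: "norm (\<Prod>p\<in>P. f p \<tau>) \<le> A * exp (- 2 * pi * N * Im \<tau>)"
      proof -
        have "norm (\<Prod>p\<in>P. f p \<tau>) = norm (f p0 \<tau>) * (\<Prod>p\<in>P - {p0}. norm (f p \<tau>))"
          using fin p0 by (simp add: prod.remove norm_mult prod_norm)
        also have "\<dots> \<le> (B0 * exp (- 2 * pi * N * Im \<tau>)) * (\<Prod>p\<in>P - {p0}. B p)"
        proof (rule mult_mono)
          show "(\<Prod>p\<in>P - {p0}. norm (f p \<tau>)) \<le> (\<Prod>p\<in>P - {p0}. B p)"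
            by (intro prod_mono) (use B y in auto)
          show "0 \<le> B0 * exp (- 2 * pi * N * Im \<tau>)" using decay[OF y] norm_ge_zero order_trans by blast
        qed (use decay[OF y] in \<open>auto intro!: prod_nonneg\<close>)
        finally show ?thesis by (simp add: A_def mult_ac)
      qed
      have A0: "0 \<le> A * exp (- 2 * pi * N * Im \<tau>)" using 1 norm_ge_zero order_trans by blast
      have 2: "?Q powi (- 2 * K * ?J) \<le> D"
      proof (cases "- 2 * K * ?J \<ge> 0")
        case True
        hence "?Q powi (- 2 * K * ?J) \<le> u powi (- 2 * K * ?J)"
          using Q by (intro power_int_mono) auto
        moreover have "l powi (- 2 * K * ?J) \<ge> 0" using Q by simp
        ultimately show ?thesis unfolding D_def by linarith
      next
        case False
        hence "?Q powi (- 2 * K * ?J) \<le> l powi (- 2 * K * ?J)"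
          using Q by (intro power_int_antimono) auto
        moreover have "u powi (- 2 * K * ?J) \<ge> 0" using Q by simp
        ultimately show ?thesis unfolding D_def by linarith
      qed
      have 3: "norm (eta \<tau> powi (- 2 * K * ?J)) = exp (2 * pi * (real_of_int K * real (card P) / 12) * Im \<tau>) * ?Q powi (- 2 * K * ?J)"
      proof -
        have "eta \<tau> powi (- 2 * K * ?J) = e2pii (of_int (- 2 * K * ?J) * (\<tau> / 24)) * qpoch (e2pii \<tau>) (e2pii \<tau>) powi (- 2 * K * ?J)"
          unfolding eta_eq_qpoch power_int_mult_distrib e2pii_powi ..
        moreover have "of_int (- 2 * K * ?J) * (\<tau> / 24) = of_real (- real_of_int K * real (card P) / 12) * \<tau>"
          by simp
        ultimately show ?thesis by (simp only: norm_mult norm_power_int norm_e2pii) simp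
      qed
      have "norm (\<Psi> \<tau>) = norm (\<Prod>p\<in>P. f p \<tau>) * (exp (2 * pi * (real_of_int K * real (card P) / 12) * Im \<tau>) * ?Q powi (- 2 * K * ?J))"
        unfolding \<Psi>_def norm_mult 3 ..
      also have "\<dots> \<le> (A * exp (- 2 * pi * N * Im \<tau>)) * (exp (2 * pi * (real_of_int K * real (card P) / 12) * Im \<tau>) * D)"
        by (intro mult_mono 1 2 A0) (use Q in auto)
      also have "\<dots> = (A * D) * exp (- (2 * pi * (N - real_of_int K * real (card P) / 12)) * Im \<tau>)"
        by (simp add: exp_add [symmetric] algebra_simps)
      finally show ?thesis .
    qed
  qed
  hence "(\<Prod>p\<in>P. f p \<tau>) = 0" if "Im \<tau> > 0" for \<tau>
    using that eta_nonzero[OF that] by (auto simp: \<Psi>_def power_int_eq_0_iff)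
  moreover have "\<i> \<in> ?H" by simp
  hence "?H \<noteq> {}" by blast
  ultimately show ?thesis
    using product_eq_0_imp_factor_eq_0[of P f ?H] fin hol
    by (auto simp: open_halfspace_Im_gt intro: convex_connected convex_halfspace_Im_gt)
qed

section \<open>Jacobi cusp forms at torsion points\<close>

locale jacobi_cusp_form =
  fixes k m :: int and g :: "complex \<Rightarrow> complex \<Rightarrow> complex" and c :: "int \<Rightarrow> int \<Rightarrow> complex"
  assumes m_pos: "m > 0" and hol: "holomorphic_HC g" and trans: "jacobi_transforms k m g"
    and fourier: "has_fourier_expansion g c"
    and support: "\<And>n r. c n r \<noteq> 0 \<Longrightarrow> 4 * n * m - r\<^sup>2 > 0"
begin

lemma c_nonpos: "n \<le> 0 \<Longrightarrow> c n r = 0"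
proof (rule ccontr)
  assume "n \<le> 0" "c n r \<noteq> 0"
  hence "4 * n * m - r\<^sup>2 > 0" by (intro support)
  moreover have "n * m \<le> 0" using \<open>n \<le> 0\<close> m_pos by (simp add: mult_nonpos_nonneg)
  moreover have "r\<^sup>2 \<ge> 0" by simp
  ultimately show False by linarith
qed

lemma finite_c: "finite {r. c n r \<noteq> 0}"
proof (rule finite_subset)
  show "{r. c n r \<noteq> 0} \<subseteq> {- (4 * n * m)..4 * n * m}"
  proof
    fix r assume "r \<in> {r. c n r \<noteq> 0}"
    hence "r\<^sup>2 < 4 * n * m" using support[of n r] by simp
    moreover have "\<bar>r\<bar> \<le> r\<^sup>2" using self_le_power[of "\<bar>r\<bar>" 2] by (cases "r = 0") auto
    ultimately show "r \<in> {- (4 * n * m)..4 * n * m}" by auto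
  qed
qed simp

lemma lookup_q_coeff: "Poly_Mapping.lookup (q_coeff c n) = c n"
  unfolding q_coeff_def using finite_c by simp

lemma keys_q_coeff: "Poly_Mapping.keys (q_coeff c n) = {r. c n r \<noteq> 0}"
  by (auto simp: in_keys_iff lookup_q_coeff)

lemma q_coeff_nonpos: "n \<le> 0 \<Longrightarrow> q_coeff c n = 0"
  by (rule poly_mapping_eqI) (simp add: lookup_q_coeff c_nonpos)

text \<open>Along a holomorphic curve the chain rule and the complex linearity of the derivative
  reduce two variables to one.\<close>

lemma g_compose_holomorphic:
  assumes p: "p holomorphic_on S" and q: "q holomorphic_on S" and S: "open S"
    and H: "\<And>z. z \<in> S \<Longrightarrow> Im (p z) > 0"
  shows "(\<lambda>z. g (p z) (q z)) holomorphic_on S"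
proof (rule holomorphic_onI)
  fix z assume z: "z \<in> S"
  obtain \<alpha> \<beta> where d: "((\<lambda>(t, w). g t w) has_derivative (\<lambda>(h, h'). \<alpha> * h + \<beta> * h')) (at (p z, q z))"
    using hol H[OF z] unfolding holomorphic_HC_def by blast
  obtain p' q' where p': "(p has_field_derivative p') (at z)" and q': "(q has_field_derivative q') (at z)"
    using p q z S by (metis holomorphic_on_open)
  have "((\<lambda>z. (p z, q z)) has_derivative (\<lambda>h. (p' * h, q' * h))) (at z)"
    using p' q' by (intro has_derivative_Pair) (simp_all add: has_field_derivative_def)
  from has_derivative_compose[OF this d]
  have "((\<lambda>z. g (p z) (q z)) has_derivative (\<lambda>h. \<alpha> * (p' * h) + \<beta> * (q' * h))) (at z)"
    by simp
  also have "(\<lambda>h. \<alpha> * (p' * h) + \<beta> * (q' * h)) = (*) (\<alpha> * p' + \<beta> * q')"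
    by (simp add: fun_eq_iff algebra_simps)
  finally have "((\<lambda>z. g (p z) (q z)) has_field_derivative \<alpha> * p' + \<beta> * q') (at z)"
    by (simp add: has_field_derivative_def)
  thus "(\<lambda>z. g (p z) (q z)) field_differentiable at z within S"
    using field_differentiable_at_within field_differentiable_def by blast
qed

lemma g_compose_continuous:
  assumes p: "continuous_on S p" and q: "continuous_on S q" and H: "\<And>z. z \<in> S \<Longrightarrow> Im (p z) > 0"
  shows "continuous_on S (\<lambda>z. g (p z) (q z))"
proof -
  have "continuous_on {x. Im (fst x) > 0} (\<lambda>(t, w). g t w)"
    unfolding continuous_on_eq_continuous_within
  proof
    fix x :: "complex \<times> complex" assume "x \<in> {x. Im (fst x) > 0}"
    then obtain a b where x: "x = (a, b)" "Im a > 0" by (cases x) auto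
    obtain \<alpha> \<beta> where "((\<lambda>(t, w). g t w) has_derivative (\<lambda>(h, h'). \<alpha> * h + \<beta> * h')) (at x)"
      using hol x unfolding holomorphic_HC_def by blast
    thus "continuous (at x within {x. Im (fst x) > 0}) (\<lambda>(t, w). g t w)"
      using has_derivative_continuous continuous_at_imp_continuous_at_within by blast
  qed
  hence "continuous_on S ((\<lambda>(t, w). g t w) \<circ> (\<lambda>z. (p z, q z)))"
    by (intro continuous_on_compose continuous_intros p q) (rule continuous_on_subset, assumption, use H in auto)
  thus ?thesis by (simp add: o_def)
qed

text \<open>
  The translate of g by the point \<open>\<lambda>\<tau> + \<mu>\<close>, with the factor that makes the modular group act on
  these functions through the row vectors \<open>(\<lambda>, \<mu>)\<close>.
\<close>

definition G :: "real \<Rightarrow> real \<Rightarrow> complex \<Rightarrow> complex \<Rightarrow> complex" where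
  "G l u \<tau> z = e2pii (of_int m * (of_real l ^ 2 * \<tau> + of_real l * of_real u + 2 * of_real l * z)) *
     g \<tau> (z + of_real l * \<tau> + of_real u)"

lemma G_holomorphic: "Im \<tau> > 0 \<Longrightarrow> G l u \<tau> holomorphic_on UNIV"
  unfolding G_def [abs_def] by (intro holomorphic_intros g_compose_holomorphic) auto

lemma G_holomorphic': "(\<lambda>\<tau>. G l u \<tau> z) holomorphic_on {\<tau>. Im \<tau> > 0}"
  unfolding G_def by (intro holomorphic_intros g_compose_holomorphic open_halfspace_Im_gt) auto

lemma G_continuous: "continuous_on ({\<tau>. Im \<tau> > 0} \<times> UNIV) (\<lambda>x. G l u (fst x) (snd x))"
  unfolding G_def by (intro continuous_intros g_compose_continuous) auto

text \<open>The row (l, u) moves to (l', u'), its product with the matrix, since l \<gamma> + u =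
  (l' \<tau> + u') / j for the image \<gamma> of \<tau>. The quadratic exponential in
  \<open>G\<close> absorbs the rest, so that neither l nor u survives in the automorphy
  factor.\<close>

lemma G_modular:
  fixes a b e d :: int
  assumes det: "a * d - b * e = 1" and \<tau>: "Im \<tau> > 0"
  defines "j \<equiv> of_int e * \<tau> + of_int d"
  assumes j0: "j \<noteq> 0"
  shows "G l u ((of_int a * \<tau> + of_int b) / j) (z / j) =
     j powi k * e2pii (of_int m * of_int e * z\<^sup>2 / j) * G (l * of_int a + u * of_int e) (l * of_int b + u * of_int d) \<tau> z"
proof -
  define l' u' where "l' = (of_real (l * of_int a + u * of_int e) :: complex)"
    and "u' = (of_real (l * of_int b + u * of_int d) :: complex)"
  define Z where "Z = z + l' * \<tau> + u'"
  define \<gamma> where "\<gamma> = (of_int a * \<tau> + of_int b) / j"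
  let ?L = "of_real l :: complex" and ?U = "of_real u :: complex"
  let ?a = "of_int a :: complex" and ?b = "of_int b :: complex" and ?e = "of_int e :: complex" and ?d = "of_int d :: complex"
  have det': "?a * ?d - ?b * ?e = 1" by (metis det of_int_1 of_int_diff of_int_mult)
  have l': "l' = ?L * ?a + ?U * ?e" and u': "u' = ?L * ?b + ?U * ?d" by (simp_all add: l'_def u'_def)
  have key: "?L = l' * ?d - ?e * u'"
  proof -
    have "l' * ?d - ?e * u' = ?L * (?a * ?d - ?b * ?e)" by (simp add: l' u' algebra_simps)
    thus ?thesis by (simp add: det')
  qed
  have LU: "?L * (?a * \<tau> + ?b) + ?U * j = l' * \<tau> + u'" by (simp add: l' u' j_def algebra_simps)
  have arg: "z / j + ?L * \<gamma> + ?U = Z / j"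
  proof -
    have "z / j + ?L * \<gamma> + ?U = (z + (?L * (?a * \<tau> + ?b) + ?U * j)) / j"
      using j0 by (simp add: \<gamma>_def field_simps)
    thus ?thesis unfolding LU Z_def by (simp add: add_ac)
  qed
  \<comment> \<open>The comparison of exponents, cleared of the denominator j. The determinant
    enters this identity only through \<open>key\<close>.\<close>
  have num: "?L * (l' * \<tau> + u') + 2 * ?L * z + ?e * Z\<^sup>2 = ?e * z\<^sup>2 + j * (l'\<^sup>2 * \<tau> + l' * u' + 2 * l' * z)"
    unfolding Z_def j_def key by (simp add: algebra_simps power2_eq_square)
  have "(?L\<^sup>2 * \<gamma> + ?L * ?U + 2 * ?L * (z / j)) + ?e * Z\<^sup>2 / j
      = (?L * (?L * (?a * \<tau> + ?b) + ?U * j) + 2 * ?L * z + ?e * Z\<^sup>2) / j"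
    using j0 by (simp add: \<gamma>_def add_divide_distrib power2_eq_square algebra_simps)
  also have "\<dots> = (?e * z\<^sup>2 + j * (l'\<^sup>2 * \<tau> + l' * u' + 2 * l' * z)) / j"
    unfolding LU num ..
  also have "\<dots> = ?e * z\<^sup>2 / j + (l'\<^sup>2 * \<tau> + l' * u' + 2 * l' * z)"
    using j0 by (simp add: add_divide_distrib)
  finally have "of_int m * ((?L\<^sup>2 * \<gamma> + ?L * ?U + 2 * ?L * (z / j)) + ?e * Z\<^sup>2 / j)
      = of_int m * (?e * z\<^sup>2 / j + (l'\<^sup>2 * \<tau> + l' * u' + 2 * l' * z))" by simp
  hence expo: "of_int m * (?L\<^sup>2 * \<gamma> + ?L * ?U + 2 * ?L * (z / j)) + of_int m * ?e * Z\<^sup>2 / j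
      = of_int m * ?e * z\<^sup>2 / j + of_int m * (l'\<^sup>2 * \<tau> + l' * u' + 2 * l' * z)"
    by (simp only: distrib_left times_divide_eq_right mult.assoc)
  have "g \<gamma> (Z / j) = j powi k * e2pii (of_int m * ?e * Z\<^sup>2 / j) * g \<tau> Z"
    using trans det \<tau> unfolding jacobi_transforms_def \<gamma>_def j_def by blast
  hence "G l u \<gamma> (z / j) = j powi k *
      (e2pii (of_int m * (?L\<^sup>2 * \<gamma> + ?L * ?U + 2 * ?L * (z / j))) * e2pii (of_int m * ?e * Z\<^sup>2 / j)) * g \<tau> Z"
    unfolding G_def arg by (simp only: mult_ac)
  also have "\<dots> = j powi k * (e2pii (of_int m * ?e * z\<^sup>2 / j) * e2pii (of_int m * (l'\<^sup>2 * \<tau> + l' * u' + 2 * l' * z))) * g \<tau> Z"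
    unfolding e2pii_add [symmetric] expo ..
  also have "\<dots> = j powi k * e2pii (of_int m * ?e * z\<^sup>2 / j) * G (l * of_int a + u * of_int e) (l * of_int b + u * of_int d) \<tau> z"
    unfolding G_def l'_def [symmetric] u'_def [symmetric] Z_def by (simp only: mult_ac)
  finally show ?thesis by (simp only: \<gamma>_def)
qed

text \<open>What remains of the elliptic factor after the correction in \<open>G\<close> has a real
  exponent independent of \<tau> and z; so \<open>\<kappa>\<close> is a constant that drops out of
  absolute values.\<close>

lemma G_shift:
  fixes x y :: int
  obtains \<kappa> where "norm \<kappa> = 1"
    "\<And>\<tau> z. Im \<tau> > 0 \<Longrightarrow> G (l + of_int x) (u + of_int y) \<tau> z = \<kappa> * G l u \<tau> z"
proof -
  let ?L = "of_real l :: complex" and ?U = "of_real u :: complex"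
  let ?x = "of_int x :: complex" and ?y = "of_int y :: complex" and ?m = "of_int m :: complex"
  define \<kappa> where "\<kappa> = e2pii (of_real (of_int m * (l * of_int y - of_int x * u + of_int x * of_int y)))"
  have "norm \<kappa> = 1" by (simp add: \<kappa>_def norm_e2pii)
  moreover have "G (l + of_int x) (u + of_int y) \<tau> z = \<kappa> * G l u \<tau> z" if \<tau>: "Im \<tau> > 0" for \<tau> z
  proof -
    have "g \<tau> (z + of_real (l + of_int x) * \<tau> + of_real (u + of_int y)) = g \<tau> ((z + ?L * \<tau> + ?U) + ?x * \<tau> + ?y)"
      by (simp add: algebra_simps)
    also have "\<dots> = e2pii (- ?m * ?x\<^sup>2 * \<tau> - 2 * ?m * ?x * (z + ?L * \<tau> + ?U)) * g \<tau> (z + ?L * \<tau> + ?U)"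
      using trans \<tau> unfolding jacobi_transforms_def by blast
    finally have 1: "g \<tau> (z + of_real (l + of_int x) * \<tau> + of_real (u + of_int y))
        = e2pii (- ?m * ?x\<^sup>2 * \<tau> - 2 * ?m * ?x * (z + ?L * \<tau> + ?U)) * g \<tau> (z + ?L * \<tau> + ?U)" .
    have 2: "?m * (of_real (l + of_int x) ^ 2 * \<tau> + of_real (l + of_int x) * of_real (u + of_int y) + 2 * of_real (l + of_int x) * z)
        + (- ?m * ?x\<^sup>2 * \<tau> - 2 * ?m * ?x * (z + ?L * \<tau> + ?U))
      = of_real (of_int m * (l * of_int y - of_int x * u + of_int x * of_int y)) + ?m * (?L ^ 2 * \<tau> + ?L * ?U + 2 * ?L * z)"
      by (simp add: algebra_simps power2_eq_square)
    show ?thesis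
      unfolding G_def 1 \<kappa>_def mult.assoc [symmetric] e2pii_add [symmetric] 2 ..
  qed
  ultimately show ?thesis using that by blast
qed

section \<open>Growth of the translates at the cusp\<close>

definition fourier_term :: "real \<Rightarrow> real \<Rightarrow> complex \<Rightarrow> complex \<Rightarrow> int \<times> int \<Rightarrow> complex" where
  "fourier_term l u \<tau> z p = e2pii (of_int m * (of_real l ^ 2 * \<tau> + of_real l * of_real u + 2 * of_real l * z)) *
     (c (fst p) (snd p) * e2pii (of_int (fst p) * \<tau>) * e2pii (of_int (snd p) * (z + of_real l * \<tau> + of_real u)))"

lemma has_sum_fourier_term: "Im \<tau> > 0 \<Longrightarrow> (fourier_term l u \<tau> z has_sum G l u \<tau> z) UNIV"
  using fourier unfolding has_fourier_expansion_def fourier_term_def [abs_def] G_def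
  by (intro has_sum_cmult_right) (simp add: case_prod_unfold)

text \<open>After the translation n + r l + m l^2 is the exponent of q and r + 2 m l that of
  \<zeta>.\<close>

lemma norm_fourier_term:
  "norm (fourier_term l u \<tau> z (n, r)) =
     norm (c n r) * exp (- (2 * pi * (Im \<tau> * (of_int n + of_int r * l + of_int m * l\<^sup>2) + (of_int r + 2 * of_int m * l) * Im z)))"
proof -
  have "norm (fourier_term l u \<tau> z (n, r)) = norm (c n r) *
      (exp (- (2 * pi * (of_int m * (l\<^sup>2 * Im \<tau> + 2 * l * Im z)))) * (exp (- (2 * pi * (of_int n * Im \<tau>))) * exp (- (2 * pi * (of_int r * (Im z + l * Im \<tau>))))))"
    by (simp add: fourier_term_def norm_mult norm_e2pii power2_eq_square mult_ac)
  also have "exp (- (2 * pi * (of_int m * (l\<^sup>2 * Im \<tau> + 2 * l * Im z)))) * (exp (- (2 * pi * (of_int n * Im \<tau>))) * exp (- (2 * pi * (of_int r * (Im z + l * Im \<tau>)))))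
      = exp (- (2 * pi * (Im \<tau> * (of_int n + of_int r * l + of_int m * l\<^sup>2) + (of_int r + 2 * of_int m * l) * Im z)))"
    by (simp add: exp_add [symmetric] algebra_simps)
  finally show ?thesis .
qed

text \<open>
  On \<open>|Im z| \<le> 1\<close> and \<open>Im \<tau> \<ge> 1\<close> the terms are dominated by those at \<open>\<tau> = i\<close>, \<open>z = \<plusminus>i\<close>.
\<close>

lemma tail_bound:
  fixes N :: real
  assumes S: "\<And>n r. (n, r) \<in> S \<Longrightarrow> c n r \<noteq> 0 \<Longrightarrow> of_int n + of_int r * l + of_int m * l\<^sup>2 \<ge> N"
  shows "\<exists>B. \<forall>\<tau> z. Im \<tau> \<ge> 1 \<longrightarrow> norm z \<le> 1 \<longrightarrow>
    norm (infsum (fourier_term l u \<tau> z) S) \<le> B * exp (- 2 * pi * N * (Im \<tau> - 1))"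
proof -
  have summ: "(\<lambda>p. norm (fourier_term l u \<tau> z p)) summable_on S" if "Im \<tau> > 0" for \<tau> z
    using has_sum_imp_summable[OF has_sum_fourier_term[OF that, of l u z]]
    unfolding summable_on_iff_abs_summable_on_complex by (rule summable_on_subset_banach) simp
  \<comment> \<open>Both signs of z are needed since r + 2 m l can have either sign. The comparison
    at imaginary part 1 is the source of Im \<tau> - 1 in the bound.\<close>
  define b where "b p = norm (fourier_term l u \<i> \<i> p) + norm (fourier_term l u \<i> (- \<i>) p)" for p
  have b: "b summable_on S" unfolding b_def by (intro summable_on_add summ) auto
  have "norm (infsum (fourier_term l u \<tau> z) S) \<le> infsum b S * exp (- 2 * pi * N * (Im \<tau> - 1))"
    if \<tau>: "Im \<tau> \<ge> 1" and z: "norm z \<le> 1" for \<tau> z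
  proof -
    have \<tau>0: "Im \<tau> > 0" using \<tau> by simp
    have "norm (infsum (fourier_term l u \<tau> z) S) \<le> infsum (\<lambda>p. norm (fourier_term l u \<tau> z p)) S"
      by (rule norm_infsum_bound[OF summ[OF \<tau>0]])
    also have "\<dots> \<le> infsum (\<lambda>p. b p * exp (- 2 * pi * N * (Im \<tau> - 1))) S"
    proof (rule infsum_mono[OF summ[OF \<tau>0]])
      show "(\<lambda>p. b p * exp (- 2 * pi * N * (Im \<tau> - 1))) summable_on S"
        by (rule summable_on_cmult_left[OF b])
      fix p assume p: "p \<in> S"
      obtain n r where nr: "p = (n, r)" by (cases p)
      define E where "E = of_int n + of_int r * l + of_int m * l\<^sup>2"
      define s where "s = of_int r + 2 * of_int m * l"
      show "norm (fourier_term l u \<tau> z p) \<le> b p * exp (- 2 * pi * N * (Im \<tau> - 1))"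
      proof (cases "c n r = 0")
        case True
        thus ?thesis by (simp add: nr norm_fourier_term b_def)
      next
        case False
        have "E \<ge> N" unfolding E_def using S p False nr by blast
        hence "0 \<le> (Im \<tau> - 1) * (E - N)" using \<tau> by simp
        moreover have "- (s * Im z) \<le> \<bar>s\<bar>"
        proof -
          have "\<bar>s * Im z\<bar> \<le> \<bar>s\<bar> * 1"
            unfolding abs_mult using abs_Im_le_cmod[of z] z by (intro mult_left_mono) auto
          thus ?thesis by linarith
        qed
        ultimately have "- (Im \<tau> * E + s * Im z) \<le> - (E - \<bar>s\<bar>) + (- N * (Im \<tau> - 1))"
          by (simp add: algebra_simps)
        hence "2 * pi * (- (Im \<tau> * E + s * Im z)) \<le> 2 * pi * (- (E - \<bar>s\<bar>) + (- N * (Im \<tau> - 1)))"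
          by (rule mult_left_mono) simp
        hence "exp (- (2 * pi * (Im \<tau> * E + s * Im z))) \<le> exp (- (2 * pi * (E - \<bar>s\<bar>)) + (- 2 * pi * N * (Im \<tau> - 1)))"
          unfolding exp_le_cancel_iff by (simp add: algebra_simps)
        also have "\<dots> = exp (- (2 * pi * (E - \<bar>s\<bar>))) * exp (- 2 * pi * N * (Im \<tau> - 1))"
          by (rule exp_add)
        also have "exp (- (2 * pi * (E - \<bar>s\<bar>))) \<le> exp (- (2 * pi * (E + s))) + exp (- (2 * pi * (E - s)))"
          by (cases "s \<ge> 0") auto
        finally have "norm (c n r) * exp (- (2 * pi * (Im \<tau> * E + s * Im z)))
            \<le> norm (c n r) * ((exp (- (2 * pi * (E + s))) + exp (- (2 * pi * (E - s)))) * exp (- 2 * pi * N * (Im \<tau> - 1)))"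
          by (intro mult_left_mono) (auto intro: mult_right_mono)
        thus ?thesis unfolding nr b_def norm_fourier_term E_def [symmetric] s_def [symmetric]
          by (simp add: algebra_simps)
      qed
    qed
    also have "\<dots> = infsum b S * exp (- 2 * pi * N * (Im \<tau> - 1))"
      by (rule infsum_cmult_left) (use b in auto)
    finally show ?thesis .
  qed
  thus ?thesis by blast
qed

text \<open>Completing the square: 4 m times the exponent is 4 n m - r^2 plus a square. The cusp
  condition thus gives positive exponents for every real l, not only for l = 0, and all translates
  stay bounded at the cusp.\<close>

lemma exponent_pos:
  assumes "c n r \<noteq> 0"
  shows "of_int n + of_int r * l + of_int m * l\<^sup>2 > (0::real)"
proof -
  have "real_of_int (4 * n * m - r\<^sup>2) > 0" using support[OF assms] by linarith
  hence "4 * real_of_int n * real_of_int m - (real_of_int r)\<^sup>2 > 0" by simp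
  moreover have "4 * real_of_int m * (of_int n + of_int r * l + of_int m * l\<^sup>2)
      = (4 * real_of_int n * real_of_int m - (real_of_int r)\<^sup>2) + (of_int r + 2 * of_int m * l)\<^sup>2"
    by (simp add: algebra_simps power2_eq_square)
  ultimately have "4 * real_of_int m * (of_int n + of_int r * l + of_int m * l\<^sup>2) > 0"
    by (simp add: add_pos_nonneg)
  thus ?thesis using m_pos by (simp add: zero_less_mult_iff)
qed

lemma G_bounded: "\<exists>B. \<forall>\<tau> z. Im \<tau> \<ge> 1 \<longrightarrow> norm z \<le> 1 \<longrightarrow> norm (G l u \<tau> z) \<le> B"
proof -
  obtain B where B: "\<And>\<tau> z. Im \<tau> \<ge> 1 \<Longrightarrow> norm z \<le> 1 \<Longrightarrow>
      norm (infsum (fourier_term l u \<tau> z) UNIV) \<le> B * exp (- 2 * pi * 0 * (Im \<tau> - 1))"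
    using tail_bound[of UNIV 0 l u] exponent_pos by (meson less_imp_le)
  have "norm (G l u \<tau> z) \<le> B" if "Im \<tau> \<ge> 1" "norm z \<le> 1" for \<tau> z
    using B[OF that] infsumI[OF has_sum_fourier_term[of \<tau> l u z]] that by simp
  thus ?thesis by blast
qed

text \<open>The part of \<open>G 0 u\<close> below q^N: for l = 0 the factor in front of g is 1, and
  the coefficients with n \<le> 0 vanish.\<close>

definition low :: "int \<Rightarrow> real \<Rightarrow> complex \<Rightarrow> complex \<Rightarrow> complex" where
  "low N u \<tau> z = (\<Sum>n\<in>{1..<N}. e2pii (of_int n * \<tau>) * laurent_eval (q_coeff c n) (e2pii (z + of_real u)))"

lemma G_minus_low:
  assumes \<tau>: "Im \<tau> > 0"
  shows "G 0 u \<tau> z - low N u \<tau> z = infsum (fourier_term 0 u \<tau> z) {p. fst p \<ge> N}"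
proof -
  let ?F = "SIGMA n:{1..<N}. Poly_Mapping.keys (q_coeff c n)"
  have "(fourier_term 0 u \<tau> z has_sum sum (fourier_term 0 u \<tau> z) ?F) ?F" by (intro has_sum_finite) auto
  moreover have "(fourier_term 0 u \<tau> z has_sum x) ?F \<longleftrightarrow> (fourier_term 0 u \<tau> z has_sum x) {p. fst p < N}" for x
  proof (rule has_sum_cong_neutral)
    fix p assume "p \<in> {p. fst p < N} - ?F"
    hence "c (fst p) (snd p) = 0"
      using c_nonpos[of "fst p" "snd p"] by (cases p) (auto simp: keys_q_coeff)
    thus "fourier_term 0 u \<tau> z p = 0" by (simp add: fourier_term_def)
  qed auto
  moreover have "sum (fourier_term 0 u \<tau> z) ?F = low N u \<tau> z"
    unfolding low_def laurent_eval_def e2pii_powi sum_distrib_left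
    by (subst sum.Sigma) (auto simp: fourier_term_def lookup_q_coeff mult_ac intro!: sum.cong)
  ultimately have "(fourier_term 0 u \<tau> z has_sum low N u \<tau> z) {p. fst p < N}" by simp
  hence "(fourier_term 0 u \<tau> z has_sum (G 0 u \<tau> z - low N u \<tau> z)) (UNIV - {p. fst p < N})"
    by (intro has_sum_Diff has_sum_fourier_term \<tau>) auto
  also have "UNIV - {p. fst p < N} = {p. fst p \<ge> N}" by auto
  finally show ?thesis by (simp add: infsumI)
qed

lemma low_remainder_bound:
  "\<exists>B. \<forall>\<tau> z. Im \<tau> \<ge> 1 \<longrightarrow> norm z \<le> 1 \<longrightarrow>
     norm (G 0 u \<tau> z - low N u \<tau> z) \<le> B * exp (- 2 * pi * of_int N * (Im \<tau> - 1))"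
proof -
  obtain B where B: "\<And>\<tau> z. Im \<tau> \<ge> 1 \<Longrightarrow> norm z \<le> 1 \<Longrightarrow>
      norm (infsum (fourier_term 0 u \<tau> z) {p. fst p \<ge> N}) \<le> B * exp (- 2 * pi * of_int N * (Im \<tau> - 1))"
    using tail_bound[of "{p. fst p \<ge> N}" "of_int N" 0 u] by auto
  have "norm (G 0 u \<tau> z - low N u \<tau> z) \<le> B * exp (- 2 * pi * of_int N * (Im \<tau> - 1))"
    if "Im \<tau> \<ge> 1" "norm z \<le> 1" for \<tau> z
    using B[OF that] G_minus_low[of \<tau> u z N] that by simp
  thus ?thesis by blast
qed

lemma low_holomorphic: "low N u \<tau> holomorphic_on UNIV"
  unfolding low_def [abs_def] by (intro holomorphic_intros laurent_eval_holomorphic)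

lemma order_ge_low:
  assumes "\<And>n. 1 \<le> n \<Longrightarrow> n < N \<Longrightarrow> order_ge i (\<lambda>z. laurent_eval (q_coeff c n) (e2pii (z + of_real u)))"
  shows "order_ge i (low N u \<tau>)"
  unfolding low_def [abs_def] by (intro order_ge_sum order_ge_cmult assms) auto

text \<open>
  Letting \<open>Im \<tau>\<close> tend to infinity in the remainder after the coefficients below n, divided by
  \<open>q\<^sup>n\<close>, transfers the order of vanishing to the n-th coefficient.
\<close>

lemma order_ge_q_coeff:
  assumes ord: "\<And>\<tau>. Im \<tau> > 0 \<Longrightarrow> order_ge i (G 0 u \<tau>)"
  shows "order_ge i (\<lambda>z. laurent_eval (q_coeff c n) (e2pii (z + of_real u)))"
proof (induction "nat n" arbitrary: n rule: less_induct)
  case less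
  show ?case
  proof (cases "n \<ge> 1")
    case False
    thus ?thesis by (auto simp: q_coeff_nonpos order_ge_def intro!: exI[of _ 0])
  next
    case True
    let ?L = "\<lambda>z. laurent_eval (q_coeff c n) (e2pii (z + of_real u))"
    have ord_low: "order_ge i (low n u \<tau>)" for \<tau>
      by (rule order_ge_low) (use less in auto)
    have low_Suc: "low (n + 1) u \<tau> z = low n u \<tau> z + e2pii (of_int n * \<tau>) * ?L z" for \<tau> z
    proof -
      have "{1..<n + 1} = insert n {1..<n}" using True by auto
      thus ?thesis by (simp add: low_def)
    qed
    obtain B where B: "\<And>\<tau> z. Im \<tau> \<ge> 1 \<Longrightarrow> norm z \<le> 1 \<Longrightarrow>
        norm (G 0 u \<tau> z - low n u \<tau> z) \<le> B * exp (- 2 * pi * of_int n * (Im \<tau> - 1))"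
      using low_remainder_bound[of u n] by blast
    obtain B' where B': "\<And>\<tau> z. Im \<tau> \<ge> 1 \<Longrightarrow> norm z \<le> 1 \<Longrightarrow>
        norm (G 0 u \<tau> z - low (n + 1) u \<tau> z) \<le> B' * exp (- 2 * pi * of_int (n + 1) * (Im \<tau> - 1))"
      using low_remainder_bound[of u "n + 1"] by blast
    have "norm (?L z) \<le> B * exp (2 * pi * of_int n) * norm z ^ i" if z: "norm z \<le> 1" for z
    proof (rule tendsto_le[OF _ _ tendsto_const])
      \<comment> \<open>The first summand comes from the terms from q^n on, whose sum still vanishes
        to order i; the second comes from the terms after q^n and tends to 0.\<close>
      let ?f = "\<lambda>y. B * exp (2 * pi * of_int n) * norm z ^ i + B' * exp (2 * pi * of_int (n + 1)) * exp (- (2 * pi) * y)"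
      have "((\<lambda>y. exp (- (2 * pi) * y)) \<longlongrightarrow> 0) at_top"
        by (intro filterlim_compose[OF exp_at_bot] filterlim_tendsto_neg_mult_at_bot[OF tendsto_const] filterlim_ident) auto
      hence "(?f \<longlongrightarrow> B * exp (2 * pi * of_int n) * norm z ^ i + B' * exp (2 * pi * of_int (n + 1)) * 0) at_top"
        by (intro tendsto_intros)
      thus "(?f \<longlongrightarrow> B * exp (2 * pi * of_int n) * norm z ^ i) at_top" by simp
      show "eventually (\<lambda>y. norm (?L z) \<le> ?f y) at_top"
        using eventually_ge_at_top[of 1]
      proof eventually_elim
        case (elim y)
        define \<tau> where "\<tau> = Complex 0 y"
        have \<tau>: "Im \<tau> \<ge> 1" "Im \<tau> > 0" "Im \<tau> = y" using elim by (auto simp: \<tau>_def)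
        define R where "R z = G 0 u \<tau> z - low n u \<tau> z" for z
        \<comment> \<open>Uniformity in y is essential here: the Schwarz constant does not involve
          the constants hidden in \<open>ord\<close> and \<open>ord_low\<close>.\<close>
        have "norm (R z) \<le> (B * exp (- 2 * pi * of_int n * (y - 1))) * norm z ^ i"
        proof (rule order_ge_Schwarz)
          show "R holomorphic_on UNIV" unfolding R_def [abs_def]
            by (intro holomorphic_intros G_holomorphic low_holomorphic \<tau>)
          show "order_ge i R" unfolding R_def [abs_def] by (intro order_ge_diff ord ord_low \<tau>)
          show "norm (R w) \<le> B * exp (- 2 * pi * of_int n * (y - 1))" if "norm w = 1" for w
            using B[of \<tau> w] \<tau> that by (simp add: R_def)
        qed (rule z)
        moreover have "norm (R z - e2pii (of_int n * \<tau>) * ?L z) \<le> B' * exp (- 2 * pi * of_int (n + 1) * (y - 1))"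
          using B'[of \<tau> z] \<tau> z unfolding low_Suc R_def diff_diff_eq by simp
        moreover have "norm (e2pii (of_int n * \<tau>) * ?L z) = exp (- 2 * pi * of_int n * y) * norm (?L z)"
          by (simp add: norm_mult norm_e2pii \<tau> mult_ac)
        moreover have "norm (e2pii (of_int n * \<tau>) * ?L z) \<le> norm (R z) + norm (R z - e2pii (of_int n * \<tau>) * ?L z)"
          by norm
        ultimately have "exp (- 2 * pi * of_int n * y) * norm (?L z) \<le>
            (B * exp (- 2 * pi * of_int n * (y - 1))) * norm z ^ i + B' * exp (- 2 * pi * of_int (n + 1) * (y - 1))"
          by linarith
        hence "exp (2 * pi * of_int n * y) * (exp (- 2 * pi * of_int n * y) * norm (?L z)) \<le>
            exp (2 * pi * of_int n * y) * ((B * exp (- 2 * pi * of_int n * (y - 1))) * norm z ^ i + B' * exp (- 2 * pi * of_int (n + 1) * (y - 1)))"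
          by (rule mult_left_mono) simp
        moreover have "exp (2 * pi * of_int n * y) * (exp (- 2 * pi * of_int n * y) * norm (?L z)) = norm (?L z)"
          by (simp add: mult.assoc [symmetric] exp_add [symmetric])
        moreover have "exp (2 * pi * of_int n * y) * ((B * exp (- 2 * pi * of_int n * (y - 1))) * norm z ^ i + B' * exp (- 2 * pi * of_int (n + 1) * (y - 1))) = ?f y"
        proof -
          have 1: "exp (2 * pi * of_int n * y) * exp (- 2 * pi * of_int n * (y - 1)) = exp (2 * pi * of_int n)"
            by (simp add: exp_add [symmetric] algebra_simps)
          have 2: "exp (2 * pi * of_int n * y) * exp (- 2 * pi * of_int (n + 1) * (y - 1)) = exp (2 * pi * of_int (n + 1)) * exp (- (2 * pi) * y)"
            by (simp add: exp_add [symmetric] algebra_simps)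
          have 3: "A * ((B * B1) * x + B' * B2) = B * (A * B1) * x + B' * (A * B2)" for A B1 B2 x :: real
            by (simp add: algebra_simps)
          show ?thesis unfolding 3 1 2 by (simp only: mult.assoc)
        qed
        ultimately show ?case by linarith
      qed
    qed simp
    thus ?thesis unfolding order_ge_def by blast
  qed
qed

end

section \<open>Taylor coefficients in z as functions of \<tau>, and their vanishing at torsion
  points\<close>

context jacobi_cusp_form
begin

text \<open>The coefficient is the pointwise limit of G(\<tau>, x) / x^i, holomorphic in \<tau>, as
  x runs through 1, 1/2, 1/3, ... The Schwarz lemma bounds these functions on compact sets, so
  Montel's theorem supplies a holomorphic limit of a subsequence, which has to agree with the
  pointwise one.\<close>

lemma lead_G_holomorphic:
  assumes ord: "\<And>\<tau>. Im \<tau> > 0 \<Longrightarrow> order_ge i (G l u \<tau>)"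
  shows "(\<lambda>\<tau>. lead i (G l u \<tau>)) holomorphic_on {\<tau>. Im \<tau> > 0}"
proof -
  let ?H = "{\<tau>. Im \<tau> > 0}"
  define x :: "nat \<Rightarrow> complex" where "x n = of_real (1 / real (Suc n))" for n
  define F where "F n \<tau> = G l u \<tau> (x n) / x n ^ i" for n \<tau>
  have x0: "x n \<noteq> 0" for n unfolding x_def of_real_eq_0_iff by simp
  have x1: "norm (x n) \<le> 1" for n unfolding x_def norm_of_real by simp
  have hol: "F n holomorphic_on ?H" for n
    unfolding F_def [abs_def] by (intro holomorphic_intros G_holomorphic') (simp add: x0)
  have lim: "(\<lambda>n. F n \<tau>) \<longlonglongrightarrow> lead i (G l u \<tau>)" if "Im \<tau> > 0" for \<tau>
  proof -
    have "x \<longlonglongrightarrow> of_real 0"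
      unfolding x_def [abs_def] by (intro tendsto_of_real LIMSEQ_Suc[OF lim_1_over_n])
    hence "x \<longlonglongrightarrow> 0" by simp
    hence "filterlim x (at 0) sequentially" by (simp add: filterlim_at x0)
    thus ?thesis unfolding F_def
      by (rule filterlim_compose[OF lead_tendsto[OF G_holomorphic[OF that] ord[OF that]]])
  qed
  obtain h s where h: "h holomorphic_on ?H" "strict_mono (s :: nat \<Rightarrow> nat)"
    "\<And>\<tau>. \<tau> \<in> ?H \<Longrightarrow> (\<lambda>n. F (s n) \<tau>) \<longlonglongrightarrow> h \<tau>"
  proof (rule Montel[of ?H "range F" F])
    show "open ?H" by (rule open_halfspace_Im_gt)
    show "f holomorphic_on ?H" if "f \<in> range F" for f using that hol by auto
    show "\<exists>B. \<forall>f\<in>range F. \<forall>\<tau>\<in>K. norm (f \<tau>) \<le> B" if K: "compact K" "K \<subseteq> ?H" for K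
    proof -
      have "compact (K \<times> sphere (0::complex) 1)" using K by (intro compact_Times) auto
      moreover have "continuous_on (K \<times> sphere 0 1) (\<lambda>x. G l u (fst x) (snd x))"
        by (rule continuous_on_subset[OF G_continuous]) (use K in auto)
      ultimately have "bounded ((\<lambda>x. G l u (fst x) (snd x)) ` (K \<times> sphere 0 1))"
        by (intro compact_imp_bounded compact_continuous_image)
      then obtain B where B: "\<And>x. x \<in> K \<times> sphere 0 1 \<Longrightarrow> norm (G l u (fst x) (snd x)) \<le> B"
        unfolding bounded_iff by blast
      have "norm (F n \<tau>) \<le> B" if \<tau>: "\<tau> \<in> K" for n \<tau>
      proof -
        have "Im \<tau> > 0" using K \<tau> by auto
        have "norm (G l u \<tau> (x n)) \<le> B * norm (x n) ^ i"
          by (rule order_ge_Schwarz[OF G_holomorphic ord]) (use \<open>Im \<tau> > 0\<close> B[of "(\<tau>, _)"] \<tau> x1 in auto)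
        thus ?thesis using x0[of n] by (simp add: F_def norm_divide norm_power field_simps)
      qed
      thus ?thesis by blast
    qed
  qed auto
  have "h \<tau> = lead i (G l u \<tau>)" if "\<tau> \<in> ?H" for \<tau>
  proof (rule LIMSEQ_unique[OF h(3)[OF that]])
    show "(\<lambda>n. F (s n) \<tau>) \<longlonglongrightarrow> lead i (G l u \<tau>)"
      using LIMSEQ_subseq_LIMSEQ[OF lim h(2)] that by (simp add: o_def)
  qed
  thus ?thesis using h(1) by (rule holomorphic_transform[rotated])
qed

lemma lead_G_bounded:
  assumes "\<And>\<tau>. Im \<tau> > 0 \<Longrightarrow> order_ge i (G l u \<tau>)"
  shows "\<exists>B. \<forall>\<tau>. Im \<tau> \<ge> 1 \<longrightarrow> norm (lead i (G l u \<tau>)) \<le> B"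
proof -
  obtain B where B: "\<And>\<tau> z. Im \<tau> \<ge> 1 \<Longrightarrow> norm z \<le> 1 \<Longrightarrow> norm (G l u \<tau> z) \<le> B"
    using G_bounded[of l u] by blast
  have "norm (lead i (G l u \<tau>)) \<le> B" if "Im \<tau> \<ge> 1" for \<tau>
    by (rule lead_bound) (use that B G_holomorphic assms in auto)
  thus ?thesis by blast
qed

text \<open>The sum below q^N vanishes to order i + 1 and does not contribute to the i-th Taylor
  coefficient, which is therefore that of the remainder, of size q^N.\<close>

lemma lead_G_decay:
  assumes ord: "\<And>\<tau>. Im \<tau> > 0 \<Longrightarrow> order_ge i (G 0 u \<tau>)"
    and low: "\<And>n. 1 \<le> n \<Longrightarrow> n < N \<Longrightarrow> order_ge (Suc i) (\<lambda>z. laurent_eval (q_coeff c n) (e2pii (z + of_real u)))"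
  shows "\<exists>B. \<forall>\<tau>. Im \<tau> \<ge> 1 \<longrightarrow> norm (lead i (G 0 u \<tau>)) \<le> B * exp (- 2 * pi * of_int N * Im \<tau>)"
proof -
  obtain B where B: "\<And>\<tau> z. Im \<tau> \<ge> 1 \<Longrightarrow> norm z \<le> 1 \<Longrightarrow>
      norm (G 0 u \<tau> z - low N u \<tau> z) \<le> B * exp (- 2 * pi * of_int N * (Im \<tau> - 1))"
    using low_remainder_bound[of u N] by blast
  have "norm (lead i (G 0 u \<tau>)) \<le> (B * exp (2 * pi * of_int N)) * exp (- 2 * pi * of_int N * Im \<tau>)"
    if \<tau>: "Im \<tau> \<ge> 1" for \<tau>
  proof -
    have \<tau>0: "Im \<tau> > 0" using \<tau> by simp
    define R where "R z = G 0 u \<tau> z - low N u \<tau> z" for z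
    have hR: "R holomorphic_on UNIV" unfolding R_def [abs_def]
      by (intro holomorphic_intros G_holomorphic low_holomorphic \<tau>0)
    have ol: "order_ge (Suc i) (low N u \<tau>)" by (rule order_ge_low[OF low])
    have oR: "order_ge i R" unfolding R_def [abs_def]
      by (intro order_ge_diff ord \<tau>0 order_ge_mono[OF ol]) simp
    have "lead i (G 0 u \<tau>) = lead i R"
      using lead_add_higher[OF hR oR low_holomorphic ol] by (simp add: R_def)
    moreover have "norm (lead i R) \<le> B * exp (- 2 * pi * of_int N * (Im \<tau> - 1))"
      by (rule lead_bound[OF hR oR]) (use B[OF \<tau>] in \<open>auto simp: R_def\<close>)
    moreover have "exp (- 2 * pi * of_int N * (Im \<tau> - 1)) = exp (2 * pi * of_int N) * exp (- 2 * pi * of_int N * Im \<tau>)"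
      by (simp add: exp_add [symmetric] algebra_simps)
    ultimately show ?thesis by (simp only: mult.assoc)
  qed
  thus ?thesis by blast
qed

context
  fixes r :: nat
  assumes r: "r > 0"
begin

definition Gv :: "int \<Rightarrow> int \<Rightarrow> complex \<Rightarrow> complex \<Rightarrow> complex" where
  "Gv x y = G (of_int x / of_nat r) (of_int y / of_nat r)"

text \<open>Integer pairs are kept unreduced, so that matrices act on them directly; residues matter
  only where a finite index set is required.\<close>

definition prim :: "int \<Rightarrow> int \<Rightarrow> bool" where
  "prim x y \<longleftrightarrow> (x mod int r, y mod int r) \<in> primvecs r"

lemma prim_alt: "prim x y \<longleftrightarrow> (\<exists>c d. coprime c d \<and> [x = c] (mod int r) \<and> [y = d] (mod int r))"
  by (auto simp: prim_def primvecs_def cong_def)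

lemma prim_coprime: "coprime x y \<Longrightarrow> prim x y"
  unfolding prim_alt by (intro exI[of _ x] exI[of _ y]) simp

lemma prim_action:
  assumes "prim x y" "a * d - b * e = 1"
  shows "prim (x * a + y * e) (x * b + y * d)"
proof -
  obtain p q where pq: "coprime p q" "[x = p] (mod int r)" "[y = q] (mod int r)"
    using assms(1) by (auto simp: prim_alt)
  \<comment> \<open>A common divisor of the new entries divides the old ones, because the adjugate
    matrix undoes the action.\<close>
  have "coprime (p * a + q * e) (p * b + q * d)"
  proof (rule coprimeI)
    fix t assume t: "t dvd p * a + q * e" "t dvd p * b + q * d"
    have "t dvd (p * a + q * e) * d - (p * b + q * d) * e" by (intro dvd_diff dvd_mult2 t)
    also have "(p * a + q * e) * d - (p * b + q * d) * e = p * (a * d - b * e)" by (simp add: algebra_simps)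
    finally have 1: "t dvd p" using assms(2) by simp
    have "t dvd (p * b + q * d) * a - (p * a + q * e) * b" by (intro dvd_diff dvd_mult2 t)
    also have "(p * b + q * d) * a - (p * a + q * e) * b = q * (a * d - b * e)" by (simp add: algebra_simps)
    finally have "t dvd q" using assms(2) by simp
    thus "is_unit t" by (rule coprime_common_divisor[OF pq(1) 1])
  qed
  moreover have "[x * a + y * e = p * a + q * e] (mod int r)" "[x * b + y * d = p * b + q * d] (mod int r)"
    by (intro cong_add cong_mult cong_refl pq)+
  ultimately show ?thesis unfolding prim_alt by blast
qed

lemma Gv_holomorphic: "Im \<tau> > 0 \<Longrightarrow> Gv x y \<tau> holomorphic_on UNIV"
  unfolding Gv_def by (rule G_holomorphic)

lemma Gv_cong:
  assumes "[x = x'] (mod int r)" "[y = y'] (mod int r)"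
  obtains \<kappa> where "norm \<kappa> = 1" "\<And>\<tau>. Im \<tau> > 0 \<Longrightarrow> Gv x y \<tau> = (\<lambda>z. \<kappa> * Gv x' y' \<tau> z)"
proof -
  obtain s t where "x - x' = int r * s" "y - y' = int r * t"
    using assms unfolding cong_iff_dvd_diff by (elim dvdE)
  hence s: "x = x' + int r * s" and t: "y = y' + int r * t" by simp_all
  have eq: "real_of_int x / real r = real_of_int x' / real r + of_int s" "real_of_int y / real r = real_of_int y' / real r + of_int t"
    using r by (simp_all add: s t field_simps)
  show ?thesis
    using G_shift[of "real_of_int x' / real r" s "real_of_int y' / real r" t] that
    unfolding Gv_def eq by (metis ext)
qed

lemma
  assumes cong: "[x = x'] (mod int r)" "[y = y'] (mod int r)"
  assumes \<tau>: "Im \<tau> > 0" and ord: "order_ge i (Gv x' y' \<tau>)"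
  shows order_ge_Gv_cong: "order_ge i (Gv x y \<tau>)"
    and norm_lead_Gv_cong: "norm (lead i (Gv x y \<tau>)) = norm (lead i (Gv x' y' \<tau>))"
proof -
  obtain \<kappa> where \<kappa>: "norm \<kappa> = 1" "Gv x y \<tau> = (\<lambda>z. \<kappa> * Gv x' y' \<tau> z)"
    using Gv_cong[OF cong] \<tau> by metis
  show "order_ge i (Gv x y \<tau>)" unfolding \<kappa>(2) by (rule order_ge_cmult[OF ord])
  have "lead i (Gv x y \<tau>) = \<kappa> * lead i (Gv x' y' \<tau>)"
  proof (rule lead_eqI)
    have "((\<lambda>z. \<kappa> * (Gv x' y' \<tau> z / z ^ i)) \<longlongrightarrow> \<kappa> * lead i (Gv x' y' \<tau>)) (at 0)"
      by (intro tendsto_intros lead_tendsto Gv_holomorphic \<tau> ord)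
    thus "((\<lambda>z. Gv x y \<tau> z / z ^ i) \<longlongrightarrow> \<kappa> * lead i (Gv x' y' \<tau>)) (at 0)"
      by (simp add: \<kappa>(2))
  qed
  thus "norm (lead i (Gv x y \<tau>)) = norm (lead i (Gv x' y' \<tau>))" by (simp add: norm_mult \<kappa>(1))
qed

text \<open>With z replaced by z / j the exponential factor tends to 1 and (z / j)^i contributes
  j^i: taking the i-th coefficient raises the weight by i.\<close>

lemma lead_Gv_modular:
  fixes a b e d :: int
  assumes det: "a * d - b * e = 1" and \<tau>: "Im \<tau> > 0"
  defines "j \<equiv> of_int e * \<tau> + of_int d"
  defines "\<gamma> \<equiv> (of_int a * \<tau> + of_int b) / j"
  assumes j0: "j \<noteq> 0" and \<gamma>: "Im \<gamma> > 0"
    and ord: "order_ge i (Gv x y \<gamma>)" and ord': "order_ge i (Gv (x * a + y * e) (x * b + y * d) \<tau>)"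
  shows "lead i (Gv x y \<gamma>) = j powi (k + int i) * lead i (Gv (x * a + y * e) (x * b + y * d) \<tau>)"
proof -
  let ?h = "Gv x y \<gamma>" and ?h' = "Gv (x * a + y * e) (x * b + y * d) \<tau>"
  have eq: "(of_int x / of_nat r) * of_int a + (of_int y / of_nat r) * of_int e = (of_int (x * a + y * e) / of_nat r :: real)"
    "(of_int x / of_nat r) * of_int b + (of_int y / of_nat r) * of_int d = (of_int (x * b + y * d) / of_nat r :: real)"
    by (simp_all add: add_divide_distrib)
  have h: "?h (z / j) = j powi k * e2pii (of_int m * of_int e * z\<^sup>2 / j) * ?h' z" for z
    unfolding Gv_def eq [symmetric] \<gamma>_def j_def
    by (rule G_modular[OF det \<tau>]) (use j0 in \<open>simp add: j_def\<close>)
  have "((\<lambda>z. z / j) \<longlongrightarrow> 0 / j) (at 0)" using j0 by (intro tendsto_intros) auto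
  hence "filterlim (\<lambda>z. z / j) (at 0) (at 0)"
    using j0 by (simp add: filterlim_at eventually_at_filter)
  from filterlim_compose[OF lead_tendsto[OF Gv_holomorphic[OF \<gamma>] ord] this]
  have 1: "((\<lambda>z. ?h (z / j) / (z / j) ^ i) \<longlongrightarrow> lead i ?h) (at 0)" .
  have "continuous_on UNIV (\<lambda>z. e2pii (of_int m * of_int e * z\<^sup>2 / j))"
    using j0 by (intro continuous_intros) auto
  hence "((\<lambda>z. e2pii (of_int m * of_int e * z\<^sup>2 / j)) \<longlongrightarrow> e2pii (of_int m * of_int e * 0\<^sup>2 / j)) (at 0)"
    unfolding continuous_on_def by (metis UNIV_I)
  hence "((\<lambda>z. e2pii (of_int m * of_int e * z\<^sup>2 / j)) \<longlongrightarrow> 1) (at 0)" by simp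
  hence "((\<lambda>z. (j powi k * j ^ i) * (e2pii (of_int m * of_int e * z\<^sup>2 / j) * (?h' z / z ^ i))) \<longlongrightarrow>
      (j powi k * j ^ i) * (1 * lead i ?h')) (at 0)"
    by (intro tendsto_mult tendsto_const lead_tendsto[OF Gv_holomorphic[OF \<tau>] ord'])
  moreover have "(\<lambda>z. ?h (z / j) / (z / j) ^ i) = (\<lambda>z. (j powi k * j ^ i) * (e2pii (of_int m * of_int e * z\<^sup>2 / j) * (?h' z / z ^ i)))"
    using j0 by (auto simp: h power_divide fun_eq_iff)
  ultimately have "((\<lambda>z. ?h (z / j) / (z / j) ^ i) \<longlongrightarrow> (j powi k * j ^ i) * lead i ?h') (at 0)" by simp
  from tendsto_unique[OF _ 1 this] have "lead i ?h = (j powi k * j ^ i) * lead i ?h'" by simp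
  thus ?thesis using j0 by (simp add: power_int_add)
qed

lemma Im_moebius:
  fixes a b e d :: int
  assumes det: "a * d - b * e = 1" and \<tau>: "Im \<tau> > 0"
  shows "of_int e * \<tau> + of_int d \<noteq> (0 :: complex)"
    and "Im ((of_int a * \<tau> + of_int b) / (of_int e * \<tau> + of_int d)) > 0"
proof -
  let ?j = "of_int e * \<tau> + of_int d :: complex"
  show j: "?j \<noteq> 0"
  proof
    assume j: "?j = 0"
    hence "Im ?j = 0" by simp
    hence "e = 0" using \<tau> by simp
    moreover from this j have "d = 0" by simp
    ultimately show False using det by simp
  qed
  have "real_of_int (a * d - b * e) = 1" by (simp only: det)
  hence "Im ((of_int a * \<tau> + of_int b) / ?j) = Im \<tau> / (norm ?j)\<^sup>2"
    unfolding Im_divide cmod_power2 by (simp add: algebra_simps)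
  thus "Im ((of_int a * \<tau> + of_int b) / ?j) > 0" using j \<tau> by simp
qed

lemma order_ge_Suc_torsion:
  assumes ord: "\<And>x y \<tau>. prim x y \<Longrightarrow> Im \<tau> > 0 \<Longrightarrow> order_ge i (Gv x y \<tau>)"
    and low: "\<And>n. 1 \<le> n \<Longrightarrow> n < N \<Longrightarrow> order_ge (Suc i) (\<lambda>z. laurent_eval (q_coeff c n) (e2pii (z + 1 / of_nat r)))"
    and N: "of_int N > real_of_int (k + int i) * real (card (primvecs r)) / 12"
    and xy: "prim x y" and \<tau>: "Im \<tau> > 0"
  shows "order_ge (Suc i) (Gv x y \<tau>)"
proof -
  define f where "f = (\<lambda>(x, y) \<tau>. lead i (Gv x y \<tau>))"
  \<comment> \<open>\<open>\<sigma>\<close> and \<open>\<rho>\<close> are right multiplication of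
    rows by the generators T and S of the modular group, reduced modulo r.\<close>
  define \<sigma> where "\<sigma> = (\<lambda>(x, y). (x mod int r, (x + y) mod int r))"
  define \<rho> where "\<rho> = (\<lambda>(x, y). (y mod int r, (- x) mod int r))"
  have P: "prim x y" "0 \<le> x" "x < int r" "0 \<le> y" "y < int r" if "(x, y) \<in> primvecs r" for x y
    using that primvecs_subset[OF r] by (auto simp: prim_def)
  have \<sigma>P: "\<sigma> p \<in> primvecs r" and \<rho>P: "\<rho> p \<in> primvecs r" if "p \<in> primvecs r" for p
  proof -
    obtain x y where p: "p = (x, y)" by (cases p)
    have "prim x y" using P that p by blast
    from prim_action[OF this, of 1 1 1 0] prim_action[OF this, of 0 0 "-1" 1]
    show "\<sigma> p \<in> primvecs r" "\<rho> p \<in> primvecs r"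
      by (auto simp: prim_def \<sigma>_def \<rho>_def p)
  qed
  have res_eq: "u = v" if "[u = v] (mod int r)" "0 \<le> u" "u < int r" "0 \<le> v" "v < int r" for u v
    using that by (simp add: cong_def)
  have bij: "bij_betw \<sigma> (primvecs r) (primvecs r)" "bij_betw \<rho> (primvecs r) (primvecs r)"
  proof -
    have "inj_on \<sigma> (primvecs r)"
    proof (rule inj_onI; clarify)
      fix x y x' y' assume 1: "(x, y) \<in> primvecs r" "(x', y') \<in> primvecs r" and eq: "\<sigma> (x, y) = \<sigma> (x', y')"
      have x: "x = x'" using eq P[OF 1(1)] P[OF 1(2)] by (simp add: \<sigma>_def)
      have "[x + y = x + y'] (mod int r)" using eq by (simp add: \<sigma>_def cong_def x)
      hence "[y = y'] (mod int r)" by (simp add: cong_add_lcancel)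
      thus "x = x' \<and> y = y'" using x res_eq P[OF 1(1)] P[OF 1(2)] by blast
    qed
    thus "bij_betw \<sigma> (primvecs r) (primvecs r)"
      unfolding bij_betw_def using \<sigma>P by (intro conjI endo_inj_surj finite_primvecs[OF r]) auto
    have "inj_on \<rho> (primvecs r)"
    proof (rule inj_onI; clarify)
      fix x y x' y' assume 1: "(x, y) \<in> primvecs r" "(x', y') \<in> primvecs r" and eq: "\<rho> (x, y) = \<rho> (x', y')"
      have y: "y = y'" using eq P[OF 1(1)] P[OF 1(2)] by (simp add: \<rho>_def)
      have "[- x = - x'] (mod int r)" using eq by (simp add: \<rho>_def cong_def)
      hence "[x = x'] (mod int r)" by (simp add: cong_minus_minus_iff)
      thus "x = x' \<and> y = y'" using y res_eq P[OF 1(1)] P[OF 1(2)] by blast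
    qed
    thus "bij_betw \<rho> (primvecs r) (primvecs r)"
      unfolding bij_betw_def using \<rho>P by (intro conjI endo_inj_surj finite_primvecs[OF r]) auto
  qed
  have f_mod: "norm (f (x mod int r, y mod int r) \<tau>) = norm (f (x, y) \<tau>)" if "prim x y" "Im \<tau> > 0" for x y \<tau>
    unfolding f_def by (simp, rule norm_lead_Gv_cong) (use that ord in \<open>auto simp: cong_def\<close>)
  have f_modular: "f (x, y) ((of_int a * \<tau> + of_int b) / (of_int e * \<tau> + of_int d)) =
      (of_int e * \<tau> + of_int d) powi (k + int i) * f (x * a + y * e, x * b + y * d) \<tau>"
    if "prim x y" "a * d - b * e = 1" "Im \<tau> > 0" for x y \<tau> and a b e d :: int
    unfolding f_def using that Im_moebius[OF that(2,3)]
    by (simp, intro lead_Gv_modular ord prim_action) auto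
  \<comment> \<open>The reductions are kept because 1 mod r is 0 when r = 1.\<close>
  have p0: "(0 mod int r, 1 mod int r) \<in> primvecs r"
    using prim_coprime[of 0 1] by (simp add: prim_def)
  have prim01: "prim 0 1" by (rule prim_coprime) simp
  have "Gv 0 1 = G 0 (1 / of_nat r)" by (simp add: Gv_def)
  hence "\<exists>B. \<forall>\<tau>. Im \<tau> \<ge> 1 \<longrightarrow> norm (f (0, 1) \<tau>) \<le> B * exp (- 2 * pi * of_int N * Im \<tau>)"
    using lead_G_decay[of i "1 / of_nat r" N] ord[OF prim01] low by (simp add: f_def)
  then obtain B where B: "\<And>\<tau>. Im \<tau> \<ge> 1 \<Longrightarrow> norm (f (0, 1) \<tau>) \<le> B * exp (- 2 * pi * of_int N * Im \<tau>)"
    by blast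
  have "\<exists>p\<in>primvecs r. \<forall>\<tau>. Im \<tau> > 0 \<longrightarrow> f p \<tau> = 0"
  proof (rule sturm_product[OF finite_primvecs[OF r] _ bij(1) _ bij(2) _ _ p0 _ N])
    fix p assume p: "p \<in> primvecs r"
    obtain x y where xy: "p = (x, y)" "prim x y" using P p by (cases p) auto
    have ordp: "\<And>\<tau>. Im \<tau> > 0 \<Longrightarrow> order_ge i (G (of_int x / of_nat r) (of_int y / of_nat r) \<tau>)"
      using ord[OF xy(2)] by (simp add: Gv_def)
    show "f p holomorphic_on {\<tau>. Im \<tau> > 0}"
      using lead_G_holomorphic[OF ordp] by (simp add: f_def xy(1) Gv_def)
    show "\<exists>B. \<forall>\<tau>. Im \<tau> \<ge> 1 \<longrightarrow> norm (f p \<tau>) \<le> B"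
      using lead_G_bounded[OF ordp] by (simp add: f_def xy(1) Gv_def)
    fix \<tau> :: complex assume \<tau>: "Im \<tau> > 0"
    have 1: "prim x (x + y)" using prim_action[OF xy(2), of 1 1 1 0] by simp
    have "f p (\<tau> + 1) = f (x, x + y) \<tau>"
      using f_modular[OF xy(2), of 1 1 1 0 \<tau>] \<tau> by (simp add: xy(1))
    thus "norm (f p (\<tau> + 1)) = norm (f (\<sigma> p) \<tau>)"
      using f_mod[OF 1 \<tau>] by (simp add: \<sigma>_def xy(1))
    have 2: "prim y (- x)" using prim_action[OF xy(2), of 0 0 "-1" 1] by simp
    have "f p (- 1 / \<tau>) = \<tau> powi (k + int i) * f (y, - x) \<tau>"
      using f_modular[OF xy(2), of 0 0 "-1" 1 \<tau>] \<tau> by (simp add: xy(1))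
    thus "norm (f p (- 1 / \<tau>)) = norm \<tau> powi (k + int i) * norm (f (\<rho> p) \<tau>)"
      using f_mod[OF 2 \<tau>] by (simp add: \<rho>_def xy(1) norm_mult norm_power_int)
  next
    show "norm (f (0 mod int r, 1 mod int r) \<tau>) \<le> B * exp (- 2 * pi * of_int N * Im \<tau>)"
      if "Im \<tau> \<ge> 1" for \<tau>
      using B[OF that] f_mod[OF prim01, of \<tau>] that by simp
  qed
  then obtain p where p: "p \<in> primvecs r" "\<And>\<tau>. Im \<tau> > 0 \<Longrightarrow> f p \<tau> = 0" by blast
  then obtain e d where ed: "p = (e mod int r, d mod int r)" "coprime e d" by (auto simp: primvecs_def)
  have ed0: "f (e, d) \<tau> = 0" if "Im \<tau> > 0" for \<tau>
    using f_mod[OF prim_coprime[OF ed(2)] that] p(2)[OF that] ed(1) by simp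
  have f01: "f (0, 1) \<tau> = 0" if \<tau>: "Im \<tau> > 0" for \<tau>
  proof -
    \<comment> \<open>The resulting matrix sends the row (e, d) to (0, 1); the second one below
      sends (0, 1) to (e', d'). Since the coefficient vanishes for all \<tau>, moving \<tau> by the
      matrix does no harm.\<close>
    obtain s t where st: "s * e + t * d = 1" using ed(2) bezout_int[of e d] by auto
    have det: "d * t - s * (- e) = 1" using st by (simp add: algebra_simps)
    let ?j = "of_int (- e) * \<tau> + of_int t" and ?\<gamma> = "(of_int d * \<tau> + of_int s) / (of_int (- e) * \<tau> + of_int t)"
    have "f (e, d) ?\<gamma> = ?j powi (k + int i) * f (e * d + d * (- e), e * s + d * t) \<tau>"
      by (rule f_modular[OF prim_coprime[OF ed(2)] det \<tau>])
    moreover have "e * d + d * (- e) = 0" "e * s + d * t = 1" using st by (simp_all add: algebra_simps)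
    ultimately show ?thesis using ed0[OF Im_moebius(2)[OF det \<tau>]] Im_moebius(1)[OF det \<tau>]
      by (auto simp: power_int_eq_0_iff)
  qed
  obtain e' d' where ed': "coprime e' d'" "[x = e'] (mod int r)" "[y = d'] (mod int r)"
    using xy by (auto simp: prim_alt)
  obtain s t where st: "s * e' + t * d' = 1" using ed'(1) bezout_int[of e' d'] by auto
  have det: "t * d' - (- s) * e' = 1" using st by (simp add: algebra_simps)
  have "f (e', d') \<tau> = 0"
    using f_modular[OF prim01 det \<tau>] f01[OF Im_moebius(2)[OF det \<tau>]] Im_moebius(1)[OF det \<tau>]
    by (auto simp: power_int_eq_0_iff)
  hence "lead i (Gv e' d' \<tau>) = 0" by (simp add: f_def)
  hence "order_ge (Suc i) (Gv e' d' \<tau>)"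
    by (intro order_ge_Suc Gv_holomorphic ord \<tau> prim_coprime ed')
  thus ?thesis by (rule order_ge_Gv_cong[OF ed'(2,3) \<tau>])
qed

lemma order_ge_torsion:
  assumes low: "\<And>n. 1 \<le> n \<Longrightarrow> n < N \<Longrightarrow> order_ge \<nu> (\<lambda>z. laurent_eval (q_coeff c n) (e2pii (z + 1 / of_nat r)))"
    and N: "\<And>i. i < \<nu> \<Longrightarrow> of_int N > real_of_int (k + int i) * real (card (primvecs r)) / 12"
    and "prim x y" "Im \<tau> > 0"
  shows "order_ge \<nu> (Gv x y \<tau>)"
proof -
  have *: "order_ge i (Gv x y \<tau>)" if "i \<le> \<nu>" "prim x y" "Im \<tau> > 0" for i x y \<tau>
    using that
  proof (induction i arbitrary: x y \<tau>)
    case 0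
    show ?case by (rule order_ge_0[OF Gv_holomorphic[OF 0(3)]])
  next
    case (Suc i)
    have IH: "\<And>x y \<tau>. prim x y \<Longrightarrow> Im \<tau> > 0 \<Longrightarrow> order_ge i (Gv x y \<tau>)"
      by (rule Suc.IH) (use Suc.prems(1) in simp_all)
    have low': "\<And>n. 1 \<le> n \<Longrightarrow> n < N \<Longrightarrow> order_ge (Suc i) (\<lambda>z. laurent_eval (q_coeff c n) (e2pii (z + 1 / of_nat r)))"
      using low Suc.prems(1) by (blast intro: order_ge_mono)
    have N': "of_int N > real_of_int (k + int i) * real (card (primvecs r)) / 12"
      by (rule N) (use Suc.prems(1) in simp)
    show ?case by (rule order_ge_Suc_torsion[OF IH low' N' Suc.prems(2,3)])
  qed
  show ?thesis by (rule *[OF order_refl assms(3,4)])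
qed

lemma bound_q_coeff_torsion:
  assumes low: "\<And>n. 1 \<le> n \<Longrightarrow> n < N \<Longrightarrow> order_ge \<nu> (\<lambda>z. laurent_eval (q_coeff c n) (e2pii (z + 1 / of_nat r)))"
    and N: "\<And>i. i < \<nu> \<Longrightarrow> of_int N > real_of_int (k + int i) * real (card (primvecs r)) / 12"
    and j: "coprime j r"
  shows "order_ge \<nu> (\<lambda>z. laurent_eval (q_coeff c n) (e2pii (z + of_nat j / of_nat r)))"
proof -
  have "coprime (int r) (int j)" using j by (simp add: coprime_commute)
  \<comment> \<open>0 and j are coprime only for j = 1, so the congruent pair (r, j) is
    used.\<close>
  hence "prim 0 (int j)" unfolding prim_alt by (intro exI[of _ "int r"] exI[of _ "int j"]) (auto simp: cong_def)
  hence "order_ge \<nu> (G 0 (of_nat j / of_nat r) \<tau>)" if "Im \<tau> > 0" for \<tau>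
    using order_ge_torsion[OF low N, of 0 "int j" \<tau>] that by (simp add: Gv_def)
  from order_ge_q_coeff[OF this] show ?thesis by simp
qed

end

section \<open>Divisibility of all coefficients\<close>

text \<open>X stands for either of the two bounds; all that matters is that it dominates the number
  of torsion points. Each r is treated with its own bound, and the maximum is at least as
  large.\<close>

lemma baby_theta_block_dvd_all:
  fixes X :: "nat \<Rightarrow> real"
  assumes fin: "finite {r. \<nu> r \<noteq> 0}" and nonneg: "\<And>r. r > 0 \<Longrightarrow> \<nu> r \<ge> 0"
    and X: "\<And>r. r > 0 \<Longrightarrow> real (card (primvecs r)) \<le> X r"
    and dvd: "\<And>n::int. real_of_int n \<le> (MAX r\<in>{r. r \<ge> 1 \<and> \<nu> r > 0}. real_of_int (k + \<nu> r - 1) / 12 * X r) \<Longrightarrow>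
      baby_theta_block \<nu> dvd q_coeff c n"
  shows "baby_theta_block \<nu> dvd q_coeff c n"
proof (rule baby_theta_block_dvdI[OF fin nonneg])
  \<comment> \<open>If no \<nu>(r) is positive, the \<open>MAX\<close> ranges over the empty set and
    has no specified value; in that case there is no such r and nothing to check.\<close>
  fix r j assume r: "r \<ge> 1" "\<nu> r > 0" and j: "j \<in> totatives r"
  let ?b = "\<lambda>r. real_of_int (k + \<nu> r - 1) / 12 * X r"
  have "finite {r. r \<ge> 1 \<and> \<nu> r > 0}" by (rule finite_subset[OF _ fin]) auto
  hence le: "?b r \<le> (MAX r\<in>{r. r \<ge> 1 \<and> \<nu> r > 0}. ?b r)" using r by (intro Max_ge) auto
  \<comment> \<open>The least integer that exceeds the bound and is at least 1. The bound can be
    negative, and N must be positive even then.\<close>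
  define N where "N = max 1 (\<lfloor>?b r\<rfloor> + 1)"
  have r0: "r > 0" using r by simp
  have "1 \<in> totatives r" using r0 by (simp add: totatives_def)
  have "order_ge (nat (\<nu> r)) (\<lambda>z. laurent_eval (q_coeff c n) (e2pii (z + of_nat j / of_nat r)))"
  proof (rule bound_q_coeff_torsion[OF r0])
    show "coprime j r" using j by (simp add: totatives_def)
    fix n assume n: "1 \<le> n" "n < N"
    hence "n \<le> \<lfloor>?b r\<rfloor>" by (simp add: N_def)
    hence "real_of_int n \<le> (MAX r\<in>{r. r \<ge> 1 \<and> \<nu> r > 0}. ?b r)" using le by linarith
    from baby_theta_block_dvd_imp_factor[OF fin r \<open>1 \<in> totatives r\<close> dvd[OF this]]
    obtain h where h: "h holomorphic_on UNIV" "\<And>z. laurent_eval (q_coeff c n) (e2pii (z + of_nat 1 / of_nat r)) = z ^ nat (\<nu> r) * h z"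
      by metis
    show "order_ge (nat (\<nu> r)) (\<lambda>z. laurent_eval (q_coeff c n) (e2pii (z + 1 / of_nat r)))"
      using order_ge_factorI[OF h(1), of "\<lambda>z. laurent_eval (q_coeff c n) (e2pii (z + 1 / of_nat r))"] h(2) by simp
  next
    fix i assume i: "i < nat (\<nu> r)"
    show "real_of_int (k + int i) * real (card (primvecs r)) / 12 < of_int N"
    \<comment> \<open>For nonnegative weight the inequalities i \<le> \<nu>(r) - 1 and card \<le> X
      can be multiplied; for negative weight the left-hand side is at most 0.\<close>
    proof (cases "k + int i \<ge> 0")
      case True
      have "real_of_int (k + int i) * real (card (primvecs r)) \<le> real_of_int (k + \<nu> r - 1) * X r"
        using True i X[OF r0] by (intro mult_mono) auto
      hence "real_of_int (k + int i) * real (card (primvecs r)) / 12 \<le> ?b r" by simp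
      also have "?b r < of_int (\<lfloor>?b r\<rfloor> + 1)" by linarith
      also have "\<dots> \<le> of_int N" unfolding of_int_le_iff N_def by simp
      finally show ?thesis .
    next
      case False
      hence "real_of_int (k + int i) * real (card (primvecs r)) \<le> 0"
        by (intro mult_nonpos_nonneg) auto
      moreover have "real_of_int N \<ge> 1" by (simp add: N_def)
      ultimately show ?thesis by linarith
    qed
  qed
  thus "\<exists>C. \<forall>z. norm z \<le> 1 \<longrightarrow> norm (laurent_eval (q_coeff c n) (e2pii (z + of_nat j / of_nat r))) \<le> C * norm z ^ nat (\<nu> r)"
    by (simp add: order_ge_def)
qed

end

lemma jacobi_cusp_form_of_cusp:
  assumes "m > 0" "g \<in> jacobi_cusp k m" "has_fourier_expansion g c"
  shows "jacobi_cusp_form k m g c"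
proof -
  obtain c' where c': "has_fourier_expansion g c'"
    "\<And>n r. c' n r \<noteq> 0 \<Longrightarrow> (if m = 0 then n > 0 \<and> r = 0 else 4 * n * m - r\<^sup>2 > 0)"
    and g: "holomorphic_HC g" "jacobi_transforms k m g"
    using assms(2) unfolding jacobi_cusp_def by blast
  have "c = c'" by (rule fourier_expansion_unique[OF assms(3) c'(1)])
  thus ?thesis using assms g c'(2) by unfold_locales auto
qed

theorem theorem6p4:
  fixes k m m' :: int
    and g \<theta> :: "complex \<Rightarrow> complex \<Rightarrow> complex"
    and c :: "int \<Rightarrow> int \<Rightarrow> complex"
    and \<nu> :: "nat \<Rightarrow> int"
  assumes "m > 0"
    and "g \<in> jacobi_cusp k m"
    and "has_fourier_expansion g c"
    and "0 \<le> m'" and "m' < m"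
    and "\<theta> \<in> jacobi_cusp k m'"
    and "basic_theta_block \<theta>"
    and "finite {r. \<nu> r \<noteq> 0}"
    and "\<And>r. r > 0 \<Longrightarrow> \<nu> r \<ge> 0"
    and "eq_off_torsion \<theta> (theta_block \<nu>)"
  shows "(fps_const (baby_theta_block \<nu>) dvd q_expansion c \<longleftrightarrow>
           (\<forall>n::int. real_of_int n \<le>
               (MAX r\<in>{r. r \<ge> 1 \<and> \<nu> r > 0}.
                 real_of_int (k + \<nu> r - 1) / 12 * real (SL2Z_index (Gamma_rm r m))) \<longrightarrow>
             baby_theta_block \<nu> dvd q_coeff c n))
       \<and> ((\<forall>n::int. real_of_int n \<le>
               (MAX r\<in>{r. r \<ge> 1 \<and> \<nu> r > 0}.
                 real_of_int (k + \<nu> r - 1) / 12 *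
                   (real r ^ 3 * (\<Prod>p\<in>prime_factors r. 1 - 1 / (real p)\<^sup>2))) \<longrightarrow>
             baby_theta_block \<nu> dvd q_coeff c n)
         \<longrightarrow> fps_const (baby_theta_block \<nu>) dvd q_expansion c \<and>
           (\<forall>n::int. real_of_int n \<le>
               (MAX r\<in>{r. r \<ge> 1 \<and> \<nu> r > 0}.
                 real_of_int (k + \<nu> r - 1) / 12 * real (SL2Z_index (Gamma_rm r m))) \<longrightarrow>
             baby_theta_block \<nu> dvd q_coeff c n))"
proof -
  interpret jacobi_cusp_form k m g c
    by (rule jacobi_cusp_form_of_cusp[OF assms(1-3)])
  have all: "fps_const (baby_theta_block \<nu>) dvd q_expansion c \<longleftrightarrow> (\<forall>n. baby_theta_block \<nu> dvd q_coeff c n)"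
  proof -
    \<comment> \<open>The power series records n \<ge> 0 only, but the other coefficients are
      0.\<close>
    have "(\<forall>n::nat. baby_theta_block \<nu> dvd q_coeff c (int n)) \<longleftrightarrow> (\<forall>n. baby_theta_block \<nu> dvd q_coeff c n)"
      by (metis dvd_0_right nonneg_int_cases linorder_linear q_coeff_nonpos)
    thus ?thesis by (simp add: fps_const_dvd_iff q_expansion_def)
  qed
  have index: "real (card (primvecs r)) \<le> real (SL2Z_index (Gamma_rm r m))" if "r > 0" for r
    using card_primvecs_le_index[OF that] by simp
  have jordan: "real (card (primvecs r)) \<le> real r ^ 3 * (\<Prod>p\<in>prime_factors r. 1 - 1 / (real p)\<^sup>2)" if "r > 0" for r
  proof -
    have "real (card (primvecs r)) \<le> real (r\<^sup>2)" using card_primvecs_le[OF that] by (rule of_nat_mono)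
    also have "\<dots> = (real r)\<^sup>2" by simp
    also note square_le_jordan_bound[OF that]
    finally show ?thesis .
  qed
  \<comment> \<open>Either bounded condition yields divisibility of every coefficient, and that
    implies all the assertions.\<close>
  show ?thesis
    unfolding all
    using baby_theta_block_dvd_all[of \<nu>, OF assms(8,9) index]
      baby_theta_block_dvd_all[of \<nu>, OF assms(8,9) jordan] by blast
qed

end
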